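(* Let $k$ be a field and let $\phi: C_1 \rightarrow C_2$ be a morphism over $k$ of curves, embedded as projectively normal models $C_1 \subset \mathbb{P}^{m}$ and $C_2\subset \mathbb{P}^r$ by invertible sheaves $\mathcal{L}_1$ and $\mathcal{L}_2$, respectively. Let $n\ge 0$ be an integer. Then $\phi$ is given by a complete tuple $\mathfrak{s} = (f_0,\dots,f_r)$ of defining polynomials of degree $n$ if and only if $\phi^*\mathcal{L}_2 \cong \mathcal{L}_1^{n}$. If such a complete tuple $\mathfrak{s}$ exists, it is unique in $k[C_1]^{r+1}$ up to a scalar multiple.
   Context: Curves are nonsingular, projective and geometrically integral over $k$. A curve $C\subset \mathbb{P}^m$ is embedded by the invertible sheaf $\mathcal{L}=\iota^*\mathcal{O}_{\mathbb{P}^m}(1)$, where $\iota$ is the inclusion, and $\mathcal{L}^n$ denotes $\mathcal{L}^{\otimes n}$. The model is projectively normal if for every $n\ge 0$ the restriction map $\Gamma(\mathbb{P}^m,\mathcal{O}(n))\to\Gamma(C,\mathcal{L}^n)$ is surjective; thus the homogeneous coordinate ring is $k[C]=k[X_0,\dots,X_m]/I_C=\bigoplus_{n\ge0}\Gamma(C,\mathcal{L}^n)$, and polynomials of degree $n$ (modulo the ideal $I_C$) are identified with elements of $\Gamma(C,\mathcal{L}^n)$. A tuple of defining polynomials of degree $n$ for $\phi:C_1\to C_2\subset\mathbb{P}^r$ is a tuple $(f_0,\dots,f_r)$ of elements of $\Gamma(C_1,\mathcal{L}_1^n)\subset k[C_1]$, not all zero, such that $\phi(P)=(f_0(P):\cdots:f_r(P))$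 at every point $P$ where the $f_i$ do not all vanish (i.e. it defines $\phi$ as a rational map). The tuple is complete if the exceptional set $\{P\in C_1(\bar k) : f_0(P)=\cdots=f_r(P)=0\}$ is empty. *)

theory Defs
  imports
    "HOL-Algebra.Algebra"
    "HOL-Algebra.Algebraic_Closure_Type"
    "HOL-Analysis.Abstract_Topology"
    "HOL-Library.Multiset"
    "HOL-Library.Extended_Nat"
    "HOL-Library.Poly_Mapping"
begin

section \<open>Dimension and regular local rings\<close>

definition chain_length :: "'a set set \<Rightarrow> enat" where
  "chain_length \<A> = Sup {enat d |d. \<exists>c. (\<forall>i\<le>d. c i \<in> \<A>) \<and> (\<forall>i<d. c i \<subset> c (Suc i))}"

definition krull_dim :: "('a, 'b) ring_scheme \<Rightarrow> enat" where
  "krull_dim R = chain_length {\<pp>. primeideal \<pp> R}"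

definition irreducible_closed :: "'a topology \<Rightarrow> 'a set \<Rightarrow> bool" where
  "irreducible_closed T Z \<longleftrightarrow> closedin T Z \<and> Z \<noteq> {} \<and>
     (\<forall>A B. closedin T A \<and> closedin T B \<and> Z \<subseteq> A \<union> B \<longrightarrow> Z \<subseteq> A \<or> Z \<subseteq> B)"

definition topological_dim :: "'a topology \<Rightarrow> enat" where
  "topological_dim T = chain_length {Z. irreducible_closed T Z}"

definition regular_local_ring :: "('a, 'b) ring_scheme \<Rightarrow> bool" where
  "regular_local_ring R \<longleftrightarrow> cring R \<and> noetherian_ring R \<and>
     (\<exists>\<mm>. maximalideal \<mm> R \<and> (\<forall>\<nn>. maximalideal \<nn> R \<longrightarrow> \<nn> = \<mm>) \<and>
       (\<exists>S. finite S \<and> S \<subseteq> carrier R \<and> genideal R S = \<mm> \<and> enat (card S) = krull_dim R))"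


section \<open>Sheaves of modules\<close>

text \<open>
  A variety is treated as a topological space with a sheaf of functions with values in a field;
  functions on \<open>U\<close> are extensional, so that their restriction to \<open>V\<close> is \<^const>\<open>restrict\<close>.
\<close>

record ('a, 'f) fun_space =
  topo :: "'a topology"
  regular :: "'a set \<Rightarrow> ('a \<Rightarrow> 'f) set"

text \<open>
  Since \<^typ>\<open>('r, 'm) module\<close> extends \<^typ>\<open>'m ring\<close>, the same record serves for the structure sheaf
  (where the ring operations are meaningful) and for sheaves of modules over it (where
  the fields \<^const>\<open>monoid.mult\<close> and \<^const>\<open>monoid.one\<close> are irrelevant).
\<close>

record ('a, 'r, 'm) mod_sheaf =
  sections :: "'a set \<Rightarrow> ('r, 'm) module"
  res :: "'a set \<Rightarrow> 'a set \<Rightarrow> 'm \<Rightarrow> 'm"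

definition structure_sheaf ::
    "('a, 'f::field) fun_space \<Rightarrow> ('a, 'a \<Rightarrow> 'f, 'a \<Rightarrow> 'f) mod_sheaf" where
  "structure_sheaf Z = \<lparr>
     sections = (\<lambda>U. \<lparr>carrier = regular Z U,
        monoid.mult = (\<lambda>s t. \<lambda>x\<in>U. s x * t x), one = (\<lambda>x\<in>U. 1),
        ring.zero = (\<lambda>x\<in>U. 0), ring.add = (\<lambda>s t. \<lambda>x\<in>U. s x + t x),
        module.smult = (\<lambda>s t. \<lambda>x\<in>U. s x * t x)\<rparr>),
     res = (\<lambda>U V s. restrict s V)\<rparr>"

definition sheaf_iso ::
    "('a, 'f::field) fun_space \<Rightarrow> ('a, 'a \<Rightarrow> 'f, 'm) mod_sheaf \<Rightarrow> ('a, 'a \<Rightarrow> 'f, 'n) mod_sheaf \<Rightarrow> bool"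
  where
  "sheaf_iso Z F G \<longleftrightarrow> (\<exists>\<psi>. \<forall>U. openin (topo Z) U \<longrightarrow>
     bij_betw (\<psi> U) (carrier (sections F U)) (carrier (sections G U)) \<and>
     (\<forall>s\<in>carrier (sections F U). \<forall>t\<in>carrier (sections F U).
        \<psi> U (s \<oplus>\<^bsub>sections F U\<^esub> t) = \<psi> U s \<oplus>\<^bsub>sections G U\<^esub> \<psi> U t) \<and>
     (\<forall>a\<in>regular Z U. \<forall>s\<in>carrier (sections F U).
        \<psi> U (a \<odot>\<^bsub>sections F U\<^esub> s) = a \<odot>\<^bsub>sections G U\<^esub> \<psi> U s) \<and>
     (\<forall>V s. openin (topo Z) V \<and> V \<subseteq> U \<and> s \<in> carrier (sections F U) \<longrightarrow>
        \<psi> V (res F U V s) = res G U V (\<psi> U s)))"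

definition space_morphism ::
    "('a, 'f) fun_space \<Rightarrow> ('b, 'f) fun_space \<Rightarrow> ('a \<Rightarrow> 'b) \<Rightarrow> bool" where
  "space_morphism Z Y \<phi> \<longleftrightarrow> continuous_map (topo Z) (topo Y) \<phi> \<and>
     (\<forall>V s. openin (topo Y) V \<and> s \<in> regular Y V \<longrightarrow>
        (\<lambda>x\<in>{x \<in> topspace (topo Z). \<phi> x \<in> V}. s (\<phi> x))
          \<in> regular Z {x \<in> topspace (topo Z). \<phi> x \<in> V})"


subsection \<open>Stalks\<close>

type_synonym ('a, 'm) germ = "('a set \<times> 'm) set"

definition germ_at ::
    "'a topology \<Rightarrow> ('a, 'r, 'm) mod_sheaf \<Rightarrow> 'a \<Rightarrow> 'a set \<Rightarrow> 'm \<Rightarrow> ('a, 'm) germ" where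
  "germ_at T F x U s = {(V, t). openin T V \<and> x \<in> V \<and> t \<in> carrier (sections F V) \<and>
     (\<exists>W. openin T W \<and> x \<in> W \<and> W \<subseteq> U \<inter> V \<and> res F U W s = res F V W t)}"

definition stalk ::
    "('a, 'f::field) fun_space \<Rightarrow> ('a, 'a \<Rightarrow> 'f, 'm) mod_sheaf \<Rightarrow> 'a
      \<Rightarrow> (('a, 'a \<Rightarrow> 'f) germ, ('a, 'm) germ) module" where
  "stalk Z F x = (let g = germ_at (topo Z) F x; E = topspace (topo Z) in \<lparr>
     carrier = {g U s |U s. openin (topo Z) U \<and> x \<in> U \<and> s \<in> carrier (sections F U)},
     monoid.mult = (\<lambda>A B. \<Union>(U, s)\<in>A. \<Union>(V, t)\<in>B.
        g (U \<inter> V) (res F U (U \<inter> V) s \<otimes>\<^bsub>sections F (U \<inter> V)\<^esub> res F V (U \<inter> V) t)),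
     one = g E \<one>\<^bsub>sections F E\<^esub>,
     ring.zero = g E \<zero>\<^bsub>sections F E\<^esub>,
     ring.add = (\<lambda>A B. \<Union>(U, s)\<in>A. \<Union>(V, t)\<in>B.
        g (U \<inter> V) (res F U (U \<inter> V) s \<oplus>\<^bsub>sections F (U \<inter> V)\<^esub> res F V (U \<inter> V) t)),
     module.smult = (\<lambda>A B. \<Union>(U, a)\<in>A. \<Union>(V, t)\<in>B.
        g (U \<inter> V) (restrict a (U \<inter> V) \<odot>\<^bsub>sections F (U \<inter> V)\<^esub> res F V (U \<inter> V) t))\<rparr>)"

abbreviation local_ring ::
    "('a, 'f::field) fun_space \<Rightarrow> 'a \<Rightarrow> (('a, 'a \<Rightarrow> 'f) germ, ('a, 'a \<Rightarrow> 'f) germ) module" where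
  "local_ring Z x \<equiv> stalk Z (structure_sheaf Z) x"

definition germ_comap ::
    "('a, 'f::field) fun_space \<Rightarrow> ('b, 'f) fun_space \<Rightarrow> ('a \<Rightarrow> 'b) \<Rightarrow> 'a
      \<Rightarrow> ('b, 'b \<Rightarrow> 'f) germ \<Rightarrow> ('a, 'a \<Rightarrow> 'f) germ" where
  "germ_comap Z Y \<phi> x A = (\<Union>(V, s)\<in>A. let U = {y \<in> topspace (topo Z). \<phi> y \<in> V} in
     germ_at (topo Z) (structure_sheaf Z) x U (\<lambda>y\<in>U. s (\<phi> y)))"


subsection \<open>Tensor powers with extension of scalars\<close>

text \<open>
  For a ring homomorphism \<open>h : R \<rightarrow> S\<close> and an \<open>R\<close>-module \<open>M\<close>, the \<open>S\<close>-module
  \<open>S \<otimes>\<^sub>R (M \<otimes>\<^sub>R \<dots> \<otimes>\<^sub>R M)\<close> (\<open>n\<close> factors \<open>M\<close>) is presented by generators and relations: the multiset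
  of pairs \<open>(a, [x\<^sub>1, \<dots>, x\<^sub>n])\<close> stands for the sum of the \<open>a \<otimes> (x\<^sub>1 \<otimes> \<dots> \<otimes> x\<^sub>n)\<close>.
  The \<open>n\<close> factors are taken at once, since iterating a binary tensor product would make the
  type depend on \<open>n\<close>. For \<open>n = 1\<close> this is \<open>S \<otimes>\<^sub>R M\<close>; for \<open>h = id\<close> it is the \<open>n\<close>-th tensor power
  of \<open>M\<close> (which is \<open>R\<close> if \<open>n = 0\<close>).
\<close>

definition formal_sums ::
    "('s, 'c) ring_scheme \<Rightarrow> ('m, 'd) ring_scheme \<Rightarrow> nat \<Rightarrow> ('s \<times> 'm list) multiset set" where
  "formal_sums S M n =
     {u. \<forall>(a, xs)\<in>set_mset u. a \<in> carrier S \<and> length xs = n \<and> set xs \<subseteq> carrier M}"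

inductive tensor_eq ::
    "('s, 'c) ring_scheme \<Rightarrow> ('r \<Rightarrow> 's) \<Rightarrow> ('r, 'e) ring_scheme \<Rightarrow> ('r, 'm) module \<Rightarrow> nat
      \<Rightarrow> ('s \<times> 'm list) multiset \<Rightarrow> ('s \<times> 'm list) multiset \<Rightarrow> bool"
  for S h R M n where
  refl: "u \<in> formal_sums S M n \<Longrightarrow> tensor_eq S h R M n u u"
| sym: "tensor_eq S h R M n u v \<Longrightarrow> tensor_eq S h R M n v u"
| trans: "tensor_eq S h R M n u v \<Longrightarrow> tensor_eq S h R M n v w \<Longrightarrow> tensor_eq S h R M n u w"
| cong: "tensor_eq S h R M n u v \<Longrightarrow> w \<in> formal_sums S M n \<Longrightarrow>
    tensor_eq S h R M n (u + w) (v + w)"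
| coeff_zero: "{#(\<zero>\<^bsub>S\<^esub>, xs)#} \<in> formal_sums S M n \<Longrightarrow>
    tensor_eq S h R M n {#(\<zero>\<^bsub>S\<^esub>, xs)#} {#}"
| coeff_add: "{#(a, xs), (b, xs)#} \<in> formal_sums S M n \<Longrightarrow>
    tensor_eq S h R M n {#(a \<oplus>\<^bsub>S\<^esub> b, xs)#} {#(a, xs), (b, xs)#}"
| slot_add: "{#(a, xs @ x # ys), (a, xs @ y # ys)#} \<in> formal_sums S M n \<Longrightarrow>
    tensor_eq S h R M n {#(a, xs @ (x \<oplus>\<^bsub>M\<^esub> y) # ys)#} {#(a, xs @ x # ys), (a, xs @ y # ys)#}"
| slot_smult: "{#(a, xs @ x # ys)#} \<in> formal_sums S M n \<Longrightarrow> c \<in> carrier R \<Longrightarrow>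
    tensor_eq S h R M n {#(a, xs @ (c \<odot>\<^bsub>M\<^esub> x) # ys)#} {#(a \<otimes>\<^bsub>S\<^esub> h c, xs @ x # ys)#}"

definition tensor_class ::
    "('s, 'c) ring_scheme \<Rightarrow> ('r \<Rightarrow> 's) \<Rightarrow> ('r, 'e) ring_scheme \<Rightarrow> ('r, 'm) module \<Rightarrow> nat
      \<Rightarrow> ('s \<times> 'm list) multiset \<Rightarrow> ('s \<times> 'm list) multiset set" where
  "tensor_class S h R M n u = {v. tensor_eq S h R M n u v}"

definition tensor ::
    "('s, 'c) ring_scheme \<Rightarrow> ('r \<Rightarrow> 's) \<Rightarrow> ('r, 'e) ring_scheme \<Rightarrow> ('r, 'm) module \<Rightarrow> nat
      \<Rightarrow> ('s, ('s \<times> 'm list) multiset set) module" where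
  "tensor S h R M n = (let cl = tensor_class S h R M n in \<lparr>
     carrier = cl ` formal_sums S M n,
     monoid.mult = undefined, one = undefined,
     ring.zero = cl {#},
     ring.add = (\<lambda>A B. \<Union>u\<in>A. \<Union>v\<in>B. cl (u + v)),
     module.smult = (\<lambda>a A. \<Union>u\<in>A. cl (image_mset (\<lambda>(b, xs). (a \<otimes>\<^bsub>S\<^esub> b, xs)) u))\<rparr>)"


subsection \<open>Pullbacks and tensor powers of sheaves\<close>

text \<open>
  For \<open>\<phi> : Z \<rightarrow> Y\<close> and a sheaf of modules \<open>F\<close> on \<open>Y\<close>, the sheaf \<open>\<phi>\<^sup>*(F\<^sup>\<otimes>\<^sup>n)\<close> has the stalks
  \<open>\<O>\<^sub>Z\<^sub>,\<^sub>x \<otimes> F\<^sub>\<phi>\<^sub>(\<^sub>x\<^sub>)\<^sup>\<otimes>\<^sup>n\<close> (tensor products over the local ring of \<open>Y\<close> at \<open>\<phi> x\<close>); its sections are the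
  families of elements of these stalks that are locally given by formal sums of sections
  (i.e. the sheafification of the tensor product of presheaves).
\<close>

type_synonym ('a, 'f, 'b, 'm) tensor_germ =
  "(('a, 'a \<Rightarrow> 'f) germ \<times> ('b, 'm) germ list) multiset set"

definition tensor_stalk ::
    "('a, 'f::field) fun_space \<Rightarrow> ('b, 'f) fun_space \<Rightarrow> ('a \<Rightarrow> 'b) \<Rightarrow> ('b, 'b \<Rightarrow> 'f, 'm) mod_sheaf
      \<Rightarrow> nat \<Rightarrow> 'a \<Rightarrow> (('a, 'a \<Rightarrow> 'f) germ, ('a, 'f, 'b, 'm) tensor_germ) module" where
  "tensor_stalk Z Y \<phi> F n x =
     tensor (local_ring Z x) (germ_comap Z Y \<phi> x) (local_ring Y (\<phi> x)) (stalk Y F (\<phi> x)) n"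

definition formal_section ::
    "('a, 'f::field) fun_space \<Rightarrow> ('b, 'f) fun_space \<Rightarrow> ('a \<Rightarrow> 'b) \<Rightarrow> ('b, 'b \<Rightarrow> 'f, 'm) mod_sheaf
      \<Rightarrow> nat \<Rightarrow> 'a set \<Rightarrow> 'b set \<Rightarrow> (('a \<Rightarrow> 'f) \<times> 'm list) multiset
      \<Rightarrow> 'a \<Rightarrow> ('a, 'f, 'b, 'm) tensor_germ" where
  "formal_section Z Y \<phi> F n W V u = (\<lambda>x\<in>W.
     tensor_class (local_ring Z x) (germ_comap Z Y \<phi> x) (local_ring Y (\<phi> x)) (stalk Y F (\<phi> x)) n
       (image_mset (\<lambda>(a, ss). (germ_at (topo Z) (structure_sheaf Z) x W a,
                               map (germ_at (topo Y) F (\<phi> x) V) ss)) u))"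

definition tensor_pullback ::
    "('a, 'f::field) fun_space \<Rightarrow> ('b, 'f) fun_space \<Rightarrow> ('a \<Rightarrow> 'b) \<Rightarrow> ('b, 'b \<Rightarrow> 'f, 'm) mod_sheaf
      \<Rightarrow> nat \<Rightarrow> ('a, 'a \<Rightarrow> 'f, 'a \<Rightarrow> ('a, 'f, 'b, 'm) tensor_germ) mod_sheaf" where
  "tensor_pullback Z Y \<phi> F n = \<lparr>
     sections = (\<lambda>U. \<lparr>
       carrier = {\<sigma> \<in> (\<Pi>\<^sub>E x\<in>U. carrier (tensor_stalk Z Y \<phi> F n x)).
         \<forall>x\<in>U. \<exists>W V u. openin (topo Z) W \<and> x \<in> W \<and> W \<subseteq> U \<and> openin (topo Y) V \<and> \<phi> ` W \<subseteq> V \<and>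
           u \<in> formal_sums (sections (structure_sheaf Z) W) (sections F V) n \<and>
           restrict \<sigma> W = formal_section Z Y \<phi> F n W V u},
       monoid.mult = undefined, one = undefined,
       ring.zero = (\<lambda>x\<in>U. \<zero>\<^bsub>tensor_stalk Z Y \<phi> F n x\<^esub>),
       ring.add = (\<lambda>\<sigma> \<tau>. \<lambda>x\<in>U. \<sigma> x \<oplus>\<^bsub>tensor_stalk Z Y \<phi> F n x\<^esub> \<tau> x),
       module.smult = (\<lambda>a \<sigma>. \<lambda>x\<in>U.
         germ_at (topo Z) (structure_sheaf Z) x U a \<odot>\<^bsub>tensor_stalk Z Y \<phi> F n x\<^esub> \<sigma> x)\<rparr>),
     res = (\<lambda>U V \<sigma>. restrict \<sigma> V)\<rparr>"

abbreviation pullback ::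
    "('a, 'f::field) fun_space \<Rightarrow> ('b, 'f) fun_space \<Rightarrow> ('a \<Rightarrow> 'b) \<Rightarrow> ('b, 'b \<Rightarrow> 'f, 'm) mod_sheaf
      \<Rightarrow> ('a, 'a \<Rightarrow> 'f, 'a \<Rightarrow> ('a, 'f, 'b, 'm) tensor_germ) mod_sheaf" where
  "pullback Z Y \<phi> F \<equiv> tensor_pullback Z Y \<phi> F 1"

abbreviation tensor_power ::
    "('a, 'f::field) fun_space \<Rightarrow> ('a, 'a \<Rightarrow> 'f, 'm) mod_sheaf \<Rightarrow> nat
      \<Rightarrow> ('a, 'a \<Rightarrow> 'f, 'a \<Rightarrow> ('a, 'f, 'a, 'm) tensor_germ) mod_sheaf" where
  "tensor_power Z F n \<equiv> tensor_pullback Z Z (\<lambda>x. x) F n"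


section \<open>Projective varieties over a field\<close>

text \<open>
  \<open>k[X\<^sub>0, \<dots>, X\<^sub>m]\<close> consists of the finitely supported maps from exponent vectors
  \<^typ>\<open>nat \<Rightarrow>\<^sub>0 nat\<close> to coefficients in which only the variables \<open>0, \<dots>, m\<close> occur.
\<close>

type_synonym 'k mpoly = "(nat \<Rightarrow>\<^sub>0 nat) \<Rightarrow>\<^sub>0 'k"

definition poly_ring :: "nat \<Rightarrow> 'k::field mpoly ring" where
  "poly_ring m = \<lparr>
     carrier = {F. \<forall>\<alpha>\<in>Poly_Mapping.keys F. Poly_Mapping.keys \<alpha> \<subseteq> {..m}},
     monoid.mult = (*), one = 1, ring.zero = 0, ring.add = (+)\<rparr>"

definition forms :: "nat \<Rightarrow> nat \<Rightarrow> 'k::field mpoly set" where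
  "forms m d = {F \<in> carrier (poly_ring m). \<forall>\<alpha>\<in>Poly_Mapping.keys F.
     (\<Sum>i\<in>Poly_Mapping.keys \<alpha>. Poly_Mapping.lookup \<alpha> i) = d}"

definition eval_poly :: "'f::field mpoly \<Rightarrow> (nat \<Rightarrow> 'f) \<Rightarrow> 'f" where
  "eval_poly F v = (\<Sum>\<alpha>\<in>Poly_Mapping.keys F. Poly_Mapping.lookup F \<alpha> *
     (\<Prod>i\<in>Poly_Mapping.keys \<alpha>. v i ^ Poly_Mapping.lookup \<alpha> i))"

definition base_change :: "'k::field mpoly \<Rightarrow> 'k alg_closure mpoly" where
  "base_change F = Poly_Mapping.map to_ac F"

abbreviation value_at :: "'k::field mpoly \<Rightarrow> (nat \<Rightarrow> 'k alg_closure) \<Rightarrow> 'k alg_closure" where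
  "value_at F v \<equiv> eval_poly (base_change F) v"

text \<open>
  A geometric point of projective space is the set of its homogeneous coordinate vectors;
  a vector \<open>v\<close> has the coordinates \<open>v 0, \<dots>, v m\<close>, and \<open>v i = 0\<close> for \<open>i > m\<close>.
\<close>

type_synonym 'k point = "(nat \<Rightarrow> 'k alg_closure) set"

definition ray :: "(nat \<Rightarrow> 'k::field alg_closure) \<Rightarrow> 'k point" where
  "ray v = {(\<lambda>i. c * v i) |c. c \<noteq> 0}"

definition proj_space :: "nat \<Rightarrow> 'k::field point set" where
  "proj_space m = {ray v |v. (\<exists>i. v i \<noteq> 0) \<and> (\<forall>i>m. v i = 0)}"

text \<open>
  A variety over \<open>k\<close> is represented by its set \<open>C\<close> of geometric points, with the topology whose
  open sets are defined over \<open>k\<close> and the sheaf of functions that are locally quotients of forms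
  of the same degree with coefficients in \<open>k\<close>. Two points may lie over the same closed point of the
  scheme over \<open>k\<close>; the open sets, and hence the sheaves and the local rings, are those of the scheme.
\<close>

definition zariski :: "nat \<Rightarrow> 'k::field point set \<Rightarrow> 'k point topology" where
  "zariski m C = topology_generated_by
     {{P \<in> C. \<forall>v\<in>P. value_at F v \<noteq> 0} |F. \<exists>d. F \<in> forms m d}"

definition variety :: "nat \<Rightarrow> 'k::field point set \<Rightarrow> ('k point, 'k alg_closure) fun_space" where
  "variety m C = \<lparr>topo = zariski m C,
     regular = (\<lambda>U. {s \<in> extensional U. \<forall>P\<in>U. \<exists>V d F G.
        openin (zariski m C) V \<and> P \<in> V \<and> V \<subseteq> U \<and> F \<in> forms m d \<and> G \<in> forms m d \<and>
        (\<forall>Q\<in>V. \<forall>v\<in>Q. value_at G v \<noteq> 0 \<and> s Q = value_at F v / value_at G v)})\<rparr>"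

text \<open>
  The sheaf \<open>\<O>(d)\<close> on projective space: its sections on \<open>U\<close> are the functions on the cone over
  \<open>U\<close> (without the origin) that are locally of the form \<open>F / G\<close> with \<open>deg F = deg G + d\<close>.
\<close>

definition twisting_sheaf ::
    "nat \<Rightarrow> nat \<Rightarrow> ('k::field point, 'k point \<Rightarrow> 'k alg_closure, (nat \<Rightarrow> 'k alg_closure) \<Rightarrow> 'k alg_closure)
      mod_sheaf" where
  "twisting_sheaf m d = \<lparr>
     sections = (\<lambda>U. \<lparr>
       carrier = {s \<in> extensional (\<Union>U). \<forall>P\<in>U. \<exists>V e F G.
         openin (zariski m (proj_space m)) V \<and> P \<in> V \<and> V \<subseteq> U \<and>
         F \<in> forms m (e + d) \<and> G \<in> forms m e \<and>
         (\<forall>v\<in>\<Union>V. value_at G v \<noteq> 0 \<and> s v = value_at F v / value_at G v)},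
       monoid.mult = undefined, one = undefined,
       ring.zero = (\<lambda>v\<in>\<Union>U. 0),
       ring.add = (\<lambda>s t. \<lambda>v\<in>\<Union>U. s v + t v),
       module.smult = (\<lambda>a s. \<lambda>v\<in>\<Union>U. a (ray v) * s v)\<rparr>),
     res = (\<lambda>U V s. restrict s (\<Union>V))\<rparr>"

text \<open>The sheaf \<open>\<iota>\<^sup>*\<O>(1)\<close> for the inclusion \<open>\<iota>\<close> of \<open>C\<close> into projective space.\<close>

definition hyperplane_sheaf where
  "hyperplane_sheaf m C =
     pullback (variety m C) (variety m (proj_space m)) (\<lambda>P. P) (twisting_sheaf m 1)"


subsection \<open>Curves\<close>

definition geometric_ideal :: "nat \<Rightarrow> 'k::field point set \<Rightarrow> 'k alg_closure mpoly set" where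
  "geometric_ideal m C = {F \<in> carrier (poly_ring m). \<forall>P\<in>C. \<forall>v\<in>P. eval_poly F v = 0}"

definition curve_ideal :: "nat \<Rightarrow> 'k::field point set \<Rightarrow> 'k mpoly set" where
  "curve_ideal m C = {F \<in> carrier (poly_ring m). \<forall>P\<in>C. \<forall>v\<in>P. value_at F v = 0}"

text \<open>
  The second and third conditions say that \<open>C\<close> is a closed subset that is defined over \<open>k\<close>, the latter
  in the sense that its ideal over the algebraic closure is generated by polynomials over \<open>k\<close>
  (if \<open>k\<close> is imperfect, this is stronger than being cut out by such polynomials).
  The fourth is geometric integrality.
\<close>

definition projective_curve :: "nat \<Rightarrow> 'k::field point set \<Rightarrow> bool" where
  "projective_curve m C \<longleftrightarrow>
     C \<subseteq> proj_space m \<and>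
     (\<forall>P\<in>proj_space m. (\<forall>F\<in>curve_ideal m C. \<forall>v\<in>P. value_at F v = 0) \<longrightarrow> P \<in> C) \<and>
     geometric_ideal m C = genideal (poly_ring m) (base_change ` curve_ideal m C) \<and>
     primeideal (geometric_ideal m C) (poly_ring m) \<and>
     topological_dim (zariski m C) = 1 \<and>
     (\<forall>P\<in>C. regular_local_ring (local_ring (variety m C) P))"

definition coord_section where
  "coord_section m C i =
     formal_section (variety m C) (variety m (proj_space m)) (\<lambda>P. P) (twisting_sheaf m 1) 1
       C (proj_space m) {#(\<lambda>P\<in>C. 1, [\<lambda>v\<in>\<Union>(proj_space m). v i])#}"

definition monomial_factors :: "nat \<Rightarrow> (nat \<Rightarrow>\<^sub>0 nat) \<Rightarrow> nat list" where
  "monomial_factors m \<alpha> = concat (map (\<lambda>i. replicate (Poly_Mapping.lookup \<alpha> i) i) [0..<Suc m])"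

text \<open>
  The restriction of a form of degree \<open>n\<close> to a global section of \<open>\<L>\<^sup>n\<close>: the product
  \<open>X\<^sub>i\<^sub>1 \<cdots> X\<^sub>i\<^sub>n\<close> is mapped to \<open>\<iota>\<^sup>*X\<^sub>i\<^sub>1 \<otimes> \<cdots> \<otimes> \<iota>\<^sup>*X\<^sub>i\<^sub>n\<close>. The global sections of \<open>\<O>(n)\<close> on projective
  space are the forms of degree \<open>n\<close>.
\<close>

definition restrict_form where
  "restrict_form m C n F =
     formal_section (variety m C) (variety m C) (\<lambda>P. P) (hyperplane_sheaf m C) n C C
       (image_mset (\<lambda>\<alpha>. (\<lambda>P\<in>C. to_ac (Poly_Mapping.lookup F \<alpha>),
                         map (coord_section m C) (monomial_factors m \<alpha>)))
         (mset_set (Poly_Mapping.keys F)))"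

definition projectively_normal :: "nat \<Rightarrow> 'k::field point set \<Rightarrow> bool" where
  "projectively_normal m C \<longleftrightarrow> (\<forall>n.
     restrict_form m C n ` forms m n =
       carrier (sections (tensor_power (variety m C) (hyperplane_sheaf m C) n) C))"


subsection \<open>Defining polynomials of a morphism\<close>

definition coord_ring :: "nat \<Rightarrow> 'k::field point set \<Rightarrow> 'k mpoly set ring" where
  "coord_ring m C = poly_ring m Quot curve_ideal m C"

abbreviation residue_class :: "nat \<Rightarrow> 'k::field point set \<Rightarrow> 'k mpoly \<Rightarrow> 'k mpoly set" where
  "residue_class m C F \<equiv> curve_ideal m C +>\<^bsub>poly_ring m\<^esub> F"

text \<open>All representatives of the residue class have the same value on the cone over \<open>C\<close>.\<close>

definition class_value ::
    "'k::field mpoly set \<Rightarrow> (nat \<Rightarrow> 'k alg_closure) \<Rightarrow> 'k alg_closure" where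
  "class_value f v = the_elem ((\<lambda>F. value_at F v) ` f)"

definition defining_polynomials ::
    "nat \<Rightarrow> 'k::field point set \<Rightarrow> nat \<Rightarrow> ('k point \<Rightarrow> 'k point) \<Rightarrow> nat \<Rightarrow> (nat \<Rightarrow> 'k mpoly set) \<Rightarrow> bool"
  where
  "defining_polynomials m C r \<phi> n f \<longleftrightarrow>
     (\<forall>i\<le>r. f i \<in> residue_class m C ` forms m n) \<and>
     (\<exists>i\<le>r. f i \<noteq> \<zero>\<^bsub>coord_ring m C\<^esub>) \<and>
     (\<forall>P\<in>C. \<forall>v\<in>P. (\<exists>i\<le>r. class_value (f i) v \<noteq> 0) \<longrightarrow>
        \<phi> P = ray (\<lambda>i. if i \<le> r then class_value (f i) v else 0))"

definition exceptional_set ::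
    "'k::field point set \<Rightarrow> nat \<Rightarrow> (nat \<Rightarrow> 'k mpoly set) \<Rightarrow> 'k point set" where
  "exceptional_set C r f = {P \<in> C. \<forall>v\<in>P. \<forall>i\<le>r. class_value (f i) v = 0}"

definition complete_tuple ::
    "nat \<Rightarrow> 'k::field point set \<Rightarrow> nat \<Rightarrow> ('k point \<Rightarrow> 'k point) \<Rightarrow> nat \<Rightarrow> (nat \<Rightarrow> 'k mpoly set) \<Rightarrow> bool"
  where
  "complete_tuple m C r \<phi> n f \<longleftrightarrow>
     defining_polynomials m C r \<phi> n f \<and> exceptional_set C r f = {}"

end

theory Submission
  imports Defs
begin

text \<open>
  Choose a coordinate vector of every point. Evaluating at these vectors turns the sections of
  \<open>\<O>(1)\<close>, and then those of \<open>\<L>\<^sub>1\<^sup>n\<close> and \<open>\<phi>\<^sup>*\<L>\<^sub>2\<close>, into functions on points: the functions that are locally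
  a regular function times a given nowhere vanishing generator. An isomorphism between two such sheaves
  is the same as a nowhere vanishing function \<open>h\<close> such that multiplication by \<open>h\<close> maps the sections of the
  one onto those of the other. If \<open>F\<^sub>0, \<dots>, F\<^sub>r\<close> represent a complete tuple, then
  \<open>F\<^sub>i(v\<^sub>P) = h(P) (v\<^sub>\<phi>\<^sub>(\<^sub>P\<^sub>))\<^sub>i\<close> for such an \<open>h\<close>. Conversely an isomorphism yields an \<open>h\<close> for which
  \<open>P \<mapsto> h(P) (v\<^sub>\<phi>\<^sub>(\<^sub>P\<^sub>))\<^sub>i\<close> is a global section of \<open>\<L>\<^sub>1\<^sup>n\<close>, hence a form by projective normality. The ratio
  of the functions \<open>h\<close> of two complete tuples is a global section of \<open>\<L>\<^sub>1\<^sup>0\<close>, and so it is constant.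
\<close>

section \<open>Sheaves whose sections have values at points\<close>

text \<open>Sections of the tensor sheaves are families of classes of formal sums, so their equality
  is not visible from the definition. A line sheaf becomes accessible through a generator \<gamma>
  near each point: every formal sum reduces to one term b \<otimes> \<gamma> \<otimes> ... \<otimes>
  \<gamma>, whose value function is b times a nowhere vanishing function. Values on a neighbourhood
  therefore determine b and with it the tensor germ; the value at a single point would not. Pulling
  back and taking powers preserve this situation, so one argument, applied repeatedly, leads from
  O(1) to its restriction, to the powers of that and to the pullback along \<phi>. The chosen
  coordinate vectors are arbitrary, so neither the values of the generators nor h need be regular.
  Only ratios matter: a quotient of forms of equal degree does not depend on the vectors. Hence h is
  handled through \<open>F i\<close> / X_j^n and its inverse, and the ratio of two such functions
  through \<open>G i\<close> / \<open>F i\<close>. The constant in the uniqueness claim lies in k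
  because projective normality in degree 0 makes the ratio the restriction of a form of degree 0
  over k.\<close>

locale function_space =
  fixes Z :: "('a, 'f::field) fun_space"
  assumes regular_extensional: "openin (topo Z) U \<Longrightarrow> a \<in> regular Z U \<Longrightarrow> a \<in> extensional U"
    and regular_restrict: "openin (topo Z) U \<Longrightarrow> openin (topo Z) V \<Longrightarrow> V \<subseteq> U \<Longrightarrow> a \<in> regular Z U
      \<Longrightarrow> restrict a V \<in> regular Z V"
    and regular_zero: "openin (topo Z) U \<Longrightarrow> (\<lambda>x\<in>U. 0) \<in> regular Z U"
    and regular_one: "openin (topo Z) U \<Longrightarrow> (\<lambda>x\<in>U. 1) \<in> regular Z U"
    and regular_add: "openin (topo Z) U \<Longrightarrow> a \<in> regular Z U \<Longrightarrow> b \<in> regular Z U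
      \<Longrightarrow> (\<lambda>x\<in>U. a x + b x) \<in> regular Z U"
    and regular_mult: "openin (topo Z) U \<Longrightarrow> a \<in> regular Z U \<Longrightarrow> b \<in> regular Z U
      \<Longrightarrow> (\<lambda>x\<in>U. a x * b x) \<in> regular Z U"

text \<open>The axiom \<open>ev_inject\<close> is the decisive one: the values over an open set
  determine the section, so abstract sections can be treated as functions and every identity between
  them checked pointwise. Values are taken in the field, without any regularity in x.\<close>

locale valued_sheaf = function_space Z for Z :: "('a, 'f::field) fun_space" +
  fixes F :: "('a, 'a \<Rightarrow> 'f, 'm) mod_sheaf"
    and ev :: "'a set \<Rightarrow> 'm \<Rightarrow> 'a \<Rightarrow> 'f"
  assumes add_closed: "openin (topo Z) U \<Longrightarrow> s \<in> carrier (sections F U) \<Longrightarrow> t \<in> carrier (sections F U)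
      \<Longrightarrow> s \<oplus>\<^bsub>sections F U\<^esub> t \<in> carrier (sections F U)"
    and smult_closed: "openin (topo Z) U \<Longrightarrow> a \<in> regular Z U \<Longrightarrow> s \<in> carrier (sections F U)
      \<Longrightarrow> a \<odot>\<^bsub>sections F U\<^esub> s \<in> carrier (sections F U)"
    and res_closed: "openin (topo Z) U \<Longrightarrow> openin (topo Z) V \<Longrightarrow> V \<subseteq> U \<Longrightarrow> s \<in> carrier (sections F U)
      \<Longrightarrow> res F U V s \<in> carrier (sections F V)"
    and ev_add: "openin (topo Z) U \<Longrightarrow> s \<in> carrier (sections F U) \<Longrightarrow> t \<in> carrier (sections F U) \<Longrightarrow> x \<in> U
      \<Longrightarrow> ev U (s \<oplus>\<^bsub>sections F U\<^esub> t) x = ev U s x + ev U t x"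
    and ev_smult: "openin (topo Z) U \<Longrightarrow> a \<in> regular Z U \<Longrightarrow> s \<in> carrier (sections F U) \<Longrightarrow> x \<in> U
      \<Longrightarrow> ev U (a \<odot>\<^bsub>sections F U\<^esub> s) x = a x * ev U s x"
    and ev_res: "openin (topo Z) U \<Longrightarrow> openin (topo Z) V \<Longrightarrow> V \<subseteq> U \<Longrightarrow> s \<in> carrier (sections F U)
      \<Longrightarrow> x \<in> V \<Longrightarrow> ev V (res F U V s) x = ev U s x"
    and ev_inject: "openin (topo Z) U \<Longrightarrow> s \<in> carrier (sections F U) \<Longrightarrow> t \<in> carrier (sections F U)
      \<Longrightarrow> (\<And>x. x \<in> U \<Longrightarrow> ev U s x = ev U t x) \<Longrightarrow> s = t"

text \<open>The operations of a stalk are unions over all pairs of representatives. Once the result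
  is the same for every pair, the union collapses to that common result, provided that
  representatives exist.\<close>

lemma UN_pairs_const:
  assumes "\<And>p q. p \<in> A \<Longrightarrow> q \<in> B \<Longrightarrow> h (fst p) (snd p) (fst q) (snd q) = c" "A \<noteq> {}" "B \<noteq> {}"
  shows "(\<Union>(U, s)\<in>A. \<Union>(V, t)\<in>B. h U s V t) = c"
  using assms by fastforce

lemma stalk_simps:
  "A \<oplus>\<^bsub>stalk Z F x\<^esub> B = (\<Union>(U, s)\<in>A. \<Union>(V, t)\<in>B. germ_at (topo Z) F x (U \<inter> V)
     (res F U (U \<inter> V) s \<oplus>\<^bsub>sections F (U \<inter> V)\<^esub> res F V (U \<inter> V) t))"
  "A \<otimes>\<^bsub>stalk Z F x\<^esub> B = (\<Union>(U, s)\<in>A. \<Union>(V, t)\<in>B. germ_at (topo Z) F x (U \<inter> V)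
     (res F U (U \<inter> V) s \<otimes>\<^bsub>sections F (U \<inter> V)\<^esub> res F V (U \<inter> V) t))"
  "D \<odot>\<^bsub>stalk Z F x\<^esub> B = (\<Union>(U, a)\<in>D. \<Union>(V, t)\<in>B. germ_at (topo Z) F x (U \<inter> V)
     (restrict a (U \<inter> V) \<odot>\<^bsub>sections F (U \<inter> V)\<^esub> res F V (U \<inter> V) t))"
  "\<zero>\<^bsub>stalk Z F x\<^esub> = germ_at (topo Z) F x (topspace (topo Z)) \<zero>\<^bsub>sections F (topspace (topo Z))\<^esub>"
  "carrier (stalk Z F x) =
     {germ_at (topo Z) F x U s |U s. openin (topo Z) U \<and> x \<in> U \<and> s \<in> carrier (sections F U)}"
  by (simp_all add: stalk_def Let_def)

text \<open>The representative is arbitrary, which is harmless: any two representatives agree near x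
  and therefore have the same value at x.\<close>

definition germ_value :: "('a set \<Rightarrow> 'm \<Rightarrow> 'a \<Rightarrow> 'f) \<Rightarrow> 'a \<Rightarrow> ('a, 'm) germ \<Rightarrow> 'f" where
  "germ_value ev x A = (let (V, s) = SOME p. p \<in> A in ev V s x)"

context valued_sheaf
begin

abbreviation germ :: "'a \<Rightarrow> 'a set \<Rightarrow> 'm \<Rightarrow> ('a, 'm) germ" where
  "germ \<equiv> germ_at (topo Z) F"

lemma res_eq_iff:
  assumes "openin (topo Z) U" "openin (topo Z) V" "openin (topo Z) W" "W \<subseteq> U \<inter> V"
    "s \<in> carrier (sections F U)" "t \<in> carrier (sections F V)"
  shows "res F U W s = res F V W t \<longleftrightarrow> (\<forall>x\<in>W. ev U s x = ev V t x)"
proof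
  assume "res F U W s = res F V W t"
  then show "\<forall>x\<in>W. ev U s x = ev V t x"
    using assms ev_res[of U W s] ev_res[of V W t] by simp
next
  assume "\<forall>x\<in>W. ev U s x = ev V t x"
  then show "res F U W s = res F V W t"
    using assms by (intro ev_inject[of W]) (auto simp: ev_res res_closed)
qed

text \<open>Since values are faithful, equality of restrictions becomes equality of values on a
  smaller neighbourhood; from here on germs are germs of functions.\<close>

lemma mem_germ_iff:
  assumes "openin (topo Z) U" "s \<in> carrier (sections F U)"
  shows "(V, t) \<in> germ x U s \<longleftrightarrow> openin (topo Z) V \<and> x \<in> V \<and> t \<in> carrier (sections F V) \<and>
    (\<exists>W. openin (topo Z) W \<and> x \<in> W \<and> W \<subseteq> U \<inter> V \<and> (\<forall>z\<in>W. ev U s z = ev V t z))"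
  using assms by (auto simp: germ_at_def cong: conj_cong) (metis le_inf_iff res_eq_iff)+

lemma germ_eqI:
  assumes "openin (topo Z) U" "s \<in> carrier (sections F U)" "openin (topo Z) V" "t \<in> carrier (sections F V)"
    and "openin (topo Z) W" "x \<in> W" "W \<subseteq> U \<inter> V" "\<And>z. z \<in> W \<Longrightarrow> ev U s z = ev V t z"
  shows "germ x U s = germ x V t"
proof -
  have "(V', t') \<in> germ x V t" if "openin (topo Z) U" "s \<in> carrier (sections F U)"
     "openin (topo Z) V" "t \<in> carrier (sections F V)" "(V', t') \<in> germ x U s"
     "W \<subseteq> U \<inter> V" "\<And>z. z \<in> W \<Longrightarrow> ev U s z = ev V t z" for V' t' U s V t
  proof -
    from that obtain W' where "openin (topo Z) V'" "x \<in> V'" "t' \<in> carrier (sections F V')"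
      "openin (topo Z) W'" "x \<in> W'" "W' \<subseteq> U \<inter> V'" "\<forall>z\<in>W'. ev U s z = ev V' t' z"
      by (auto simp: mem_germ_iff)
    then show ?thesis using that assms(5,6)
      by (auto simp: mem_germ_iff intro!: exI[of _ "W \<inter> W'"])
  qed
  from this[of U s V t] this[of V t U s] assms show ?thesis
    by auto
qed

lemma mem_germ_self:
  assumes "openin (topo Z) U" "s \<in> carrier (sections F U)" "x \<in> U"
  shows "(U, s) \<in> germ x U s"
  using assms by (auto simp: mem_germ_iff)

lemma germ_value_germ:
  assumes "openin (topo Z) U" "s \<in> carrier (sections F U)" "x \<in> U"
  shows "germ_value ev x (germ x U s) = ev U s x"
proof -
  have "(SOME p. p \<in> germ x U s) \<in> germ x U s"
    using mem_germ_self[OF assms] by (metis someI)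
  then show ?thesis
    using assms by (cases "SOME p. p \<in> germ x U s") (auto simp: germ_value_def mem_germ_iff)
qed

lemma germ_in_stalk:
  "openin (topo Z) U \<Longrightarrow> s \<in> carrier (sections F U) \<Longrightarrow> x \<in> U \<Longrightarrow> germ x U s \<in> carrier (stalk Z F x)"
  by (auto simp: stalk_simps)

lemma stalk_cases:
  assumes "A \<in> carrier (stalk Z F x)"
  obtains U s where "openin (topo Z) U" "x \<in> U" "s \<in> carrier (sections F U)" "A = germ x U s"
  using assms by (auto simp: stalk_simps)

text \<open>The representative of the sum is left free: any section with the right values near x
  will do. This spares the later proofs the explicit restrictions in the definition of the
  stalk.\<close>

lemma stalk_add_germ:
  assumes U: "openin (topo Z) U" "s \<in> carrier (sections F U)" "x \<in> U"
    and V: "openin (topo Z) V" "t \<in> carrier (sections F V)" "x \<in> V"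
    and W: "openin (topo Z) W" "r \<in> carrier (sections F W)" "x \<in> W"
    and r: "\<And>z. z \<in> W \<inter> U \<inter> V \<Longrightarrow> ev W r z = ev U s z + ev V t z"
  shows "germ x U s \<oplus>\<^bsub>stalk Z F x\<^esub> germ x V t = germ x W r"
proof -
  have "germ x (U' \<inter> V') (res F U' (U' \<inter> V') s' \<oplus>\<^bsub>sections F (U' \<inter> V')\<^esub> res F V' (U' \<inter> V') t') = germ x W r"
    if "(U', s') \<in> germ x U s" "(V', t') \<in> germ x V t" for U' s' V' t'
  proof -
    from that U V obtain A B where A: "openin (topo Z) U'" "x \<in> U'" "s' \<in> carrier (sections F U')"
      "openin (topo Z) A" "x \<in> A" "A \<subseteq> U \<inter> U'" "\<forall>z\<in>A. ev U s z = ev U' s' z"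
      and B: "openin (topo Z) V'" "x \<in> V'" "t' \<in> carrier (sections F V')"
      "openin (topo Z) B" "x \<in> B" "B \<subseteq> V \<inter> V'" "\<forall>z\<in>B. ev V t z = ev V' t' z"
      by (auto simp: mem_germ_iff)
    show ?thesis
    \<comment> \<open>On \<open>A\<close> and \<open>B\<close> the arbitrary representatives agree
      with the given ones, and on \<open>W\<close> the section r is available; all three comparisons
      are possible on the intersection.\<close>
    proof (rule germ_eqI[of _ _ _ _ "A \<inter> B \<inter> W"])
      fix z assume z: "z \<in> A \<inter> B \<inter> W"
      then have "ev U s z = ev U' s' z" "ev V t z = ev V' t' z" "z \<in> W \<inter> U \<inter> V"
        using A(6,7) B(6,7) by blast+
      then have "ev W r z = ev U' s' z + ev V' t' z" using r by simp
      moreover have "ev (U' \<inter> V') (res F U' (U' \<inter> V') s') z = ev U' s' z"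
        "ev (U' \<inter> V') (res F V' (U' \<inter> V') t') z = ev V' t' z"
        using A B z by (auto intro!: ev_res)
      ultimately show "ev (U' \<inter> V') (res F U' (U' \<inter> V') s' \<oplus>\<^bsub>sections F (U' \<inter> V')\<^esub> res F V' (U' \<inter> V') t') z = ev W r z"
        using A(1-6) B(1-6) z by (subst ev_add) (auto intro!: res_closed)
    qed (use A(1-6) B(1-6) W in \<open>auto intro!: add_closed res_closed\<close>)
  qed
  then show ?thesis
    unfolding stalk_simps using mem_germ_self[OF U] mem_germ_self[OF V]
    by (intro UN_pairs_const) auto
qed

end

section \<open>The structure sheaf and its local rings\<close>

context function_space
begin

lemma structure_sheaf_simps [simp]:
  "carrier (sections (structure_sheaf Z) U) = regular Z U"
  "a \<oplus>\<^bsub>sections (structure_sheaf Z) U\<^esub> b = (\<lambda>x\<in>U. a x + b x)"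
  "a \<otimes>\<^bsub>sections (structure_sheaf Z) U\<^esub> b = (\<lambda>x\<in>U. a x * b x)"
  "a \<odot>\<^bsub>sections (structure_sheaf Z) U\<^esub> b = (\<lambda>x\<in>U. a x * b x)"
  "\<zero>\<^bsub>sections (structure_sheaf Z) U\<^esub> = (\<lambda>x\<in>U. 0)"
  "\<one>\<^bsub>sections (structure_sheaf Z) U\<^esub> = (\<lambda>x\<in>U. 1)"
  "res (structure_sheaf Z) U V a = restrict a V"
  by (simp_all add: structure_sheaf_def)

text \<open>Regular functions are their own value functions; faithfulness is extensionality.\<close>

sublocale O: valued_sheaf Z "structure_sheaf Z" "\<lambda>U a. a"
proof
  fix U and s t :: "'a \<Rightarrow> 'f"
  assume "openin (topo Z) U" "s \<in> carrier (sections (structure_sheaf Z) U)"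
    "t \<in> carrier (sections (structure_sheaf Z) U)" "\<And>x. x \<in> U \<Longrightarrow> s x = t x"
  then show "s = t" by (intro extensionalityI[of s U t]) (auto simp: regular_extensional)
qed (auto simp: regular_add regular_mult regular_restrict)

text \<open>Multiplication is treated apart from addition and scaling because the
  \<open>mult\<close> field of the common record has a meaning only for the structure sheaf.\<close>

lemma local_ring_mult_germ:
  assumes U: "openin (topo Z) U" "a \<in> regular Z U" "x \<in> U"
    and V: "openin (topo Z) V" "b \<in> regular Z V" "x \<in> V"
    and W: "openin (topo Z) W" "c \<in> regular Z W" "x \<in> W"
    and c: "\<And>z. z \<in> W \<inter> U \<inter> V \<Longrightarrow> c z = a z * b z"
  shows "O.germ x U a \<otimes>\<^bsub>local_ring Z x\<^esub> O.germ x V b = O.germ x W c"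
proof -
  have "O.germ x (U' \<inter> V') (res (structure_sheaf Z) U' (U' \<inter> V') a'
      \<otimes>\<^bsub>sections (structure_sheaf Z) (U' \<inter> V')\<^esub> res (structure_sheaf Z) V' (U' \<inter> V') b') = O.germ x W c"
    if "(U', a') \<in> O.germ x U a" "(V', b') \<in> O.germ x V b" for U' a' V' b'
  proof -
    from that U V obtain A B where A: "openin (topo Z) U'" "x \<in> U'" "a' \<in> regular Z U'"
      "openin (topo Z) A" "x \<in> A" "A \<subseteq> U \<inter> U'" "\<forall>z\<in>A. a z = a' z"
      and B: "openin (topo Z) V'" "x \<in> V'" "b' \<in> regular Z V'"
      "openin (topo Z) B" "x \<in> B" "B \<subseteq> V \<inter> V'" "\<forall>z\<in>B. b z = b' z"
      by (auto simp: O.mem_germ_iff)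
    show ?thesis
      unfolding structure_sheaf_simps
    proof (rule O.germ_eqI[of _ _ _ _ "A \<inter> B \<inter> W"])
      show "(\<lambda>x\<in>U' \<inter> V'. restrict a' (U' \<inter> V') x * restrict b' (U' \<inter> V') x)
          \<in> carrier (sections (structure_sheaf Z) (U' \<inter> V'))"
        unfolding structure_sheaf_simps
        by (intro regular_mult regular_restrict[OF A(1) _ _ A(3)] regular_restrict[OF B(1) _ _ B(3)] openin_Int A B)
          auto
      fix z assume z: "z \<in> A \<inter> B \<inter> W"
      then have "a z = a' z" "b z = b' z" "z \<in> W \<inter> U \<inter> V" "z \<in> U' \<inter> V'"
        using A(6,7) B(6,7) by blast+
      then show "(\<lambda>x\<in>U' \<inter> V'. restrict a' (U' \<inter> V') x * restrict b' (U' \<inter> V') x) z = c z"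
        using c by simp
    qed (use A(1-6) B(1-6) W in auto)
  qed
  then show ?thesis
    unfolding stalk_simps using O.mem_germ_self[of U a x] O.mem_germ_self[of V b x] U V
    by (intro UN_pairs_const) auto
qed

lemma local_ring_zero:
  assumes "openin (topo Z) U" "x \<in> U"
  shows "\<zero>\<^bsub>local_ring Z x\<^esub> = O.germ x U (\<lambda>x\<in>U. 0)"
proof -
  have "O.germ x (topspace (topo Z)) (\<lambda>x\<in>topspace (topo Z). 0) = O.germ x U (\<lambda>x\<in>U. 0)"
    using assms openin_subset[OF assms(1)] by (intro O.germ_eqI[of _ _ _ _ U]) (auto simp: regular_zero)
  then show ?thesis by (simp add: stalk_simps)
qed

end

context valued_sheaf
begin

lemma stalk_smult_germ:
  assumes U: "openin (topo Z) U" "a \<in> regular Z U" "x \<in> U"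
    and V: "openin (topo Z) V" "t \<in> carrier (sections F V)" "x \<in> V"
    and W: "openin (topo Z) W" "r \<in> carrier (sections F W)" "x \<in> W"
    and r: "\<And>z. z \<in> W \<inter> U \<inter> V \<Longrightarrow> ev W r z = a z * ev V t z"
  shows "O.germ x U a \<odot>\<^bsub>stalk Z F x\<^esub> germ x V t = germ x W r"
proof -
  have "germ x (U' \<inter> V') (restrict a' (U' \<inter> V') \<odot>\<^bsub>sections F (U' \<inter> V')\<^esub> res F V' (U' \<inter> V') t') = germ x W r"
    if "(U', a') \<in> O.germ x U a" "(V', t') \<in> germ x V t" for U' a' V' t'
  proof -
    from that U V obtain A B where A: "openin (topo Z) U'" "x \<in> U'" "a' \<in> regular Z U'"
      "openin (topo Z) A" "x \<in> A" "A \<subseteq> U \<inter> U'" "\<forall>z\<in>A. a z = a' z"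
      and B: "openin (topo Z) V'" "x \<in> V'" "t' \<in> carrier (sections F V')"
      "openin (topo Z) B" "x \<in> B" "B \<subseteq> V \<inter> V'" "\<forall>z\<in>B. ev V t z = ev V' t' z"
      by (auto simp: mem_germ_iff O.mem_germ_iff)
    show ?thesis
    proof (rule germ_eqI[of _ _ _ _ "A \<inter> B \<inter> W"])
      fix z assume z: "z \<in> A \<inter> B \<inter> W"
      then have "a z = a' z" "ev V t z = ev V' t' z" "z \<in> W \<inter> U \<inter> V"
        using A(6,7) B(6,7) by blast+
      then have "ev W r z = a' z * ev V' t' z" using r by simp
      moreover have "ev (U' \<inter> V') (res F V' (U' \<inter> V') t') z = ev V' t' z"
        using A B z by (auto intro!: ev_res)
      ultimately show "ev (U' \<inter> V') (restrict a' (U' \<inter> V') \<odot>\<^bsub>sections F (U' \<inter> V')\<^esub> res F V' (U' \<inter> V') t') z = ev W r z"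
        using A(1-6) B(1-6) z by (subst ev_smult) (auto intro!: res_closed regular_restrict[of U'])
    qed (use A(1-6) B(1-6) W in \<open>auto intro!: smult_closed res_closed regular_restrict[of U']\<close>)
  qed
  then show ?thesis
    unfolding stalk_simps using O.mem_germ_self[of U a x] mem_germ_self[OF V] U
    by (intro UN_pairs_const) auto
qed

end

section \<open>Tensor products\<close>

text \<open>These are the laws that keep formal sums closed under the tensor relations and the
  relations stable under scaling. They are listed one by one so that they can be checked directly on
  germs.\<close>

locale tensor_setting =
  fixes S :: "('s, 'c) ring_scheme" and h :: "'r \<Rightarrow> 's" and R :: "('r, 'e) ring_scheme"
    and M :: "('r, 'm) module" and n :: nat
  assumes S_zero: "\<zero>\<^bsub>S\<^esub> \<in> carrier S"
    and S_add: "a \<in> carrier S \<Longrightarrow> b \<in> carrier S \<Longrightarrow> a \<oplus>\<^bsub>S\<^esub> b \<in> carrier S"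
    and S_mult: "a \<in> carrier S \<Longrightarrow> b \<in> carrier S \<Longrightarrow> a \<otimes>\<^bsub>S\<^esub> b \<in> carrier S"
    and S_mult_zero: "a \<in> carrier S \<Longrightarrow> a \<otimes>\<^bsub>S\<^esub> \<zero>\<^bsub>S\<^esub> = \<zero>\<^bsub>S\<^esub>"
    and S_distrib: "a \<in> carrier S \<Longrightarrow> b \<in> carrier S \<Longrightarrow> d \<in> carrier S
      \<Longrightarrow> a \<otimes>\<^bsub>S\<^esub> (b \<oplus>\<^bsub>S\<^esub> d) = a \<otimes>\<^bsub>S\<^esub> b \<oplus>\<^bsub>S\<^esub> a \<otimes>\<^bsub>S\<^esub> d"
    and S_assoc: "a \<in> carrier S \<Longrightarrow> b \<in> carrier S \<Longrightarrow> d \<in> carrier S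
      \<Longrightarrow> a \<otimes>\<^bsub>S\<^esub> (b \<otimes>\<^bsub>S\<^esub> d) = a \<otimes>\<^bsub>S\<^esub> b \<otimes>\<^bsub>S\<^esub> d"
    and h_closed: "c \<in> carrier R \<Longrightarrow> h c \<in> carrier S"
    and M_add: "x \<in> carrier M \<Longrightarrow> y \<in> carrier M \<Longrightarrow> x \<oplus>\<^bsub>M\<^esub> y \<in> carrier M"
    and M_smult: "c \<in> carrier R \<Longrightarrow> x \<in> carrier M \<Longrightarrow> c \<odot>\<^bsub>M\<^esub> x \<in> carrier M"
begin

abbreviation teq (infix "\<sim>\<^sub>t" 50) where "u \<sim>\<^sub>t v \<equiv> tensor_eq S h R M n u v"
abbreviation cls where "cls \<equiv> tensor_class S h R M n"
abbreviation fsums where "fsums \<equiv> formal_sums S M n"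
abbreviation scale where "scale a u \<equiv> image_mset (\<lambda>(b, xs). (a \<otimes>\<^bsub>S\<^esub> b, xs)) u"

lemma formal_sums_simps [simp]:
  "{#} \<in> fsums"
  "add_mset p u \<in> fsums \<longleftrightarrow> fst p \<in> carrier S \<and> length (snd p) = n \<and> set (snd p) \<subseteq> carrier M \<and> u \<in> fsums"
  "u + v \<in> fsums \<longleftrightarrow> u \<in> fsums \<and> v \<in> fsums"
  by (auto simp: formal_sums_def case_prod_unfold ball_Un)

lemma scale_closed: "a \<in> carrier S \<Longrightarrow> u \<in> fsums \<Longrightarrow> scale a u \<in> fsums"
  by (auto simp: formal_sums_def S_mult)

lemma tensor_eq_formal_sums:
  assumes "u \<sim>\<^sub>t v" shows "u \<in> fsums \<and> v \<in> fsums"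
  using assms by induction (auto simp: S_zero S_add S_mult M_add M_smult h_closed)

text \<open>Each generating relation survives multiplication of all coefficients by a:
  distributivity serves \<open>coeff_add\<close>, associativity \<open>slot_smult\<close>, and a
  times zero \<open>coeff_zero\<close>. This makes scalar multiplication of classes well
  defined.\<close>

lemma tensor_eq_scale:
  assumes "u \<sim>\<^sub>t v" "a \<in> carrier S" shows "scale a u \<sim>\<^sub>t scale a v"
  using assms
proof induction
  case (trans u v w)
  then show ?case by (blast intro: tensor_eq.trans)
next
  case (coeff_add b xs c)
  then show ?case
    using tensor_eq.coeff_add[of "a \<otimes>\<^bsub>S\<^esub> b" xs "a \<otimes>\<^bsub>S\<^esub> c" S M n h R] by (simp add: S_distrib S_mult)
next
  case (slot_smult b xs x ys c)
  then show ?case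
    using tensor_eq.slot_smult[of "a \<otimes>\<^bsub>S\<^esub> b" xs x ys S M n c R h] by (simp add: S_assoc S_mult h_closed)
next
  case (coeff_zero xs)
  then show ?case
    using tensor_eq.coeff_zero[of S xs M n h R] by (simp add: S_mult_zero)
next
  case (slot_add b xs x ys y)
  then show ?case
    using tensor_eq.slot_add[of "a \<otimes>\<^bsub>S\<^esub> b" xs x ys y S M n h R] by (simp add: S_mult)
qed (auto intro: tensor_eq.intros simp: scale_closed)

lemma tensor_class_eqI: "u \<sim>\<^sub>t v \<Longrightarrow> cls u = cls v"
  unfolding tensor_class_def by (blast intro: tensor_eq.trans tensor_eq.sym)

lemma tensor_add_class:
  assumes "u \<in> fsums" "v \<in> fsums"
  shows "cls u \<oplus>\<^bsub>tensor S h R M n\<^esub> cls v = cls (u + v)"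
proof -
  have "cls (u' + v') = cls (u + v)" if "u' \<in> cls u" "v' \<in> cls v" for u' v'
  proof (rule tensor_class_eqI)
    have "u \<sim>\<^sub>t u'" "v \<sim>\<^sub>t v'" using that by (auto simp: tensor_class_def)
    \<comment> \<open>The rule \<open>cong\<close> adds a summand on the right only, so the two
      summands are exchanged one at a time and commutativity of multiset union joins the two
      moves.\<close>
    then have "u' + v' \<sim>\<^sub>t u + v'" "v' + u \<sim>\<^sub>t v + u"
      using assms tensor_eq_formal_sums by (blast intro: tensor_eq.cong tensor_eq.sym)+
    then show "u' + v' \<sim>\<^sub>t u + v" by (simp add: add.commute tensor_eq.trans)
  qed
  moreover have "u \<in> cls u" "v \<in> cls v" using assms by (auto simp: tensor_class_def tensor_eq.refl)
  ultimately have "(\<Union>u'\<in>cls u. \<Union>v'\<in>cls v. cls (u' + v')) = cls (u + v)" by blast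
  then show ?thesis by (simp add: tensor_def Let_def)
qed

lemma tensor_smult_class:
  assumes "u \<in> fsums" "a \<in> carrier S"
  shows "a \<odot>\<^bsub>tensor S h R M n\<^esub> cls u = cls (scale a u)"
proof -
  have "cls (scale a u') = cls (scale a u)" if "u' \<in> cls u" for u'
    using that assms(2)
    by (intro tensor_class_eqI tensor_eq_scale) (auto simp: tensor_class_def intro: tensor_eq.sym)
  moreover have "u \<in> cls u" using assms by (auto simp: tensor_class_def tensor_eq.refl)
  ultimately have "(\<Union>u'\<in>cls u. cls (scale a u')) = cls (scale a u)" by blast
  then show ?thesis by (simp add: tensor_def Let_def)
qed

end

text \<open>The multilinear map a \<otimes> x_1 \<otimes> ... \<otimes> x_n \<mapsto> p(a) q(x_1)
  ... q(x_n), extended additively to formal sums.\<close>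

definition formal_value :: "('s \<Rightarrow> 'f::field) \<Rightarrow> ('m \<Rightarrow> 'f) \<Rightarrow> ('s \<times> 'm list) multiset \<Rightarrow> 'f" where
  "formal_value p q u = (\<Sum>(a, xs)\<in>#u. p a * prod_list (map q xs))"

lemma formal_value_simps [simp]:
  "formal_value p q {#} = 0"
  "formal_value p q (add_mset (a, xs) u) = p a * prod_list (map q xs) + formal_value p q u"
  "formal_value p q (u + v) = formal_value p q u + formal_value p q v"
  by (auto simp: formal_value_def)

text \<open>The well-definedness half of the universal property of the tensor product, with a field
  as target. The map p' is the one by which R acts on the field; the two hypotheses about it say
  that a scalar contributes the same factor in a slot as in the coefficient.\<close>

lemma formal_value_tensor_eq:
  assumes "tensor_eq S h R M n u v"
    and "p \<zero>\<^bsub>S\<^esub> = 0"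
    and "\<And>a b. a \<in> carrier S \<Longrightarrow> b \<in> carrier S \<Longrightarrow> p (a \<oplus>\<^bsub>S\<^esub> b) = p a + p b"
    and "\<And>a c. a \<in> carrier S \<Longrightarrow> c \<in> carrier R \<Longrightarrow> p (a \<otimes>\<^bsub>S\<^esub> h c) = p a * p' c"
    and "\<And>x y. x \<in> carrier M \<Longrightarrow> y \<in> carrier M \<Longrightarrow> q (x \<oplus>\<^bsub>M\<^esub> y) = q x + q y"
    and "\<And>c x. c \<in> carrier R \<Longrightarrow> x \<in> carrier M \<Longrightarrow> q (c \<odot>\<^bsub>M\<^esub> x) = p' c * q x"
  shows "formal_value p q u = formal_value p q v"
  using assms(1)
  by induction (auto simp: formal_sums_def assms(2-) algebra_simps)

context valued_sheaf
begin

lemma add_section: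
  assumes "openin (topo Z) U" "openin (topo Z) V" "s \<in> carrier (sections F U)" "t \<in> carrier (sections F V)"
  obtains r where "r \<in> carrier (sections F (U \<inter> V))" "\<And>z. z \<in> U \<inter> V \<Longrightarrow> ev (U \<inter> V) r z = ev U s z + ev V t z"
proof
  let ?r = "res F U (U \<inter> V) s \<oplus>\<^bsub>sections F (U \<inter> V)\<^esub> res F V (U \<inter> V) t"
  have c: "res F U (U \<inter> V) s \<in> carrier (sections F (U \<inter> V))" "res F V (U \<inter> V) t \<in> carrier (sections F (U \<inter> V))"
    using assms by (auto intro!: res_closed)
  then show "?r \<in> carrier (sections F (U \<inter> V))" using assms by (auto intro!: add_closed)
  show "ev (U \<inter> V) ?r z = ev U s z + ev V t z" if "z \<in> U \<inter> V" for z
    using that assms c ev_res[of U "U \<inter> V" s z] ev_res[of V "U \<inter> V" t z] by (simp add: ev_add openin_Int)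
qed

lemma smult_section:
  assumes "openin (topo Z) U" "openin (topo Z) V" "a \<in> regular Z U" "t \<in> carrier (sections F V)"
  obtains r where "r \<in> carrier (sections F (U \<inter> V))" "\<And>z. z \<in> U \<inter> V \<Longrightarrow> ev (U \<inter> V) r z = a z * ev V t z"
proof
  let ?r = "restrict a (U \<inter> V) \<odot>\<^bsub>sections F (U \<inter> V)\<^esub> res F V (U \<inter> V) t"
  have c: "restrict a (U \<inter> V) \<in> regular Z (U \<inter> V)" "res F V (U \<inter> V) t \<in> carrier (sections F (U \<inter> V))"
    using assms by (auto intro!: res_closed regular_restrict[of U])
  then show "?r \<in> carrier (sections F (U \<inter> V))" using assms by (auto intro!: smult_closed)
  show "ev (U \<inter> V) ?r z = a z * ev V t z" if "z \<in> U \<inter> V" for z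
    using that assms c ev_res[of V "U \<inter> V" t z] by (subst ev_smult) auto
qed

lemma stalk_add:
  assumes "A \<in> carrier (stalk Z F x)" "B \<in> carrier (stalk Z F x)"
  shows "A \<oplus>\<^bsub>stalk Z F x\<^esub> B \<in> carrier (stalk Z F x)"
    and "germ_value ev x (A \<oplus>\<^bsub>stalk Z F x\<^esub> B) = germ_value ev x A + germ_value ev x B"
proof -
  obtain U s where U: "openin (topo Z) U" "x \<in> U" "s \<in> carrier (sections F U)" "A = germ x U s"
    using assms(1) by (rule stalk_cases)
  obtain V t where V: "openin (topo Z) V" "x \<in> V" "t \<in> carrier (sections F V)" "B = germ x V t"
    using assms(2) by (rule stalk_cases)
  obtain r where r: "r \<in> carrier (sections F (U \<inter> V))" "\<And>z. z \<in> U \<inter> V \<Longrightarrow> ev (U \<inter> V) r z = ev U s z + ev V t z"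
    using add_section U V by blast
  have eq: "A \<oplus>\<^bsub>stalk Z F x\<^esub> B = germ x (U \<inter> V) r"
    unfolding U V by (rule stalk_add_germ) (use U V r in auto)
  show "A \<oplus>\<^bsub>stalk Z F x\<^esub> B \<in> carrier (stalk Z F x)"
    unfolding eq using U V r by (intro germ_in_stalk) auto
  show "germ_value ev x (A \<oplus>\<^bsub>stalk Z F x\<^esub> B) = germ_value ev x A + germ_value ev x B"
    unfolding eq using U V r by (simp add: germ_value_germ openin_Int)
qed

lemma stalk_smult:
  assumes "A \<in> carrier (local_ring Z x)" "B \<in> carrier (stalk Z F x)"
  shows "A \<odot>\<^bsub>stalk Z F x\<^esub> B \<in> carrier (stalk Z F x)"
    and "germ_value ev x (A \<odot>\<^bsub>stalk Z F x\<^esub> B) = germ_value (\<lambda>U a. a) x A * germ_value ev x B"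
proof -
  obtain U a where U: "openin (topo Z) U" "x \<in> U" "a \<in> regular Z U" "A = O.germ x U a"
    using assms(1) by (rule O.stalk_cases) auto
  obtain V t where V: "openin (topo Z) V" "x \<in> V" "t \<in> carrier (sections F V)" "B = germ x V t"
    using assms(2) by (rule stalk_cases)
  obtain r where r: "r \<in> carrier (sections F (U \<inter> V))" "\<And>z. z \<in> U \<inter> V \<Longrightarrow> ev (U \<inter> V) r z = a z * ev V t z"
    using smult_section U V by blast
  have eq: "A \<odot>\<^bsub>stalk Z F x\<^esub> B = germ x (U \<inter> V) r"
    unfolding U V by (rule stalk_smult_germ) (use U V r in auto)
  show "A \<odot>\<^bsub>stalk Z F x\<^esub> B \<in> carrier (stalk Z F x)"
    unfolding eq using U V r by (intro germ_in_stalk) auto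
  show "germ_value ev x (A \<odot>\<^bsub>stalk Z F x\<^esub> B) = germ_value (\<lambda>U a. a) x A * germ_value ev x B"
    unfolding eq using U V r by (simp add: germ_value_germ O.germ_value_germ openin_Int)
qed

end

section \<open>Ring laws for germs of regular functions\<close>

context function_space
begin

lemma regular_add_Int:
  assumes "openin (topo Z) U" "openin (topo Z) V" "a \<in> regular Z U" "b \<in> regular Z V"
  shows "(\<lambda>x\<in>U \<inter> V. a x + b x) \<in> regular Z (U \<inter> V)"
proof -
  have "(\<lambda>x\<in>U \<inter> V. restrict a (U \<inter> V) x + restrict b (U \<inter> V) x) \<in> regular Z (U \<inter> V)"
    using assms by (intro regular_add regular_restrict[OF assms(1) _ _ assms(3)]
      regular_restrict[OF assms(2) _ _ assms(4)]) auto
  then show ?thesis by (simp cong: restrict_cong)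
qed

lemma regular_mult_Int:
  assumes "openin (topo Z) U" "openin (topo Z) V" "a \<in> regular Z U" "b \<in> regular Z V"
  shows "(\<lambda>x\<in>U \<inter> V. a x * b x) \<in> regular Z (U \<inter> V)"
proof -
  have "(\<lambda>x\<in>U \<inter> V. restrict a (U \<inter> V) x * restrict b (U \<inter> V) x) \<in> regular Z (U \<inter> V)"
    using assms by (intro regular_mult regular_restrict[OF assms(1) _ _ assms(3)]
      regular_restrict[OF assms(2) _ _ assms(4)]) auto
  then show ?thesis by (simp cong: restrict_cong)
qed

lemma local_ring_cases:
  assumes "A \<in> carrier (local_ring Z x)"
  obtains U a where "openin (topo Z) U" "x \<in> U" "a \<in> regular Z U" "A = O.germ x U a"
  using assms by (rule O.stalk_cases) auto

lemma local_ring_mult_germ_Int: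
  assumes "openin (topo Z) U" "a \<in> regular Z U" "x \<in> U"
    and "openin (topo Z) V" "b \<in> regular Z V" "x \<in> V"
  shows "O.germ x U a \<otimes>\<^bsub>local_ring Z x\<^esub> O.germ x V b = O.germ x (U \<inter> V) (\<lambda>x\<in>U \<inter> V. a x * b x)"
  by (rule local_ring_mult_germ) (use assms in \<open>auto intro: regular_mult_Int\<close>)

lemma local_ring_add_germ_Int:
  assumes "openin (topo Z) U" "a \<in> regular Z U" "x \<in> U"
    and "openin (topo Z) V" "b \<in> regular Z V" "x \<in> V"
  shows "O.germ x U a \<oplus>\<^bsub>local_ring Z x\<^esub> O.germ x V b = O.germ x (U \<inter> V) (\<lambda>x\<in>U \<inter> V. a x + b x)"
  by (rule O.stalk_add_germ) (use assms in \<open>auto intro: regular_add_Int\<close>)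

lemma local_ring_mult:
  assumes "A \<in> carrier (local_ring Z x)" "B \<in> carrier (local_ring Z x)"
  shows "A \<otimes>\<^bsub>local_ring Z x\<^esub> B \<in> carrier (local_ring Z x)"
    and "germ_value (\<lambda>U a. a) x (A \<otimes>\<^bsub>local_ring Z x\<^esub> B)
      = germ_value (\<lambda>U a. a) x A * germ_value (\<lambda>U a. a) x B"
proof -
  obtain U a where U: "openin (topo Z) U" "x \<in> U" "a \<in> regular Z U" "A = O.germ x U a"
    using assms(1) by (rule local_ring_cases)
  obtain V b where V: "openin (topo Z) V" "x \<in> V" "b \<in> regular Z V" "B = O.germ x V b"
    using assms(2) by (rule local_ring_cases)
  have eq: "A \<otimes>\<^bsub>local_ring Z x\<^esub> B = O.germ x (U \<inter> V) (\<lambda>x\<in>U \<inter> V. a x * b x)"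
    unfolding U V using U V by (intro local_ring_mult_germ_Int)
  show "A \<otimes>\<^bsub>local_ring Z x\<^esub> B \<in> carrier (local_ring Z x)"
    unfolding eq using U V by (intro O.germ_in_stalk) (auto intro: regular_mult_Int)
  show "germ_value (\<lambda>U a. a) x (A \<otimes>\<^bsub>local_ring Z x\<^esub> B)
      = germ_value (\<lambda>U a. a) x A * germ_value (\<lambda>U a. a) x B"
    unfolding eq using U V by (simp add: O.germ_value_germ openin_Int regular_mult_Int)
qed

lemma local_ring_zero_closed:
  assumes "x \<in> topspace (topo Z)"
  shows "\<zero>\<^bsub>local_ring Z x\<^esub> \<in> carrier (local_ring Z x)" "germ_value (\<lambda>U a. a) x \<zero>\<^bsub>local_ring Z x\<^esub> = 0"
  using assms local_ring_zero[of "topspace (topo Z)" x]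
  by (auto simp: O.germ_value_germ regular_zero intro!: O.germ_in_stalk)

lemma local_ring_mult_assoc:
  assumes "A \<in> carrier (local_ring Z x)" "B \<in> carrier (local_ring Z x)" "C \<in> carrier (local_ring Z x)"
  shows "A \<otimes>\<^bsub>local_ring Z x\<^esub> (B \<otimes>\<^bsub>local_ring Z x\<^esub> C) = A \<otimes>\<^bsub>local_ring Z x\<^esub> B \<otimes>\<^bsub>local_ring Z x\<^esub> C"
proof -
  obtain U a where U: "openin (topo Z) U" "x \<in> U" "a \<in> regular Z U" "A = O.germ x U a"
    using assms(1) by (rule local_ring_cases)
  obtain V b where V: "openin (topo Z) V" "x \<in> V" "b \<in> regular Z V" "B = O.germ x V b"
    using assms(2) by (rule local_ring_cases)
  obtain W c where W: "openin (topo Z) W" "x \<in> W" "c \<in> regular Z W" "C = O.germ x W c"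
    using assms(3) by (rule local_ring_cases)
  show ?thesis
    unfolding U V W using U V W
    by (simp add: local_ring_mult_germ_Int regular_mult_Int openin_Int del: restrict_apply)
      (rule O.germ_eqI[of _ _ _ _ "U \<inter> V \<inter> W"],
        auto simp: regular_mult_Int openin_Int mult.assoc simp del: restrict_apply, simp add: mult.assoc)
qed

lemma local_ring_distrib:
  assumes "A \<in> carrier (local_ring Z x)" "B \<in> carrier (local_ring Z x)" "C \<in> carrier (local_ring Z x)"
  shows "A \<otimes>\<^bsub>local_ring Z x\<^esub> (B \<oplus>\<^bsub>local_ring Z x\<^esub> C)
    = A \<otimes>\<^bsub>local_ring Z x\<^esub> B \<oplus>\<^bsub>local_ring Z x\<^esub> A \<otimes>\<^bsub>local_ring Z x\<^esub> C"
proof -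
  obtain U a where U: "openin (topo Z) U" "x \<in> U" "a \<in> regular Z U" "A = O.germ x U a"
    using assms(1) by (rule local_ring_cases)
  obtain V b where V: "openin (topo Z) V" "x \<in> V" "b \<in> regular Z V" "B = O.germ x V b"
    using assms(2) by (rule local_ring_cases)
  obtain W c where W: "openin (topo Z) W" "x \<in> W" "c \<in> regular Z W" "C = O.germ x W c"
    using assms(3) by (rule local_ring_cases)
  show ?thesis
    unfolding U V W using U V W
    by (simp add: local_ring_mult_germ_Int local_ring_add_germ_Int regular_add_Int regular_mult_Int openin_Int
          del: restrict_apply)
      (rule O.germ_eqI[of _ _ _ _ "U \<inter> V \<inter> W"],
        auto simp: regular_mult_Int regular_add_Int openin_Int simp del: restrict_apply, simp add: distrib_left)
qed

lemma local_ring_mult_zero: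
  assumes "A \<in> carrier (local_ring Z x)"
  shows "A \<otimes>\<^bsub>local_ring Z x\<^esub> \<zero>\<^bsub>local_ring Z x\<^esub> = \<zero>\<^bsub>local_ring Z x\<^esub>"
proof -
  obtain U a where U: "openin (topo Z) U" "x \<in> U" "a \<in> regular Z U" "A = O.germ x U a"
    using assms(1) by (rule local_ring_cases)
  have z: "\<zero>\<^bsub>local_ring Z x\<^esub> = O.germ x U (\<lambda>x\<in>U. 0)" using U by (intro local_ring_zero)
  show ?thesis
    unfolding z U by (rule local_ring_mult_germ) (use U in \<open>auto simp: regular_zero\<close>)
qed

end

text \<open>\<open>gen V g\<close> records a local trivialisation: g is the value function of a
  section that generates over V. As a predicate it can stand for a whole family, such as the
  coordinates of projective space. The axiom \<open>gen_local\<close> asks for a regular coefficient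
  only near each point, which is all that arguments about germs use.\<close>

locale line_sheaf = valued_sheaf Z F ev
  for Z :: "('a, 'f::field) fun_space" and F :: "('a, 'a \<Rightarrow> 'f, 'm) mod_sheaf" and ev +
  fixes gen :: "'a set \<Rightarrow> ('a \<Rightarrow> 'f) \<Rightarrow> bool"
  assumes gen_open: "gen V g \<Longrightarrow> openin (topo Z) V"
    and gen_nonzero: "gen V g \<Longrightarrow> x \<in> V \<Longrightarrow> g x \<noteq> 0"
    and gen_section: "gen V g \<Longrightarrow> \<exists>s\<in>carrier (sections F V). \<forall>x\<in>V. ev V s x = g x"
    and gen_cover: "x \<in> topspace (topo Z) \<Longrightarrow> \<exists>V g. gen V g \<and> x \<in> V"
    and gen_local: "openin (topo Z) U \<Longrightarrow> s \<in> carrier (sections F U) \<Longrightarrow> gen V g \<Longrightarrow> x \<in> U \<Longrightarrow> x \<in> V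
      \<Longrightarrow> \<exists>W a. openin (topo Z) W \<and> x \<in> W \<and> W \<subseteq> U \<inter> V \<and> a \<in> regular Z W \<and> (\<forall>z\<in>W. ev U s z = a z * g z)"

section \<open>Pullbacks of tensor powers of line sheaves\<close>

text \<open>One construction covers both cases that occur: n = 1 is the pullback along \<phi>, and
  the identity map gives the tensor power.\<close>

locale line_pullback = Z: function_space Z + Y: line_sheaf Y F ev gen
  for Z :: "('a, 'f::field) fun_space" and Y :: "('b, 'f) fun_space"
    and F :: "('b, 'b \<Rightarrow> 'f, 'm) mod_sheaf" and ev gen +
  fixes \<phi> :: "'a \<Rightarrow> 'b" and n :: nat
  assumes morphism: "space_morphism Z Y \<phi>"
begin

abbreviation pre :: "'b set \<Rightarrow> 'a set" where
  "pre V \<equiv> {x \<in> topspace (topo Z). \<phi> x \<in> V}"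

lemma pre_open: "openin (topo Y) V \<Longrightarrow> openin (topo Z) (pre V)"
  using morphism by (auto simp: space_morphism_def continuous_map_def)

lemma phi_in: "x \<in> topspace (topo Z) \<Longrightarrow> \<phi> x \<in> topspace (topo Y)"
  using morphism by (auto simp: space_morphism_def continuous_map_def)

lemma comp_regular:
  "openin (topo Y) V \<Longrightarrow> c \<in> regular Y V \<Longrightarrow> (\<lambda>x\<in>pre V. c (\<phi> x)) \<in> regular Z (pre V)"
  using morphism by (auto simp: space_morphism_def)

text \<open>If two functions agree on W, their composites with \<phi> agree on \<open>pre W\<close>;
  so the union over representatives has one member.\<close>

lemma germ_comap_germ:
  assumes "openin (topo Y) V" "c \<in> regular Y V" "x \<in> pre V"
  shows "germ_comap Z Y \<phi> x (Y.O.germ (\<phi> x) V c) = Z.O.germ x (pre V) (\<lambda>x\<in>pre V. c (\<phi> x))"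
proof -
  have "Z.O.germ x (pre V') (\<lambda>x\<in>pre V'. c' (\<phi> x)) = Z.O.germ x (pre V) (\<lambda>x\<in>pre V. c (\<phi> x))"
    if "(V', c') \<in> Y.O.germ (\<phi> x) V c" for V' c'
  proof -
    obtain W where W: "openin (topo Y) V'" "\<phi> x \<in> V'" "c' \<in> regular Y V'" "openin (topo Y) W" "\<phi> x \<in> W"
      "W \<subseteq> V \<inter> V'" "\<forall>z\<in>W. c z = c' z"
      using \<open>(V', c') \<in> _\<close> assms by (auto simp: Y.O.mem_germ_iff)
    show ?thesis
      by (rule Z.O.germ_eqI[of _ _ _ _ "pre W"]) (use W assms in \<open>auto simp: pre_open comp_regular\<close>)
  qed
  moreover have "(V, c) \<in> Y.O.germ (\<phi> x) V c"
    using assms by (intro Y.O.mem_germ_self) auto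
  ultimately have "(\<Union>(V', c')\<in>Y.O.germ (\<phi> x) V c. Z.O.germ x (pre V') (\<lambda>x\<in>pre V'. c' (\<phi> x)))
      = Z.O.germ x (pre V) (\<lambda>x\<in>pre V. c (\<phi> x))"
    by fast
  then show ?thesis by (simp add: germ_comap_def Let_def)
qed

lemma germ_comap_closed:
  assumes "x \<in> topspace (topo Z)" "A \<in> carrier (local_ring Y (\<phi> x))"
  shows "germ_comap Z Y \<phi> x A \<in> carrier (local_ring Z x)"
    and "germ_value (\<lambda>U a. a) x (germ_comap Z Y \<phi> x A) = germ_value (\<lambda>U a. a) (\<phi> x) A"
proof -
  obtain V c where V: "openin (topo Y) V" "\<phi> x \<in> V" "c \<in> regular Y V" "A = Y.O.germ (\<phi> x) V c"
    using assms(2) by (rule Y.local_ring_cases)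
  have eq: "germ_comap Z Y \<phi> x A = Z.O.germ x (pre V) (\<lambda>x\<in>pre V. c (\<phi> x))"
    unfolding V(4) using V assms(1) by (intro germ_comap_germ) auto
  show "germ_comap Z Y \<phi> x A \<in> carrier (local_ring Z x)"
    unfolding eq using V assms(1) by (intro Z.O.germ_in_stalk) (auto simp: pre_open comp_regular)
  show "germ_value (\<lambda>U a. a) x (germ_comap Z Y \<phi> x A) = germ_value (\<lambda>U a. a) (\<phi> x) A"
    unfolding eq unfolding V(4) using V assms(1)
    by (simp add: Z.O.germ_value_germ Y.O.germ_value_germ pre_open comp_regular del: restrict_apply) simp
qed

lemma tensor_setting_stalks:
  assumes "x \<in> topspace (topo Z)"
  shows "tensor_setting (local_ring Z x) (germ_comap Z Y \<phi> x) (local_ring Y (\<phi> x)) (stalk Y F (\<phi> x))"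
  by unfold_locales
    (use assms in \<open>auto simp: Z.local_ring_zero_closed Z.O.stalk_add Z.local_ring_mult Z.local_ring_mult_zero
       Z.local_ring_distrib Z.local_ring_mult_assoc germ_comap_closed Y.stalk_add Y.stalk_smult\<close>)

abbreviation eq_at where
  "eq_at x \<equiv> tensor_eq (local_ring Z x) (germ_comap Z Y \<phi> x) (local_ring Y (\<phi> x)) (stalk Y F (\<phi> x)) n"
abbreviation class_at where
  "class_at x \<equiv> tensor_class (local_ring Z x) (germ_comap Z Y \<phi> x) (local_ring Y (\<phi> x)) (stalk Y F (\<phi> x)) n"
abbreviation sums_at where
  "sums_at x \<equiv> formal_sums (local_ring Z x) (stalk Y F (\<phi> x)) n"
abbreviation sums_on where
  "sums_on W V \<equiv> formal_sums (sections (structure_sheaf Z) W) (sections F V) n"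
abbreviation germs_at where
  "germs_at x W V u \<equiv> image_mset (\<lambda>(a, ss). (Z.O.germ x W a, map (Y.germ (\<phi> x) V) ss)) u"
abbreviation section_of where
  "section_of \<equiv> formal_section Z Y \<phi> F n"
abbreviation sheaf where
  "sheaf \<equiv> tensor_pullback Z Y \<phi> F n"

definition section_value :: "'b set \<Rightarrow> (('a \<Rightarrow> 'f) \<times> 'm list) multiset \<Rightarrow> 'a \<Rightarrow> 'f" where
  "section_value V u x = formal_value (\<lambda>a. a x) (\<lambda>s. ev V s (\<phi> x)) u"

text \<open>The chosen formal sum is immaterial because \<open>formal_value_tensor_eq\<close>
  applies with p and q the evaluations at x and \<phi> x.\<close>

definition point_value :: "'a \<Rightarrow> ('a, 'f, 'b, 'm) tensor_germ \<Rightarrow> 'f" where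
  "point_value x T = formal_value (germ_value (\<lambda>U a. a) x) (germ_value ev (\<phi> x)) (SOME u. u \<in> T)"

lemma point_value_class:
  assumes "x \<in> topspace (topo Z)" "u \<in> sums_at x"
  shows "point_value x (class_at x u) = formal_value (germ_value (\<lambda>U a. a) x) (germ_value ev (\<phi> x)) u"
proof -
  have "u \<in> class_at x u" using assms(2) by (simp add: tensor_class_def tensor_eq.refl)
  then have "(SOME v. v \<in> class_at x u) \<in> class_at x u" by (metis someI)
  then have "eq_at x u (SOME v. v \<in> class_at x u)" by (simp add: tensor_class_def)
  then show ?thesis
    unfolding point_value_def
    by (rule formal_value_tensor_eq[symmetric, where p' = "germ_value (\<lambda>U a. a) (\<phi> x)"])
      (use assms(1) in \<open>auto simp: Z.local_ring_zero_closed Z.O.stalk_add Z.local_ring_mult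
        germ_comap_closed Y.stalk_add Y.stalk_smult\<close>)
qed

lemma germs_at_closed:
  assumes "openin (topo Z) W" "openin (topo Y) V" "\<phi> ` W \<subseteq> V" "u \<in> sums_on W V" "x \<in> W"
  shows "germs_at x W V u \<in> sums_at x"
proof -
  have "\<phi> x \<in> V" using assms by auto
  then show ?thesis
    using assms by (fastforce simp: formal_sums_def intro!: Z.O.germ_in_stalk Y.germ_in_stalk)
qed

lemma formal_value_germs_at:
  assumes "openin (topo Z) W" "openin (topo Y) V" "\<phi> ` W \<subseteq> V" "u \<in> sums_on W V" "x \<in> W"
  shows "formal_value (germ_value (\<lambda>U a. a) x) (germ_value ev (\<phi> x)) (germs_at x W V u) = section_value V u x"
  using assms(4)
proof (induction u)
  case (add p u)
  obtain a ss where p: "p = (a, ss)" by (cases p)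
  have "\<phi> x \<in> V" using assms by auto
  have a: "a \<in> regular Z W" "set ss \<subseteq> carrier (sections F V)" "u \<in> sums_on W V"
    using add.prems by (auto simp: formal_sums_def p)
  then have "map (\<lambda>s. germ_value ev (\<phi> x) (Y.germ (\<phi> x) V s)) ss = map (\<lambda>s. ev V s (\<phi> x)) ss"
    using assms \<open>\<phi> x \<in> V\<close> by (auto simp: Y.germ_value_germ)
  then have "(\<Prod>s\<leftarrow>ss. germ_value ev (\<phi> x) (Y.germ (\<phi> x) V s)) = (\<Prod>s\<leftarrow>ss. ev V s (\<phi> x))"
    by (rule arg_cong)
  then show ?case
    using add a assms(1,5) by (simp add: p section_value_def Z.O.germ_value_germ o_def)
qed (simp add: section_value_def)

lemma point_value_section_of:
  assumes "openin (topo Z) W" "openin (topo Y) V" "\<phi> ` W \<subseteq> V" "u \<in> sums_on W V" "x \<in> W"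
  shows "point_value x (section_of W V u x) = section_value V u x"
proof -
  have "x \<in> topspace (topo Z)" using assms openin_subset by blast
  then show ?thesis
    using assms by (simp add: formal_section_def point_value_class germs_at_closed formal_value_germs_at)
qed
end

context line_pullback
begin

lemma section_value_simps [simp]:
  "section_value V {#} x = 0"
  "section_value V (add_mset (a, ss) u) x = a x * (\<Prod>s\<leftarrow>ss. ev V s (\<phi> x)) + section_value V u x"
  by (simp_all add: section_value_def)

text \<open>
  Near \<open>\<phi> x\<close> every section is a multiple of the generator \<open>\<gamma>\<close>, so the slots can be replaced by \<open>\<gamma>\<close> one after
  the other, each time moving the factor to the coefficient; this shrinks the neighbourhood finitely often.
\<close>

lemma reduce_slots:
  assumes "gen V\<^sub>0 g" "\<gamma> \<in> carrier (sections F V\<^sub>0)" "\<And>y. y \<in> V\<^sub>0 \<Longrightarrow> ev V\<^sub>0 \<gamma> y = g y" "\<phi> x \<in> V\<^sub>0"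
    and "openin (topo Y) V" "\<phi> x \<in> V"
    and "set ss \<subseteq> carrier (sections F V)" "openin (topo Z) W" "x \<in> W" "b \<in> regular Z W" "k + length ss = n"
  shows "\<exists>W' b'. openin (topo Z) W' \<and> x \<in> W' \<and> W' \<subseteq> W \<and> b' \<in> regular Z W' \<and>
    eq_at x {#(Z.O.germ x W b, replicate k (Y.germ (\<phi> x) V\<^sub>0 \<gamma>) @ map (Y.germ (\<phi> x) V) ss)#}
      {#(Z.O.germ x W' b', replicate n (Y.germ (\<phi> x) V\<^sub>0 \<gamma>))#} \<and>
    (\<forall>z\<in>W'. b' z * g (\<phi> z) ^ n = b z * g (\<phi> z) ^ k * (\<Prod>s\<leftarrow>ss. ev V s (\<phi> z)))"
  using assms(7-)
proof (induction ss arbitrary: W b k)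
  case Nil
  have "Z.O.germ x W b \<in> carrier (local_ring Z x)" "Y.germ (\<phi> x) V\<^sub>0 \<gamma> \<in> carrier (stalk Y F (\<phi> x))"
    using Nil assms(1,2,4) by (auto intro!: Z.O.germ_in_stalk Y.germ_in_stalk Y.gen_open)
  then have "{#(Z.O.germ x W b, replicate n (Y.germ (\<phi> x) V\<^sub>0 \<gamma>))#} \<in> sums_at x"
    by (auto simp: formal_sums_def)
  then show ?case using Nil by (auto intro!: exI[of _ W] exI[of _ b] tensor_eq.refl)
next
  case (Cons s ss)
  let ?\<Gamma> = "Y.germ (\<phi> x) V\<^sub>0 \<gamma>"
  let ?rest = "map (Y.germ (\<phi> x) V) ss"
  have V0: "openin (topo Y) V\<^sub>0" using assms(1) by (rule Y.gen_open)
  have xZ: "x \<in> topspace (topo Z)" using Cons.prems openin_subset by blast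
  \<comment> \<open>Near \<phi> x the leading unreduced factor s is c times the generator; the
    coefficient c is what moves out of the slot.\<close>
  obtain V' c where V': "openin (topo Y) V'" "\<phi> x \<in> V'" "V' \<subseteq> V \<inter> V\<^sub>0" "c \<in> regular Y V'"
    "\<forall>y\<in>V'. ev V s y = c y * g y"
    using Y.gen_local[of V s V\<^sub>0 g "\<phi> x"] assms(1,4-6) Cons.prems(1) by auto
  let ?C = "Y.O.germ (\<phi> x) V' c"
  let ?W = "W \<inter> pre V'"
  define b\<^sub>1 where "b\<^sub>1 = (\<lambda>z\<in>?W. b z * (\<lambda>x\<in>pre V'. c (\<phi> x)) z)"
  have s: "Y.germ (\<phi> x) V s = ?C \<odot>\<^bsub>stalk Y F (\<phi> x)\<^esub> ?\<Gamma>"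
    by (rule Y.stalk_smult_germ[symmetric]) (use V' V0 assms Cons.prems in auto)
  have C: "?C \<in> carrier (local_ring Y (\<phi> x))" using V' by (intro Y.O.germ_in_stalk) auto
  have "Z.O.germ x W b \<in> carrier (local_ring Z x)" "?\<Gamma> \<in> carrier (stalk Y F (\<phi> x))"
    "set ?rest \<subseteq> carrier (stalk Y F (\<phi> x))"
    using Cons.prems V0 assms by (auto intro!: Z.O.germ_in_stalk Y.germ_in_stalk)
  then have "{#(Z.O.germ x W b, replicate k ?\<Gamma> @ ?\<Gamma> # ?rest)#} \<in> sums_at x"
    using Cons.prems by (auto simp: formal_sums_def)
  then have eq1: "eq_at x {#(Z.O.germ x W b, replicate k ?\<Gamma> @ map (Y.germ (\<phi> x) V) (s # ss))#}
      {#(Z.O.germ x W b \<otimes>\<^bsub>local_ring Z x\<^esub> germ_comap Z Y \<phi> x ?C, replicate k ?\<Gamma> @ ?\<Gamma> # ?rest)#}"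
    unfolding list.map s using C by (rule tensor_eq.slot_smult)
  have W: "openin (topo Z) ?W" using Cons.prems V' pre_open by auto
  have xV': "x \<in> pre V'" using V' xZ by simp
  have b: "b\<^sub>1 \<in> regular Z ?W"
    unfolding b\<^sub>1_def using Cons.prems V' by (intro Z.regular_mult_Int pre_open comp_regular)
  have g: "Z.O.germ x W b \<otimes>\<^bsub>local_ring Z x\<^esub> germ_comap Z Y \<phi> x ?C = Z.O.germ x ?W b\<^sub>1"
    unfolding b\<^sub>1_def germ_comap_germ[OF V'(1,4) xV']
    by (rule Z.local_ring_mult_germ_Int) (use Cons.prems V' xV' pre_open comp_regular in blast)+
  \<comment> \<open>The number k counts the slots already filled with the generator, so the
    induction hypothesis is used with k + 1. The identity of value functions is carried along on the
    whole neighbourhood, since later the coefficients have to be compared there and not only at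
    x.\<close>
  have "\<exists>W' b'. openin (topo Z) W' \<and> x \<in> W' \<and> W' \<subseteq> ?W \<and> b' \<in> regular Z W' \<and>
      eq_at x {#(Z.O.germ x ?W b\<^sub>1, replicate (Suc k) ?\<Gamma> @ ?rest)#} {#(Z.O.germ x W' b', replicate n ?\<Gamma>)#} \<and>
      (\<forall>z\<in>W'. b' z * g (\<phi> z) ^ n = b\<^sub>1 z * g (\<phi> z) ^ Suc k * (\<Prod>s\<leftarrow>ss. ev V s (\<phi> z)))"
    by (rule Cons.IH) (use Cons.prems W b V' xZ in auto)
  then obtain W' b' where W': "openin (topo Z) W'" "x \<in> W'" "W' \<subseteq> ?W" "b' \<in> regular Z W'"
      and eq2: "eq_at x {#(Z.O.germ x ?W b\<^sub>1, replicate (Suc k) ?\<Gamma> @ ?rest)#} {#(Z.O.germ x W' b', replicate n ?\<Gamma>)#}"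
      and v: "\<forall>z\<in>W'. b' z * g (\<phi> z) ^ n = b\<^sub>1 z * g (\<phi> z) ^ Suc k * (\<Prod>s\<leftarrow>ss. ev V s (\<phi> z))"
    by blast
  have "eq_at x {#(Z.O.germ x W b, replicate k ?\<Gamma> @ map (Y.germ (\<phi> x) V) (s # ss))#}
      {#(Z.O.germ x W' b', replicate n ?\<Gamma>)#}"
    using eq1 eq2 unfolding g by (simp add: replicate_app_Cons_same tensor_eq.trans)
  moreover have "b' z * g (\<phi> z) ^ n = b z * g (\<phi> z) ^ k * (\<Prod>s\<leftarrow>s # ss. ev V s (\<phi> z))" if z: "z \<in> W'" for z
  proof -
    have "z \<in> W" "\<phi> z \<in> V'" "z \<in> topspace (topo Z)" using z W' by auto
    then show ?thesis using v z V' by (simp add: b\<^sub>1_def algebra_simps)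
  qed
  ultimately show ?case using W' by blast
qed

text \<open>The stalk of the tensor sheaf is generated by the single element \<gamma> \<otimes> ...
  \<otimes> \<gamma>: each summand is reduced by \<open>reduce_slots\<close>, and summands with
  identical slots are merged by adding coefficients on the common neighbourhood.\<close>

lemma normal_form:
  assumes "gen V\<^sub>0 g" "\<gamma> \<in> carrier (sections F V\<^sub>0)" "\<And>y. y \<in> V\<^sub>0 \<Longrightarrow> ev V\<^sub>0 \<gamma> y = g y" "\<phi> x \<in> V\<^sub>0"
    and "openin (topo Y) V" "openin (topo Z) W" "\<phi> ` W \<subseteq> V" "x \<in> W"
    and "u \<in> sums_on W V"
  shows "\<exists>W' b. openin (topo Z) W' \<and> x \<in> W' \<and> W' \<subseteq> W \<and> b \<in> regular Z W' \<and>
    eq_at x (germs_at x W V u) {#(Z.O.germ x W' b, replicate n (Y.germ (\<phi> x) V\<^sub>0 \<gamma>))#} \<and>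
    (\<forall>z\<in>W'. section_value V u z = b z * g (\<phi> z) ^ n)"
  using assms(9)
proof (induction u)
  let ?\<Gamma>s = "replicate n (Y.germ (\<phi> x) V\<^sub>0 \<gamma>)"
  have xZ: "x \<in> topspace (topo Z)" using assms(6,8) openin_subset by blast
  interpret T: tensor_setting "local_ring Z x" "germ_comap Z Y \<phi> x" "local_ring Y (\<phi> x)" "stalk Y F (\<phi> x)" n
    using xZ by (rule tensor_setting_stalks)
  have G: "set ?\<Gamma>s \<subseteq> carrier (stalk Y F (\<phi> x))"
    using assms(1,2,4) by (auto intro!: Y.germ_in_stalk Y.gen_open)
  {
    case empty
    \<comment> \<open>The empty sum has no slots, so \<open>coeff_zero\<close> is read from right to
      left to give it the normal form with coefficient zero.\<close>
    have "eq_at x {#(\<zero>\<^bsub>local_ring Z x\<^esub>, ?\<Gamma>s)#} {#}"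
      by (rule tensor_eq.coeff_zero) (use G T.S_zero in auto)
    then show ?case using assms(6,8)
      by (auto intro!: exI[of _ W] exI[of _ "\<lambda>x\<in>W. 0"] Z.regular_zero tensor_eq.sym
        simp: Z.local_ring_zero[of W])
  next
    case (add p u)
    obtain a ss where p: "p = (a, ss)" by (cases p)
    have a: "a \<in> regular Z W" "length ss = n" "set ss \<subseteq> carrier (sections F V)" "u \<in> sums_on W V"
      using add.prems by (auto simp: formal_sums_def p)
    obtain A b where A: "openin (topo Z) A" "x \<in> A" "A \<subseteq> W" "b \<in> regular Z A"
      and eqA: "eq_at x (germs_at x W V u) {#(Z.O.germ x A b, ?\<Gamma>s)#}"
      and vA: "\<forall>z\<in>A. section_value V u z = b z * g (\<phi> z) ^ n"
      using add.IH[OF a(4)] by blast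
    obtain B c where B: "openin (topo Z) B" "x \<in> B" "B \<subseteq> W" "c \<in> regular Z B"
      and eqB: "eq_at x {#(Z.O.germ x W a, map (Y.germ (\<phi> x) V) ss)#} {#(Z.O.germ x B c, ?\<Gamma>s)#}"
      and vB: "\<forall>z\<in>B. c z * g (\<phi> z) ^ n = a z * (\<Prod>s\<leftarrow>ss. ev V s (\<phi> z))"
      \<comment> \<open>The value 0 for k means that no slot of this summand has been replaced
        yet.\<close>
      using reduce_slots[OF assms(1-5) _ a(3) assms(6,8) a(1), of 0] a(2) assms(7,8) by auto
    define d where "d = (\<lambda>z\<in>A \<inter> B. b z + c z)"
    have gb: "Z.O.germ x A b \<in> carrier (local_ring Z x)" and gc: "Z.O.germ x B c \<in> carrier (local_ring Z x)"
      using A B by (auto intro!: Z.O.germ_in_stalk)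
    have "eq_at x (germs_at x W V u + {#(Z.O.germ x W a, map (Y.germ (\<phi> x) V) ss)#})
       ({#(Z.O.germ x A b, ?\<Gamma>s)#} + {#(Z.O.germ x W a, map (Y.germ (\<phi> x) V) ss)#})"
      using eqA T.tensor_eq_formal_sums[OF eqB] by (blast intro: tensor_eq.cong)
    moreover have "eq_at x ({#(Z.O.germ x W a, map (Y.germ (\<phi> x) V) ss)#} + {#(Z.O.germ x A b, ?\<Gamma>s)#})
       ({#(Z.O.germ x B c, ?\<Gamma>s)#} + {#(Z.O.germ x A b, ?\<Gamma>s)#})"
      using eqB T.tensor_eq_formal_sums[OF eqA] by (blast intro: tensor_eq.cong)
    moreover have "eq_at x {#(Z.O.germ x A b \<oplus>\<^bsub>local_ring Z x\<^esub> Z.O.germ x B c, ?\<Gamma>s)#}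
        {#(Z.O.germ x A b, ?\<Gamma>s), (Z.O.germ x B c, ?\<Gamma>s)#}"
      by (rule tensor_eq.coeff_add) (use gb gc G in auto)
    moreover have "Z.O.germ x A b \<oplus>\<^bsub>local_ring Z x\<^esub> Z.O.germ x B c = Z.O.germ x (A \<inter> B) d"
      unfolding d_def using A B by (intro Z.local_ring_add_germ_Int)
    ultimately have "eq_at x (germs_at x W V (add_mset p u)) {#(Z.O.germ x (A \<inter> B) d, ?\<Gamma>s)#}"
      by (simp add: p add_mset_commute) (blast intro: tensor_eq.trans tensor_eq.sym)
    moreover have "d \<in> regular Z (A \<inter> B)" unfolding d_def using A B by (intro Z.regular_add_Int)
    moreover have "section_value V (add_mset p u) z = d z * g (\<phi> z) ^ n" if "z \<in> A \<inter> B" for z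
      using that vA vB by (simp add: p d_def algebra_simps)
    ultimately show ?case using A B by (intro exI[of _ "A \<inter> B"] exI[of _ d]) auto
  }
qed
end

context line_pullback
begin

text \<open>Faithfulness of values at the level of tensor germs. Both sums have normal forms with
  the same generator; their coefficients a and b satisfy a g^n = b g^n near x, and g vanishes
  nowhere, so a and b have the same germ.\<close>

lemma section_of_cong:
  assumes "openin (topo Z) W" "openin (topo Y) V" "\<phi> ` W \<subseteq> V" "u \<in> sums_on W V"
    and "openin (topo Z) W'" "openin (topo Y) V'" "\<phi> ` W' \<subseteq> V'" "u' \<in> sums_on W' V'"
    and "openin (topo Z) N" "x \<in> N" "N \<subseteq> W \<inter> W'"
    and eq: "\<And>z. z \<in> N \<Longrightarrow> section_value V u z = section_value V' u' z"
  shows "section_of W V u x = section_of W' V' u' x"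
proof -
  have x: "x \<in> W" "x \<in> W'" "x \<in> topspace (topo Z)" using assms(9-11) openin_subset by auto
  interpret T: tensor_setting "local_ring Z x" "germ_comap Z Y \<phi> x" "local_ring Y (\<phi> x)" "stalk Y F (\<phi> x)" n
    using x(3) by (rule tensor_setting_stalks)
  obtain V\<^sub>0 g where g: "gen V\<^sub>0 g" "\<phi> x \<in> V\<^sub>0" using Y.gen_cover phi_in x(3) by blast
  obtain \<gamma> where \<gamma>: "\<gamma> \<in> carrier (sections F V\<^sub>0)" "\<And>y. y \<in> V\<^sub>0 \<Longrightarrow> ev V\<^sub>0 \<gamma> y = g y"
    using Y.gen_section g(1) by blast
  obtain A a where A: "openin (topo Z) A" "x \<in> A" "A \<subseteq> W" "a \<in> regular Z A"
      and eqA: "eq_at x (germs_at x W V u) {#(Z.O.germ x A a, replicate n (Y.germ (\<phi> x) V\<^sub>0 \<gamma>))#}"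
      and vA: "\<forall>z\<in>A. section_value V u z = a z * g (\<phi> z) ^ n"
    using normal_form[OF g(1) \<gamma> g(2) assms(2,1,3) x(1) assms(4)] by blast
  obtain B b where B: "openin (topo Z) B" "x \<in> B" "B \<subseteq> W'" "b \<in> regular Z B"
      and eqB: "eq_at x (germs_at x W' V' u') {#(Z.O.germ x B b, replicate n (Y.germ (\<phi> x) V\<^sub>0 \<gamma>))#}"
      and vB: "\<forall>z\<in>B. section_value V' u' z = b z * g (\<phi> z) ^ n"
    using normal_form[OF g(1) \<gamma> g(2) assms(6,5,7) x(2) assms(8)] by blast
  \<comment> \<open>The factor \<open>pre\<close> of the generator's domain is included because g is
    known to be nonzero only there.\<close>
  have N: "openin (topo Z) (A \<inter> B \<inter> N \<inter> pre V\<^sub>0)"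
    using A(1) B(1) assms(9) pre_open[OF Y.gen_open[OF g(1)]] by (intro openin_Int)
  have "Z.O.germ x A a = Z.O.germ x B b"
  proof (rule Z.O.germ_eqI[of _ _ _ _ "A \<inter> B \<inter> N \<inter> pre V\<^sub>0"])
    fix z assume z: "z \<in> A \<inter> B \<inter> N \<inter> pre V\<^sub>0"
    then have "a z * g (\<phi> z) ^ n = b z * g (\<phi> z) ^ n" using vA vB eq by (metis IntD1 IntD2)
    then show "a z = b z" using z Y.gen_nonzero[OF g(1), of "\<phi> z"] by simp
  qed (use A B N assms(10) g x in auto)
  then have "class_at x (germs_at x W V u) = class_at x (germs_at x W' V' u')"
    using T.tensor_class_eqI[OF eqA] T.tensor_class_eqI[OF eqB] by simp
  then show ?thesis using x by (simp add: formal_section_def)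
qed

text \<open>Membership in the tensor stalks follows from being locally given by formal sums, so only
  extensionality and local representability remain to be checked.\<close>

lemma sections_iff:
  assumes "openin (topo Z) U"
  shows "\<sigma> \<in> carrier (sections sheaf U) \<longleftrightarrow> \<sigma> \<in> extensional U \<and>
    (\<forall>x\<in>U. \<exists>W V u. openin (topo Z) W \<and> x \<in> W \<and> W \<subseteq> U \<and> openin (topo Y) V \<and> \<phi> ` W \<subseteq> V \<and>
       u \<in> sums_on W V \<and> (\<forall>z\<in>W. \<sigma> z = section_of W V u z))"
    (is "_ \<longleftrightarrow> _ \<and> (\<forall>x\<in>U. \<exists>W V u. ?P x W V u)")
proof -
  have res: "restrict \<sigma> W = section_of W V u \<longleftrightarrow> (\<forall>z\<in>W. \<sigma> z = section_of W V u z)" for W V u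
    by (auto simp: formal_section_def fun_eq_iff)
  have "\<sigma> x \<in> carrier (tensor_stalk Z Y \<phi> F n x)" if "?P x W V u" for x W V u
  proof -
    have "\<sigma> x = class_at x (germs_at x W V u)" using that by (simp add: formal_section_def)
    moreover have "germs_at x W V u \<in> sums_at x" using that germs_at_closed by blast
    ultimately show ?thesis by (simp add: tensor_stalk_def tensor_def Let_def)
  qed
  then show ?thesis
    by (auto simp: tensor_pullback_def res PiE_def)
qed

lemma section_of_closed:
  assumes "openin (topo Z) U" "openin (topo Y) V" "\<phi> ` U \<subseteq> V" "u \<in> sums_on U V"
  shows "section_of U V u \<in> carrier (sections sheaf U)"
  using assms by (subst sections_iff) (auto simp: formal_section_def)

text \<open>Gluing by value functions: local formal sums with the common value function f define the
  same germs on overlaps by \<open>section_of_cong\<close>. The section takes at x the germ supplied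
  by the neighbourhood chosen for x itself.\<close>

lemma section_exists:
  assumes "openin (topo Z) U"
    and "\<And>x. x \<in> U \<Longrightarrow> \<exists>W V u. openin (topo Z) W \<and> x \<in> W \<and> W \<subseteq> U \<and> openin (topo Y) V \<and> \<phi> ` W \<subseteq> V \<and>
       u \<in> sums_on W V \<and> (\<forall>z\<in>W. f z = section_value V u z)"
  shows "\<exists>\<sigma>\<in>carrier (sections sheaf U). \<forall>x\<in>U. point_value x (\<sigma> x) = f x"
proof -
  have "\<forall>x\<in>U. \<exists>W V u. openin (topo Z) W \<and> x \<in> W \<and> W \<subseteq> U \<and> openin (topo Y) V \<and> \<phi> ` W \<subseteq> V \<and>
       u \<in> sums_on W V \<and> (\<forall>z\<in>W. f z = section_value V u z)"
    using assms(2) by blast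
  then obtain W V u where l: "\<And>x. x \<in> U \<Longrightarrow> openin (topo Z) (W x) \<and> x \<in> W x \<and> W x \<subseteq> U \<and>
      openin (topo Y) (V x) \<and> \<phi> ` W x \<subseteq> V x \<and> u x \<in> sums_on (W x) (V x) \<and>
      (\<forall>z\<in>W x. f z = section_value (V x) (u x) z)"
    by metis
  define \<sigma> where "\<sigma> = (\<lambda>x\<in>U. section_of (W x) (V x) (u x) x)"
  have loc: "\<sigma> z = section_of (W x) (V x) (u x) z" if "x \<in> U" "z \<in> W x" for x z
  proof -
    have "z \<in> U" using that l by blast
    note z = l[OF this] and x = l[OF that(1)]
    have "section_of (W z) (V z) (u z) z = section_of (W x) (V x) (u x) z"
      by (rule section_of_cong[of _ _ _ _ _ _ "W x \<inter> W z"]) (use x z that in auto)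
    then show ?thesis using \<open>z \<in> U\<close> by (simp add: \<sigma>_def)
  qed
  have "\<sigma> \<in> carrier (sections sheaf U)"
    unfolding sections_iff[OF assms(1)]
  proof (intro conjI ballI)
    show "\<sigma> \<in> extensional U" by (simp add: \<sigma>_def)
    fix x assume x: "x \<in> U"
    show "\<exists>W V u. openin (topo Z) W \<and> x \<in> W \<and> W \<subseteq> U \<and> openin (topo Y) V \<and> \<phi> ` W \<subseteq> V \<and>
       u \<in> sums_on W V \<and> (\<forall>z\<in>W. \<sigma> z = section_of W V u z)"
      using l[OF x] loc[OF x] by (intro exI[of _ "W x"] exI[of _ "V x"] exI[of _ "u x"]) simp
  qed
  moreover have "point_value x (\<sigma> x) = f x" if "x \<in> U" for x
    using l[OF that] that by (simp add: \<sigma>_def point_value_section_of)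
  ultimately show ?thesis by blast
qed

text \<open>\<open>normal_form\<close> speaks of the germ at x; here it is spread to a
  neighbourhood. The single-term sum and the original one have equal values there, so
  \<open>section_of_cong\<close> identifies them at every point of it.\<close>

lemma local_unit:
  assumes U: "openin (topo Z) U" "\<sigma> \<in> carrier (sections sheaf U)" "x \<in> U"
    and g: "gen V\<^sub>0 g" "\<gamma> \<in> carrier (sections F V\<^sub>0)" "\<And>y. y \<in> V\<^sub>0 \<Longrightarrow> ev V\<^sub>0 \<gamma> y = g y" "\<phi> x \<in> V\<^sub>0"
  shows "\<exists>W a. openin (topo Z) W \<and> x \<in> W \<and> W \<subseteq> U \<and> \<phi> ` W \<subseteq> V\<^sub>0 \<and> a \<in> regular Z W \<and>
    {#(a, replicate n \<gamma>)#} \<in> sums_on W V\<^sub>0 \<and>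
    (\<forall>z\<in>W. \<sigma> z = section_of W V\<^sub>0 {#(a, replicate n \<gamma>)#} z) \<and> (\<forall>z\<in>W. point_value z (\<sigma> z) = a z * g (\<phi> z) ^ n)"
proof -
  obtain A V u where A: "openin (topo Z) A" "x \<in> A" "A \<subseteq> U" "openin (topo Y) V" "\<phi> ` A \<subseteq> V"
       "u \<in> sums_on A V" "\<forall>z\<in>A. \<sigma> z = section_of A V u z"
    using U by (auto simp: sections_iff)
  obtain B b where B: "openin (topo Z) B" "x \<in> B" "B \<subseteq> A" "b \<in> regular Z B"
      "\<forall>z\<in>B. section_value V u z = b z * g (\<phi> z) ^ n"
    using normal_form[OF g A(4,1,5,2,6)] by blast
  \<comment> \<open>A formal section with slots over the generator's domain needs \<phi> to map
    \<open>W\<close> into that domain.\<close>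
  define W where "W = B \<inter> pre V\<^sub>0"
  define a where "a = restrict b W"
  have W: "openin (topo Z) W" "x \<in> W" "\<phi> ` W \<subseteq> V\<^sub>0" "W \<subseteq> B"
    unfolding W_def using B g Y.gen_open pre_open openin_subset[OF U(1)] U(3) by auto
  have a: "a \<in> regular Z W" unfolding a_def by (rule Z.regular_restrict[of B]) (use B W in auto)
  have u: "{#(a, replicate n \<gamma>)#} \<in> sums_on W V\<^sub>0"
    using a g(2) by (auto simp: formal_sums_def)
  have v: "section_value V\<^sub>0 {#(a, replicate n \<gamma>)#} z = section_value V u z" if "z \<in> W" for z
    using that B(5) W g(3)[of "\<phi> z"] by (auto simp: a_def image_subset_iff)
  have "section_of A V u z = section_of W V\<^sub>0 {#(a, replicate n \<gamma>)#} z" if "z \<in> W" for z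
    by (rule section_of_cong[of _ _ _ _ _ _ W]) (use A W B u v that Y.gen_open g in auto)
  moreover have "point_value z (section_of A V u z) = a z * g (\<phi> z) ^ n" if "z \<in> W" for z
    using that W B A by (subst point_value_section_of) (auto simp: a_def)
  ultimately show ?thesis
    using W a u A B by (intro exI[of _ W] exI[of _ a]) auto
qed

lemma generator_at:
  assumes "x \<in> topspace (topo Z)"
  obtains V g \<gamma> where "gen V g" "\<gamma> \<in> carrier (sections F V)" "\<And>y. y \<in> V \<Longrightarrow> ev V \<gamma> y = g y" "\<phi> x \<in> V"
    "openin (topo Y) V"
  using Y.gen_cover[OF phi_in[OF assms]] Y.gen_section Y.gen_open by metis

lemma sheaf_simps:
  "res sheaf U V \<sigma> = restrict \<sigma> V"
  "\<sigma> \<oplus>\<^bsub>sections sheaf U\<^esub> \<tau> = (\<lambda>x\<in>U. \<sigma> x \<oplus>\<^bsub>tensor_stalk Z Y \<phi> F n x\<^esub> \<tau> x)"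
  "a \<odot>\<^bsub>sections sheaf U\<^esub> \<sigma> = (\<lambda>x\<in>U. Z.O.germ x U a \<odot>\<^bsub>tensor_stalk Z Y \<phi> F n x\<^esub> \<sigma> x)"
  by (simp_all add: tensor_pullback_def)

text \<open>With equal slots, \<open>coeff_add\<close> read from right to left turns addition of
  classes into addition of coefficients. This reduces the module structure of the sheaf to that of
  the regular functions.\<close>

lemma add_units:
  assumes A: "openin (topo Z) A" "a \<in> regular Z A" "x \<in> A" and B: "openin (topo Z) B" "b \<in> regular Z B" "x \<in> B"
    and \<gamma>: "openin (topo Y) V" "\<gamma> \<in> carrier (sections F V)" "\<phi> x \<in> V"
  shows "section_of A V {#(a, replicate n \<gamma>)#} x \<oplus>\<^bsub>tensor_stalk Z Y \<phi> F n x\<^esub>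
      section_of B V {#(b, replicate n \<gamma>)#} x = section_of (A \<inter> B) V {#(\<lambda>z\<in>A \<inter> B. a z + b z, replicate n \<gamma>)#} x"
proof -
  let ?\<Gamma>s = "replicate n (Y.germ (\<phi> x) V \<gamma>)"
  have xZ: "x \<in> topspace (topo Z)" using A openin_subset by blast
  interpret T: tensor_setting "local_ring Z x" "germ_comap Z Y \<phi> x" "local_ring Y (\<phi> x)" "stalk Y F (\<phi> x)" n
    using xZ by (rule tensor_setting_stalks)
  have G: "set ?\<Gamma>s \<subseteq> carrier (stalk Y F (\<phi> x))" "Z.O.germ x A a \<in> carrier (local_ring Z x)"
    "Z.O.germ x B b \<in> carrier (local_ring Z x)"
    using A B \<gamma> by (auto intro!: Y.germ_in_stalk Z.O.germ_in_stalk)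
  have "T.cls {#(Z.O.germ x A a, ?\<Gamma>s)#} \<oplus>\<^bsub>tensor_stalk Z Y \<phi> F n x\<^esub> T.cls {#(Z.O.germ x B b, ?\<Gamma>s)#}
      = T.cls ({#(Z.O.germ x A a, ?\<Gamma>s)#} + {#(Z.O.germ x B b, ?\<Gamma>s)#})"
    unfolding tensor_stalk_def by (rule T.tensor_add_class) (use G in auto)
  also have "\<dots> = T.cls {#(Z.O.germ x A a \<oplus>\<^bsub>local_ring Z x\<^esub> Z.O.germ x B b, ?\<Gamma>s)#}"
  proof -
    have "T.teq {#(Z.O.germ x A a \<oplus>\<^bsub>local_ring Z x\<^esub> Z.O.germ x B b, ?\<Gamma>s)#}
        {#(Z.O.germ x A a, ?\<Gamma>s), (Z.O.germ x B b, ?\<Gamma>s)#}"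
      by (rule tensor_eq.coeff_add) (use G in auto)
    from T.tensor_class_eqI[OF this] show ?thesis by (simp add: add_mset_commute)
  qed
  also have "Z.O.germ x A a \<oplus>\<^bsub>local_ring Z x\<^esub> Z.O.germ x B b = Z.O.germ x (A \<inter> B) (\<lambda>z\<in>A \<inter> B. a z + b z)"
    using A B by (intro Z.local_ring_add_germ_Int)
  finally show ?thesis using A B by (simp add: formal_section_def del: restrict_apply) (simp)
qed

lemma smult_unit:
  assumes A: "openin (topo Z) A" "a \<in> regular Z A" "x \<in> A" and B: "openin (topo Z) B" "b \<in> regular Z B" "x \<in> B"
    and \<gamma>: "openin (topo Y) V" "\<gamma> \<in> carrier (sections F V)" "\<phi> x \<in> V"
  shows "Z.O.germ x A a \<odot>\<^bsub>tensor_stalk Z Y \<phi> F n x\<^esub>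
      section_of B V {#(b, replicate n \<gamma>)#} x = section_of (A \<inter> B) V {#(\<lambda>z\<in>A \<inter> B. a z * b z, replicate n \<gamma>)#} x"
proof -
  let ?\<Gamma>s = "replicate n (Y.germ (\<phi> x) V \<gamma>)"
  have xZ: "x \<in> topspace (topo Z)" using A openin_subset by blast
  interpret T: tensor_setting "local_ring Z x" "germ_comap Z Y \<phi> x" "local_ring Y (\<phi> x)" "stalk Y F (\<phi> x)" n
    using xZ by (rule tensor_setting_stalks)
  have G: "set ?\<Gamma>s \<subseteq> carrier (stalk Y F (\<phi> x))" "Z.O.germ x A a \<in> carrier (local_ring Z x)"
    "Z.O.germ x B b \<in> carrier (local_ring Z x)"
    using A B \<gamma> by (auto intro!: Y.germ_in_stalk Z.O.germ_in_stalk)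
  have "Z.O.germ x A a \<odot>\<^bsub>tensor_stalk Z Y \<phi> F n x\<^esub> T.cls {#(Z.O.germ x B b, ?\<Gamma>s)#}
      = T.cls (T.scale (Z.O.germ x A a) {#(Z.O.germ x B b, ?\<Gamma>s)#})"
    unfolding tensor_stalk_def by (rule T.tensor_smult_class) (use G in auto)
  also have "\<dots> = T.cls {#(Z.O.germ x A a \<otimes>\<^bsub>local_ring Z x\<^esub> Z.O.germ x B b, ?\<Gamma>s)#}"
    by simp
  also have "Z.O.germ x A a \<otimes>\<^bsub>local_ring Z x\<^esub> Z.O.germ x B b = Z.O.germ x (A \<inter> B) (\<lambda>z\<in>A \<inter> B. a z * b z)"
    using A B by (intro Z.local_ring_mult_germ_Int)
  finally show ?thesis using A B by (simp add: formal_section_def del: restrict_apply) (simp)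
qed
end

section \<open>The pullback of a power of a line sheaf is a line sheaf\<close>

context line_pullback
begin

abbreviation pullback_ev :: "'a set \<Rightarrow> ('a \<Rightarrow> ('a, 'f, 'b, 'm) tensor_germ) \<Rightarrow> 'a \<Rightarrow> 'f" where
  "pullback_ev \<equiv> \<lambda>U \<sigma> x. point_value x (\<sigma> x)"

text \<open>The value function of 1 \<otimes> \<gamma> \<otimes> ... \<otimes> \<gamma>, where
  \<gamma> has values g.\<close>

definition pullback_gen :: "'a set \<Rightarrow> ('a \<Rightarrow> 'f) \<Rightarrow> bool" where
  "pullback_gen W h \<longleftrightarrow> (\<exists>V g. gen V g \<and> W = pre V \<and> h = (\<lambda>x. g (\<phi> x) ^ n))"

lemma unit_section_value:
  assumes "openin (topo Z) W" "a \<in> regular Z W" "\<phi> ` W \<subseteq> V" "gen V g"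
    "\<gamma> \<in> carrier (sections F V)" "\<And>y. y \<in> V \<Longrightarrow> ev V \<gamma> y = g y" "z \<in> W"
  shows "point_value z (section_of W V {#(a, replicate n \<gamma>)#} z) = a z * g (\<phi> z) ^ n"
proof -
  have "{#(a, replicate n \<gamma>)#} \<in> sums_on W V" using assms by (auto simp: formal_sums_def)
  moreover have "\<phi> z \<in> V" using assms by auto
  ultimately show ?thesis using assms Y.gen_open by (simp add: point_value_section_of)
qed

text \<open>Writing both sections with the same generator, as a and b times its power, gives a + b
  as coefficient of the sum. The first conclusion yields closure under addition, the second
  additivity of values.\<close>

lemma add_local:
  assumes U: "openin (topo Z) U" and \<sigma>: "\<sigma> \<in> carrier (sections sheaf U)" and \<tau>: "\<tau> \<in> carrier (sections sheaf U)"
    and x: "x \<in> U"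
  shows "\<exists>W V u. openin (topo Z) W \<and> x \<in> W \<and> W \<subseteq> U \<and> openin (topo Y) V \<and> \<phi> ` W \<subseteq> V \<and>
       u \<in> sums_on W V \<and> (\<forall>z\<in>W. (\<sigma> \<oplus>\<^bsub>sections sheaf U\<^esub> \<tau>) z = section_of W V u z)" (is ?L)
    and "point_value x ((\<sigma> \<oplus>\<^bsub>sections sheaf U\<^esub> \<tau>) x) = point_value x (\<sigma> x) + point_value x (\<tau> x)" (is ?V)
proof -
  have "x \<in> topspace (topo Z)" using U x openin_subset by blast
  then obtain V g \<gamma> where g: "gen V g" "\<gamma> \<in> carrier (sections F V)" "\<And>y. y \<in> V \<Longrightarrow> ev V \<gamma> y = g y" "\<phi> x \<in> V"
    and V: "openin (topo Y) V"
    by (rule generator_at) blast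
  obtain A a where A: "openin (topo Z) A" "x \<in> A" "A \<subseteq> U" "\<phi> ` A \<subseteq> V" "a \<in> regular Z A"
    "\<forall>z\<in>A. \<sigma> z = section_of A V {#(a, replicate n \<gamma>)#} z" "\<forall>z\<in>A. point_value z (\<sigma> z) = a z * g (\<phi> z) ^ n"
    using local_unit[OF U \<sigma> x g] by blast
  obtain B b where B: "openin (topo Z) B" "x \<in> B" "B \<subseteq> U" "\<phi> ` B \<subseteq> V" "b \<in> regular Z B"
    "\<forall>z\<in>B. \<tau> z = section_of B V {#(b, replicate n \<gamma>)#} z" "\<forall>z\<in>B. point_value z (\<tau> z) = b z * g (\<phi> z) ^ n"
    using local_unit[OF U \<tau> x g] by blast
  define c where "c = (\<lambda>z\<in>A \<inter> B. a z + b z)"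
  have c: "c \<in> regular Z (A \<inter> B)" unfolding c_def using A B by (intro Z.regular_add_Int)
  have AB: "openin (topo Z) (A \<inter> B)" "\<phi> ` (A \<inter> B) \<subseteq> V" "x \<in> A \<inter> B" "A \<inter> B \<subseteq> U" using A B by auto
  have eq: "(\<sigma> \<oplus>\<^bsub>sections sheaf U\<^esub> \<tau>) z = section_of (A \<inter> B) V {#(c, replicate n \<gamma>)#} z" if "z \<in> A \<inter> B" for z
  proof -
    have "z \<in> A" "z \<in> B" "z \<in> U" "\<phi> z \<in> V" using that A B by auto
    then show ?thesis
      unfolding c_def sheaf_simps using A B V g
      by (subst add_units[symmetric]) auto
  qed
  have u: "{#(c, replicate n \<gamma>)#} \<in> sums_on (A \<inter> B) V" using c g(2) by (auto simp: formal_sums_def)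
  show ?L
    using eq u AB V by (intro exI[of _ "A \<inter> B"] exI[of _ V] exI[of _ "{#(c, replicate n \<gamma>)#}"]) blast
  show ?V
    using unit_section_value[OF AB(1) c AB(2) g(1-3) AB(3)] eq[OF AB(3)] A B AB(3)
    by (simp add: c_def distrib_right)
qed

lemma smult_local:
  assumes U: "openin (topo Z) U" and a: "a \<in> regular Z U" and \<tau>: "\<tau> \<in> carrier (sections sheaf U)"
    and x: "x \<in> U"
  shows "\<exists>W V u. openin (topo Z) W \<and> x \<in> W \<and> W \<subseteq> U \<and> openin (topo Y) V \<and> \<phi> ` W \<subseteq> V \<and>
       u \<in> sums_on W V \<and> (\<forall>z\<in>W. (a \<odot>\<^bsub>sections sheaf U\<^esub> \<tau>) z = section_of W V u z)" (is ?L)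
    and "point_value x ((a \<odot>\<^bsub>sections sheaf U\<^esub> \<tau>) x) = a x * point_value x (\<tau> x)" (is ?V)
proof -
  have "x \<in> topspace (topo Z)" using U x openin_subset by blast
  then obtain V g \<gamma> where g: "gen V g" "\<gamma> \<in> carrier (sections F V)" "\<And>y. y \<in> V \<Longrightarrow> ev V \<gamma> y = g y" "\<phi> x \<in> V"
    and V: "openin (topo Y) V"
    by (rule generator_at) blast
  obtain B b where B: "openin (topo Z) B" "x \<in> B" "B \<subseteq> U" "\<phi> ` B \<subseteq> V" "b \<in> regular Z B"
    "\<forall>z\<in>B. \<tau> z = section_of B V {#(b, replicate n \<gamma>)#} z" "\<forall>z\<in>B. point_value z (\<tau> z) = b z * g (\<phi> z) ^ n"
    using local_unit[OF U \<tau> x g] by blast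
  define c where "c = (\<lambda>z\<in>U \<inter> B. a z * b z)"
  have c: "c \<in> regular Z (U \<inter> B)" unfolding c_def using U a B by (intro Z.regular_mult_Int)
  have UB: "openin (topo Z) (U \<inter> B)" "\<phi> ` (U \<inter> B) \<subseteq> V" "x \<in> U \<inter> B" "U \<inter> B \<subseteq> U" using U x B by auto
  have eq: "(a \<odot>\<^bsub>sections sheaf U\<^esub> \<tau>) z = section_of (U \<inter> B) V {#(c, replicate n \<gamma>)#} z" if "z \<in> U \<inter> B" for z
  proof -
    have "z \<in> B" "z \<in> U" "\<phi> z \<in> V" using that B by auto
    then show ?thesis
      unfolding c_def sheaf_simps using U a B V g
      by (subst smult_unit[symmetric]) auto
  qed
  have u: "{#(c, replicate n \<gamma>)#} \<in> sums_on (U \<inter> B) V" using c g(2) by (auto simp: formal_sums_def)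
  show ?L
    using eq u UB V by (intro exI[of _ "U \<inter> B"] exI[of _ V] exI[of _ "{#(c, replicate n \<gamma>)#}"]) blast
  show ?V
    using unit_section_value[OF UB(1) c UB(2) g(1-3) UB(3)] eq[OF UB(3)] B UB(3)
    by (simp add: c_def)
qed

text \<open>At each point both sections are single terms over one generator; their value functions
  agree on the overlap, so \<open>section_of_cong\<close> makes the germs equal.\<close>

lemma point_value_inject:
  assumes U: "openin (topo Z) U" and \<sigma>: "\<sigma> \<in> carrier (sections sheaf U)" and \<tau>: "\<tau> \<in> carrier (sections sheaf U)"
    and eq: "\<And>x. x \<in> U \<Longrightarrow> point_value x (\<sigma> x) = point_value x (\<tau> x)"
  shows "\<sigma> = \<tau>"
proof (rule extensionalityI[of _ U])
  show "\<sigma> \<in> extensional U" "\<tau> \<in> extensional U" using \<sigma> \<tau> by (simp_all add: sections_iff[OF U])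
  fix x assume x: "x \<in> U"
  then have "x \<in> topspace (topo Z)" using U openin_subset by blast
  then obtain V g \<gamma> where g: "gen V g" "\<gamma> \<in> carrier (sections F V)" "\<And>y. y \<in> V \<Longrightarrow> ev V \<gamma> y = g y" "\<phi> x \<in> V"
    and V: "openin (topo Y) V"
    by (rule generator_at) blast
  obtain A a where A: "openin (topo Z) A" "x \<in> A" "A \<subseteq> U" "\<phi> ` A \<subseteq> V" "{#(a, replicate n \<gamma>)#} \<in> sums_on A V"
    "\<forall>z\<in>A. \<sigma> z = section_of A V {#(a, replicate n \<gamma>)#} z"
    using local_unit[OF U \<sigma> x g] by blast
  obtain B b where B: "openin (topo Z) B" "x \<in> B" "B \<subseteq> U" "\<phi> ` B \<subseteq> V" "{#(b, replicate n \<gamma>)#} \<in> sums_on B V"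
    "\<forall>z\<in>B. \<tau> z = section_of B V {#(b, replicate n \<gamma>)#} z"
    using local_unit[OF U \<tau> x g] by blast
  have "section_of A V {#(a, replicate n \<gamma>)#} x = section_of B V {#(b, replicate n \<gamma>)#} x"
  proof (rule section_of_cong[of _ _ _ _ _ _ "A \<inter> B"])
    fix z assume z: "z \<in> A \<inter> B"
    then have "z \<in> U" "z \<in> A" "z \<in> B" using A by blast+
    then show "section_value V {#(a, replicate n \<gamma>)#} z = section_value V {#(b, replicate n \<gamma>)#} z"
      using eq[of z] A(6) B(6) point_value_section_of[OF A(1) V A(4,5), of z]
        point_value_section_of[OF B(1) V B(4,5), of z] by simp
  qed (use A B V in auto)
  then show "\<sigma> x = \<tau> x" using A B by simp
qed

lemma restrict_section:
  assumes U: "openin (topo Z) U" "openin (topo Z) U'" "U' \<subseteq> U" and \<sigma>: "\<sigma> \<in> carrier (sections sheaf U)"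
  shows "restrict \<sigma> U' \<in> carrier (sections sheaf U')"
  unfolding sections_iff[OF U(2)]
proof (intro conjI ballI)
  fix x assume x: "x \<in> U'"
  then have "x \<in> U" using U by auto
  then have "x \<in> topspace (topo Z)" using U openin_subset by blast
  then obtain V g \<gamma> where g: "gen V g" "\<gamma> \<in> carrier (sections F V)" "\<And>y. y \<in> V \<Longrightarrow> ev V \<gamma> y = g y" "\<phi> x \<in> V"
    and V: "openin (topo Y) V"
    by (rule generator_at) blast
  obtain A a where A: "openin (topo Z) A" "x \<in> A" "A \<subseteq> U" "\<phi> ` A \<subseteq> V" "a \<in> regular Z A"
      "{#(a, replicate n \<gamma>)#} \<in> sums_on A V" "\<forall>z\<in>A. \<sigma> z = section_of A V {#(a, replicate n \<gamma>)#} z"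
    using local_unit[OF U(1) \<sigma> \<open>x \<in> U\<close> g] by blast
  define b where "b = restrict a (A \<inter> U')"
  have AU: "openin (topo Z) (A \<inter> U')" using A U by auto
  have "b \<in> regular Z (A \<inter> U')"
    unfolding b_def using A U by (intro Z.regular_restrict[of A]) auto
  then have b: "{#(b, replicate n \<gamma>)#} \<in> sums_on (A \<inter> U') V" using g(2) by (auto simp: formal_sums_def)
  have eq: "section_of A V {#(a, replicate n \<gamma>)#} z = section_of (A \<inter> U') V {#(b, replicate n \<gamma>)#} z"
    if "z \<in> A \<inter> U'" for z
    by (rule section_of_cong[of _ _ _ _ _ _ "A \<inter> U'"]) (use A AU V b that in \<open>auto simp: b_def\<close>)
  have "restrict \<sigma> U' z = section_of (A \<inter> U') V {#(b, replicate n \<gamma>)#} z" if "z \<in> A \<inter> U'" for z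
    using eq[OF that] A(7) that by simp
  then show "\<exists>W V u. openin (topo Z) W \<and> x \<in> W \<and> W \<subseteq> U' \<and> openin (topo Y) V \<and> \<phi> ` W \<subseteq> V \<and>
       u \<in> sums_on W V \<and> (\<forall>z\<in>W. restrict \<sigma> U' z = section_of W V u z)"
    using AU A x V b
    by (intro exI[of _ "A \<inter> U'"] exI[of _ V] exI[of _ "{#(b, replicate n \<gamma>)#}"]) blast
qed simp

text \<open>The class of line sheaves is closed under the construction, so it can be iterated: O(1)
  is restricted to a curve, and the result is raised to a power or pulled back along \<phi>.\<close>

theorem line_sheaf_pullback: "line_sheaf Z sheaf pullback_ev pullback_gen"
proof
  fix U \<sigma> \<tau> assume *: "openin (topo Z) U" "\<sigma> \<in> carrier (sections sheaf U)" "\<tau> \<in> carrier (sections sheaf U)"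
  show "\<sigma> \<oplus>\<^bsub>sections sheaf U\<^esub> \<tau> \<in> carrier (sections sheaf U)"
    using add_local(1)[OF *] unfolding sections_iff[OF *(1)] by (simp add: sheaf_simps)
next
  fix U a \<tau> assume *: "openin (topo Z) U" "a \<in> regular Z U" "\<tau> \<in> carrier (sections sheaf U)"
  show "a \<odot>\<^bsub>sections sheaf U\<^esub> \<tau> \<in> carrier (sections sheaf U)"
    using smult_local(1)[OF *] unfolding sections_iff[OF *(1)] by (simp add: sheaf_simps)
next
  fix V g assume "pullback_gen V g"
  then obtain V\<^sub>0 g\<^sub>0 where g: "gen V\<^sub>0 g\<^sub>0" "V = pre V\<^sub>0" "g = (\<lambda>x. g\<^sub>0 (\<phi> x) ^ n)"
    by (auto simp: pullback_gen_def)
  show V: "openin (topo Z) V" using g Y.gen_open pre_open by blast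
  show "g x \<noteq> 0" if "x \<in> V" for x using g that Y.gen_nonzero by auto
  obtain \<gamma> where \<gamma>: "\<gamma> \<in> carrier (sections F V\<^sub>0)" "\<And>y. y \<in> V\<^sub>0 \<Longrightarrow> ev V\<^sub>0 \<gamma> y = g\<^sub>0 y"
    using Y.gen_section g(1) by blast
  \<comment> \<open>The generator is realised by the term with coefficient 1 and \<gamma> in every
    slot.\<close>
  have "section_of V V\<^sub>0 {#(\<lambda>x\<in>V. 1, replicate n \<gamma>)#} \<in> carrier (sections sheaf V)"
    by (rule section_of_closed)
      (use V g(1,2) \<gamma>(1) Y.gen_open in \<open>auto simp: formal_sums_def Z.regular_one\<close>)
  moreover have "point_value z (section_of V V\<^sub>0 {#(\<lambda>x\<in>V. 1, replicate n \<gamma>)#} z) = g z" if "z \<in> V" for z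
    using that g V \<gamma> Z.regular_one[OF V] by (subst unit_section_value[of _ _ _ g\<^sub>0]) auto
  ultimately show "\<exists>\<sigma>\<in>carrier (sections sheaf V). \<forall>x\<in>V. point_value x (\<sigma> x) = g x" by blast
  fix U \<sigma> x assume *: "openin (topo Z) U" "\<sigma> \<in> carrier (sections sheaf U)" "x \<in> U" "x \<in> V"
  then have "\<phi> x \<in> V\<^sub>0" using g by auto
  then obtain W a where "openin (topo Z) W" "x \<in> W" "W \<subseteq> U" "\<phi> ` W \<subseteq> V\<^sub>0" "a \<in> regular Z W"
    "\<forall>z\<in>W. point_value z (\<sigma> z) = a z * g\<^sub>0 (\<phi> z) ^ n"
    using local_unit[OF *(1-3) g(1) \<gamma>] by blast
  then show "\<exists>W a. openin (topo Z) W \<and> x \<in> W \<and> W \<subseteq> U \<inter> V \<and> a \<in> regular Z W \<and>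
      (\<forall>z\<in>W. point_value z (\<sigma> z) = a z * g z)"
    using openin_subset[of "topo Z" W] g by (intro exI[of _ W] exI[of _ a]) auto
next
  fix x assume x: "x \<in> topspace (topo Z)"
  then obtain V g where "gen V g" "\<phi> x \<in> V" using Y.gen_cover phi_in by blast
  then show "\<exists>V g. pullback_gen V g \<and> x \<in> V" using x unfolding pullback_gen_def by blast
qed (use add_local(2) smult_local(2) restrict_section point_value_inject in \<open>auto simp: sheaf_simps(1)\<close>)

text \<open>The working criterion for constructing sections: a function on points comes from a
  section as soon as it is locally a regular multiple of a pulled back generator. No tensors appear
  in it.\<close>

lemma pullback_section_exists:
  assumes "openin (topo Z) U"
    and "\<And>x. x \<in> U \<Longrightarrow> \<exists>W V g a. openin (topo Z) W \<and> x \<in> W \<and> W \<subseteq> U \<and> \<phi> ` W \<subseteq> V \<and> gen V g \<and>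
       a \<in> regular Z W \<and> (\<forall>z\<in>W. f z = a z * g (\<phi> z) ^ n)"
  shows "\<exists>\<sigma>\<in>carrier (sections sheaf U). \<forall>x\<in>U. point_value x (\<sigma> x) = f x"
proof (rule section_exists[OF assms(1)])
  fix x assume x: "x \<in> U"
  from assms(2)[OF x] obtain W V g a where W: "openin (topo Z) W" "x \<in> W" "W \<subseteq> U" "\<phi> ` W \<subseteq> V" "gen V g"
       "a \<in> regular Z W" "\<forall>z\<in>W. f z = a z * g (\<phi> z) ^ n"
    by (elim exE conjE) (rule that)
  obtain \<gamma> where \<gamma>: "\<gamma> \<in> carrier (sections F V)" "\<forall>y\<in>V. ev V \<gamma> y = g y"
    using Y.gen_section W(5) by blast
  have "{#(a, replicate n \<gamma>)#} \<in> sums_on W V" using W(6) \<gamma>(1) by (auto simp: formal_sums_def)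
  moreover have "\<forall>z\<in>W. f z = section_value V {#(a, replicate n \<gamma>)#} z"
    using W(4,7) \<gamma>(2) by (simp add: image_subset_iff)
  ultimately show "\<exists>W V u. openin (topo Z) W \<and> x \<in> W \<and> W \<subseteq> U \<and> openin (topo Y) V \<and> \<phi> ` W \<subseteq> V \<and>
       u \<in> sums_on W V \<and> (\<forall>z\<in>W. f z = section_value V u z)"
    using W(1-4) Y.gen_open[OF W(5)]
    by (intro exI[of _ W] exI[of _ V] exI[of _ "{#(a, replicate n \<gamma>)#}"]) simp
qed
end

section \<open>Isomorphisms of line sheaves as multiplication by functions\<close>

text \<open>Near x every section is a \<gamma>, so linearity and compatibility with restriction give
  \<psi>(s) = a \<psi>(\<gamma>) there. Hence the values at x of \<psi>(s) and s differ by a factor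
  that does not depend on s. It is nonzero because some section is mapped to a generator of the
  target.\<close>

lemma sheaf_iso_factor:
  assumes "line_sheaf Z F evF genF" "line_sheaf Z G evG genG" "sheaf_iso Z F G"
  obtains h where "\<And>x. x \<in> topspace (topo Z) \<Longrightarrow> h x \<noteq> 0"
    and "\<And>U s. openin (topo Z) U \<Longrightarrow> s \<in> carrier (sections F U) \<Longrightarrow>
      \<exists>t\<in>carrier (sections G U). \<forall>x\<in>U. evG U t x = h x * evF U s x"
proof -
  interpret F: line_sheaf Z F evF genF by fact
  interpret G: line_sheaf Z G evG genG by fact
  obtain \<psi> where bij: "\<And>U. openin (topo Z) U \<Longrightarrow> bij_betw (\<psi> U) (carrier (sections F U)) (carrier (sections G U))"
    and smult: "\<And>U a s. openin (topo Z) U \<Longrightarrow> a \<in> regular Z U \<Longrightarrow> s \<in> carrier (sections F U) \<Longrightarrow>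
       \<psi> U (a \<odot>\<^bsub>sections F U\<^esub> s) = a \<odot>\<^bsub>sections G U\<^esub> \<psi> U s"
    and res: "\<And>U V s. openin (topo Z) U \<Longrightarrow> openin (topo Z) V \<Longrightarrow> V \<subseteq> U \<Longrightarrow> s \<in> carrier (sections F U) \<Longrightarrow>
       \<psi> V (res F U V s) = res G U V (\<psi> U s)"
  proof -
    obtain \<psi> where "\<forall>U. openin (topo Z) U \<longrightarrow>
       bij_betw (\<psi> U) (carrier (sections F U)) (carrier (sections G U)) \<and>
       (\<forall>s\<in>carrier (sections F U). \<forall>t\<in>carrier (sections F U).
          \<psi> U (s \<oplus>\<^bsub>sections F U\<^esub> t) = \<psi> U s \<oplus>\<^bsub>sections G U\<^esub> \<psi> U t) \<and>
       (\<forall>a\<in>regular Z U. \<forall>s\<in>carrier (sections F U).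
          \<psi> U (a \<odot>\<^bsub>sections F U\<^esub> s) = a \<odot>\<^bsub>sections G U\<^esub> \<psi> U s) \<and>
       (\<forall>V s. openin (topo Z) V \<and> V \<subseteq> U \<and> s \<in> carrier (sections F U) \<longrightarrow>
          \<psi> V (res F U V s) = res G U V (\<psi> U s))"
      using assms(3) unfolding sheaf_iso_def by (rule exE)
    then show ?thesis by (intro that[of \<psi>]) simp_all
  qed
  have closed: "\<psi> U s \<in> carrier (sections G U)" if "openin (topo Z) U" "s \<in> carrier (sections F U)" for U s
    using bij[OF that(1)] that(2) by (auto simp: bij_betw_def)
  have "\<forall>x\<in>topspace (topo Z). \<exists>c. c \<noteq> 0 \<and> (\<forall>U s. openin (topo Z) U \<longrightarrow> x \<in> U \<longrightarrow> s \<in> carrier (sections F U) \<longrightarrow>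
      evG U (\<psi> U s) x = c * evF U s x)"
  proof
    fix x assume x: "x \<in> topspace (topo Z)"
    obtain V g where g: "genF V g" "x \<in> V" using F.gen_cover x by blast
    obtain \<gamma> where \<gamma>: "\<gamma> \<in> carrier (sections F V)" "\<forall>y\<in>V. evF V \<gamma> y = g y" using F.gen_section g by blast
    have V: "openin (topo Z) V" using g F.gen_open by blast
    \<comment> \<open>The factor is read off from the generator, whose value at x is
      nonzero.\<close>
    define c where "c = evG V (\<psi> V \<gamma>) x / g x"
    have g0: "g x \<noteq> 0" using g F.gen_nonzero by blast
    have *: "evG U (\<psi> U s) x = c * evF U s x" if U: "openin (topo Z) U" "x \<in> U" "s \<in> carrier (sections F U)" for U s
    proof -
      obtain W a where W: "openin (topo Z) W" "x \<in> W" "W \<subseteq> U \<inter> V" "a \<in> regular Z W" "\<forall>z\<in>W. evF U s z = a z * g z"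
        using F.gen_local[OF U(1,3) g(1) U(2) g(2)] by blast
      have WU: "W \<subseteq> U" and WV: "W \<subseteq> V" using W by auto
      have r: "res F V W \<gamma> \<in> carrier (sections F W)" by (rule F.res_closed[OF V W(1) WV \<gamma>(1)])
      have "res F U W s = a \<odot>\<^bsub>sections F W\<^esub> res F V W \<gamma>"
      proof (rule F.ev_inject[OF W(1)])
        fix z assume z: "z \<in> W"
        show "evF W (res F U W s) z = evF W (a \<odot>\<^bsub>sections F W\<^esub> res F V W \<gamma>) z"
          using z W \<gamma>(2) WV F.ev_res[OF U(1) W(1) WU U(3) z] F.ev_res[OF V W(1) WV \<gamma>(1) z]
            F.ev_smult[OF W(1,4) r z] by auto
      qed (use F.res_closed[OF U(1) W(1) WU U(3)] F.smult_closed[OF W(1,4) r] in auto)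
      then have "res G U W (\<psi> U s) = a \<odot>\<^bsub>sections G W\<^esub> res G V W (\<psi> V \<gamma>)"
        using res[OF U(1) W(1) WU U(3)] smult[OF W(1,4) r] res[OF V W(1) WV \<gamma>(1)] by simp
      then have "evG U (\<psi> U s) x = a x * evG V (\<psi> V \<gamma>) x"
        using G.ev_res[OF U(1) W(1) WU closed[OF U(1,3)] W(2)] G.ev_res[OF V W(1) WV closed[OF V \<gamma>(1)] W(2)]
          G.ev_smult[OF W(1,4) G.res_closed[OF V W(1) WV closed[OF V \<gamma>(1)]] W(2)] by simp
      then show ?thesis using W(2,5) g0 by (simp add: c_def)
    qed
    \<comment> \<open>Surjectivity of \<psi> enters here: a generator t of the target at x has a
      preimage s, and c = 0 would force the nonzero value of t at x to be 0.\<close>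
    obtain V' g' where g': "genG V' g'" "x \<in> V'" using G.gen_cover x by blast
    obtain t where t: "t \<in> carrier (sections G V')" "\<forall>y\<in>V'. evG V' t y = g' y" using G.gen_section g' by blast
    have V': "openin (topo Z) V'" using g' G.gen_open by blast
    obtain s where s: "s \<in> carrier (sections F V')" "t = \<psi> V' s"
      using bij[OF V'] t(1) by (auto simp: bij_betw_def)
    have "c \<noteq> 0" using *[OF V' g'(2) s(1)] t(2) s(2) g'(2) G.gen_nonzero[OF g'] by auto
    with * show "\<exists>c. c \<noteq> 0 \<and> (\<forall>U s. openin (topo Z) U \<longrightarrow> x \<in> U \<longrightarrow> s \<in> carrier (sections F U) \<longrightarrow>
      evG U (\<psi> U s) x = c * evF U s x)" by blast
  qed
  then obtain h where "\<forall>x\<in>topspace (topo Z). h x \<noteq> 0 \<and> (\<forall>U s. openin (topo Z) U \<longrightarrow> x \<in> U \<longrightarrow>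
      s \<in> carrier (sections F U) \<longrightarrow> evG U (\<psi> U s) x = h x * evF U s x)"
    by metis
  then show ?thesis using that[of h] closed openin_subset by blast
qed

text \<open>\<psi> is chosen section by section without any coherence. Since values in G are
  faithful, \<psi>(s) is the only section with values h times those of s, and additivity, linearity
  and compatibility with restriction follow by comparing values.\<close>

lemma sheaf_isoI:
  assumes "valued_sheaf Z F evF" "valued_sheaf Z G evG"
    and h: "\<And>x. x \<in> topspace (topo Z) \<Longrightarrow> h x \<noteq> 0"
    and FG: "\<And>U s. openin (topo Z) U \<Longrightarrow> s \<in> carrier (sections F U) \<Longrightarrow>
      \<exists>t\<in>carrier (sections G U). \<forall>x\<in>U. evG U t x = h x * evF U s x"
    and GF: "\<And>U t. openin (topo Z) U \<Longrightarrow> t \<in> carrier (sections G U) \<Longrightarrow>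
      \<exists>s\<in>carrier (sections F U). \<forall>x\<in>U. evG U t x = h x * evF U s x"
  shows "sheaf_iso Z F G"
proof -
  interpret F: valued_sheaf Z F evF by fact
  interpret G: valued_sheaf Z G evG by fact
  obtain \<psi> where \<psi>: "\<And>U s. openin (topo Z) U \<Longrightarrow> s \<in> carrier (sections F U) \<Longrightarrow>
      \<psi> U s \<in> carrier (sections G U) \<and> (\<forall>x\<in>U. evG U (\<psi> U s) x = h x * evF U s x)"
    using FG by metis
  have eqI: "\<psi> U s = t" if "openin (topo Z) U" "s \<in> carrier (sections F U)" "t \<in> carrier (sections G U)"
    "\<And>x. x \<in> U \<Longrightarrow> evG U t x = h x * evF U s x" for U s t
    using that \<psi>[OF that(1,2)] by (intro G.ev_inject[OF that(1)]) auto
  have h': "h x \<noteq> 0" if "openin (topo Z) U" "x \<in> U" for U x using that h openin_subset by blast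
  show ?thesis
    unfolding sheaf_iso_def
  proof (intro exI[of _ \<psi>] allI impI conjI ballI)
    fix U assume U: "openin (topo Z) U"
    have "inj_on (\<psi> U) (carrier (sections F U))"
    proof (rule inj_onI)
      fix s t assume st: "s \<in> carrier (sections F U)" "t \<in> carrier (sections F U)" "\<psi> U s = \<psi> U t"
      show "s = t"
      proof (rule F.ev_inject[OF U st(1,2)])
        fix x assume "x \<in> U"
        then show "evF U s x = evF U t x" using \<psi>[OF U st(1)] \<psi>[OF U st(2)] st(3) h'[OF U] by auto
      qed
    qed
    moreover have "t \<in> \<psi> U ` carrier (sections F U)" if t: "t \<in> carrier (sections G U)" for t
    proof -
      obtain s where s: "s \<in> carrier (sections F U)" "\<forall>x\<in>U. evG U t x = h x * evF U s x" using GF U t by blast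
      then have "\<psi> U s = t" using U t by (intro eqI) auto
      then show ?thesis using s by blast
    qed
    ultimately show "bij_betw (\<psi> U) (carrier (sections F U)) (carrier (sections G U))"
      using \<psi>[OF U] by (auto simp: bij_betw_def)
    {
      fix s t assume st: "s \<in> carrier (sections F U)" "t \<in> carrier (sections F U)"
      show "\<psi> U (s \<oplus>\<^bsub>sections F U\<^esub> t) = \<psi> U s \<oplus>\<^bsub>sections G U\<^esub> \<psi> U t"
        by (rule eqI) (use U st \<psi>[OF U st(1)] \<psi>[OF U st(2)] in
          \<open>auto simp: F.add_closed G.add_closed F.ev_add G.ev_add distrib_left\<close>)
    next
      fix a s assume as: "a \<in> regular Z U" "s \<in> carrier (sections F U)"
      show "\<psi> U (a \<odot>\<^bsub>sections F U\<^esub> s) = a \<odot>\<^bsub>sections G U\<^esub> \<psi> U s"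
        by (rule eqI) (use U as \<psi>[OF U as(2)] in
          \<open>auto simp: F.smult_closed G.smult_closed F.ev_smult G.ev_smult\<close>)
    next
      fix V s assume "openin (topo Z) V \<and> V \<subseteq> U \<and> s \<in> carrier (sections F U)"
      then have V: "openin (topo Z) V" "V \<subseteq> U" and s: "s \<in> carrier (sections F U)" by auto
      show "\<psi> V (res F U V s) = res G U V (\<psi> U s)"
      proof (rule eqI[OF V(1) F.res_closed[OF U V s]])
        show "res G U V (\<psi> U s) \<in> carrier (sections G V)" using \<psi>[OF U s] G.res_closed[OF U V] by blast
        fix x assume x: "x \<in> V"
        show "evG V (res G U V (\<psi> U s)) x = h x * evF V (res F U V s) x"
          using \<psi>[OF U s] x V F.ev_res[OF U V s x] G.ev_res[OF U V _ x, of "\<psi> U s"] by auto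
      qed
    }
  qed
qed

section \<open>Polynomials and forms\<close>

definition monomial_value :: "(nat \<Rightarrow>\<^sub>0 nat) \<Rightarrow> (nat \<Rightarrow> 'f::field) \<Rightarrow> 'f" where
  "monomial_value \<alpha> v = (\<Prod>i\<in>Poly_Mapping.keys \<alpha>. v i ^ Poly_Mapping.lookup \<alpha> i)"

definition monomial_degree :: "(nat \<Rightarrow>\<^sub>0 nat) \<Rightarrow> nat" where
  "monomial_degree \<alpha> = (\<Sum>i\<in>Poly_Mapping.keys \<alpha>. Poly_Mapping.lookup \<alpha> i)"

text \<open>Padding with exponents 0 lets several monomials be written over one index set.\<close>

lemma monomial_value_superset:
  "finite A \<Longrightarrow> Poly_Mapping.keys \<alpha> \<subseteq> A \<Longrightarrow> monomial_value \<alpha> v = (\<Prod>i\<in>A. v i ^ Poly_Mapping.lookup \<alpha> i)"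
  unfolding monomial_value_def by (rule prod.mono_neutral_left) (auto simp: in_keys_iff)

lemma monomial_degree_superset:
  "finite A \<Longrightarrow> Poly_Mapping.keys \<alpha> \<subseteq> A \<Longrightarrow> monomial_degree \<alpha> = (\<Sum>i\<in>A. Poly_Mapping.lookup \<alpha> i)"
  unfolding monomial_degree_def by (rule sum.mono_neutral_left) (auto simp: in_keys_iff)

lemma monomial_value_add: "monomial_value (\<alpha> + \<beta>) v = monomial_value \<alpha> v * monomial_value \<beta> v"
proof -
  let ?A = "Poly_Mapping.keys \<alpha> \<union> Poly_Mapping.keys \<beta>"
  have "monomial_value \<gamma> v = (\<Prod>i\<in>?A. v i ^ Poly_Mapping.lookup \<gamma> i)" if "\<gamma> \<in> {\<alpha>, \<beta>, \<alpha> + \<beta>}" for \<gamma>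
    using that keys_add[of \<alpha> \<beta>] by (intro monomial_value_superset) auto
  then show ?thesis by (simp add: lookup_add power_add prod.distrib)
qed

lemma monomial_degree_add: "monomial_degree (\<alpha> + \<beta>) = monomial_degree \<alpha> + monomial_degree \<beta>"
proof -
  let ?A = "Poly_Mapping.keys \<alpha> \<union> Poly_Mapping.keys \<beta>"
  have "monomial_degree \<gamma> = (\<Sum>i\<in>?A. Poly_Mapping.lookup \<gamma> i)" if "\<gamma> \<in> {\<alpha>, \<beta>, \<alpha> + \<beta>}" for \<gamma>
    using that keys_add[of \<alpha> \<beta>] by (intro monomial_degree_superset) auto
  then show ?thesis by (simp add: lookup_add sum.distrib)
qed

lemma monomial_value_scale:
  "monomial_value \<alpha> (\<lambda>i. c * v i) = c ^ monomial_degree \<alpha> * monomial_value \<alpha> v"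
  by (simp add: monomial_value_def monomial_degree_def power_mult_distrib prod.distrib power_sum)

lemma monomial_zero [simp]: "monomial_value 0 v = 1" "monomial_degree 0 = 0"
  by (simp_all add: monomial_value_def monomial_degree_def)

lemma monomial_single [simp]:
  "monomial_value (Poly_Mapping.single i k) v = v i ^ k" "monomial_degree (Poly_Mapping.single i k) = k"
  by (simp_all add: monomial_value_def monomial_degree_def)

lemma value_at_eq:
  "value_at F v = (\<Sum>\<alpha>\<in>Poly_Mapping.keys F. to_ac (Poly_Mapping.lookup F \<alpha>) * monomial_value \<alpha> v)"
proof -
  have l: "Poly_Mapping.lookup (base_change F) \<alpha> = to_ac (Poly_Mapping.lookup F \<alpha>)" for \<alpha>
    by (simp add: base_change_def map.rep_eq when_def)
  \<comment> \<open>The embedding into the algebraic closure is injective, so no coefficient becomes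
    zero.\<close>
  then have "Poly_Mapping.keys (base_change F) = Poly_Mapping.keys F" by (auto simp: in_keys_iff)
  then show ?thesis by (simp add: eval_poly_def l monomial_value_def)
qed

lemma value_at_superset:
  "finite A \<Longrightarrow> Poly_Mapping.keys F \<subseteq> A \<Longrightarrow>
     value_at F v = (\<Sum>\<alpha>\<in>A. to_ac (Poly_Mapping.lookup F \<alpha>) * monomial_value \<alpha> v)"
  unfolding value_at_eq by (rule sum.mono_neutral_left) (auto simp: in_keys_iff)

lemma value_at_zero [simp]: "value_at 0 v = 0"
  by (simp add: value_at_eq)

lemma value_at_single [simp]: "value_at (Poly_Mapping.single \<alpha> c) v = to_ac c * monomial_value \<alpha> v"
  by (simp add: value_at_eq)

lemma value_at_one [simp]: "value_at 1 v = 1"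
  using value_at_single[of 0 1 v] by simp

lemma value_at_add [simp]: "value_at (F + G) v = value_at F v + value_at G v"
proof -
  let ?A = "Poly_Mapping.keys F \<union> Poly_Mapping.keys G"
  have "value_at H v = (\<Sum>\<alpha>\<in>?A. to_ac (Poly_Mapping.lookup H \<alpha>) * monomial_value \<alpha> v)" if "H \<in> {F, G, F + G}" for H
    using that keys_add[of F G] by (intro value_at_superset) auto
  then show ?thesis by (simp add: lookup_add distrib_right sum.distrib)
qed

lemma value_at_uminus [simp]: "value_at (- F) v = - value_at F v"
  using value_at_add[of F "- F" v] by (simp add: add_eq_0_iff)

lemma value_at_sum: "value_at (\<Sum>x\<in>A. f x) v = (\<Sum>x\<in>A. value_at (f x) v)"
  by (induction A rule: infinite_finite_induct) auto

lemma poly_mapping_sum_single: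
  fixes F :: "'a \<Rightarrow>\<^sub>0 'b::comm_monoid_add"
  shows "F = (\<Sum>\<alpha>\<in>Poly_Mapping.keys F. Poly_Mapping.single \<alpha> (Poly_Mapping.lookup F \<alpha>))"
  by (rule poly_mapping_eqI)
    (simp add: lookup_sum lookup_single when_def in_keys_iff)

lemma value_at_mult [simp]: "value_at (F * G) v = value_at F v * value_at G v"
proof -
  have "F * G = (\<Sum>\<alpha>\<in>Poly_Mapping.keys F. \<Sum>\<beta>\<in>Poly_Mapping.keys G.
      Poly_Mapping.single (\<alpha> + \<beta>) (Poly_Mapping.lookup F \<alpha> * Poly_Mapping.lookup G \<beta>))"
    using arg_cong2[OF poly_mapping_sum_single[of F] poly_mapping_sum_single[of G], of "(*)"]
    by (simp add: sum_product mult_single)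
  then have "value_at (F * G) v = (\<Sum>\<alpha>\<in>Poly_Mapping.keys F. \<Sum>\<beta>\<in>Poly_Mapping.keys G.
      (to_ac (Poly_Mapping.lookup F \<alpha>) * monomial_value \<alpha> v) * (to_ac (Poly_Mapping.lookup G \<beta>) * monomial_value \<beta> v))"
    by (simp add: value_at_sum monomial_value_add mult_ac)
  then show ?thesis by (simp add: value_at_eq sum_product)
qed

section \<open>The polynomial ring, the vanishing ideal and forms\<close>

lemma poly_ring_simps [simp]:
  "F \<otimes>\<^bsub>poly_ring m\<^esub> G = F * G" "\<one>\<^bsub>poly_ring m\<^esub> = 1"
  "F \<oplus>\<^bsub>poly_ring m\<^esub> G = F + G" "\<zero>\<^bsub>poly_ring m\<^esub> = 0"
  by (simp_all add: poly_ring_def)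

lemma carrier_poly_ring:
  "F \<in> carrier (poly_ring m) \<longleftrightarrow> (\<forall>\<alpha>\<in>Poly_Mapping.keys F. Poly_Mapping.keys \<alpha> \<subseteq> {..m})"
  by (simp add: poly_ring_def)

lemma keys_uminus: "Poly_Mapping.keys (- F) = Poly_Mapping.keys (F :: 'a \<Rightarrow>\<^sub>0 'b::ab_group_add)"
  by (auto simp: in_keys_iff)

lemma poly_ring_closed:
  "0 \<in> carrier (poly_ring m)" "1 \<in> carrier (poly_ring m)"
  "Poly_Mapping.single 0 c \<in> carrier (poly_ring m)"
  "F \<in> carrier (poly_ring m) \<Longrightarrow> - F \<in> carrier (poly_ring m)"
  by (auto simp: carrier_poly_ring keys_uminus)

lemma poly_ring_add_closed:
  "F \<in> carrier (poly_ring m) \<Longrightarrow> G \<in> carrier (poly_ring m) \<Longrightarrow> F + G \<in> carrier (poly_ring m)"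
  unfolding carrier_poly_ring using keys_add[of F G] by blast

lemma poly_ring_mult_closed:
  assumes "F \<in> carrier (poly_ring m)" "G \<in> carrier (poly_ring m)"
  shows "F * G \<in> carrier (poly_ring m)"
  unfolding carrier_poly_ring
proof
  fix \<gamma> assume "\<gamma> \<in> Poly_Mapping.keys (F * G)"
  then obtain \<alpha> \<beta> where ab: "\<gamma> = \<alpha> + \<beta>" "\<alpha> \<in> Poly_Mapping.keys F" "\<beta> \<in> Poly_Mapping.keys G"
    using keys_mult[of F G] by blast
  then have "Poly_Mapping.keys \<alpha> \<union> Poly_Mapping.keys \<beta> \<subseteq> {..m}"
    using assms by (simp add: carrier_poly_ring)
  then show "Poly_Mapping.keys \<gamma> \<subseteq> {..m}"
    using keys_add[of \<alpha> \<beta>] ab(1) by (simp add: subset_trans)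
qed

lemma poly_ring_cring: "cring (poly_ring m)"
proof (intro cringI abelian_groupI comm_monoidI)
  fix F assume F: "F \<in> carrier (poly_ring m)"
  then show "\<exists>G\<in>carrier (poly_ring m). G \<oplus>\<^bsub>poly_ring m\<^esub> F = \<zero>\<^bsub>poly_ring m\<^esub>"
    by (intro bexI[of _ "- F"]) (auto simp: poly_ring_closed poly_ring_add_closed poly_ring_mult_closed)
qed (auto simp: poly_ring_closed poly_ring_add_closed poly_ring_mult_closed algebra_simps)

lemma curve_ideal_ideal: "ideal (curve_ideal m C) (poly_ring m)"
proof -
  interpret cring "poly_ring m :: 'a mpoly ring" by (rule poly_ring_cring)
  have neg: "\<ominus>\<^bsub>poly_ring m\<^esub> F = - F" if "F \<in> carrier (poly_ring m)" for F :: "'a mpoly"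
    using that by (intro minus_equality) (auto simp: poly_ring_closed poly_ring_add_closed poly_ring_mult_closed)
  have "subgroup (curve_ideal m C) (add_monoid (poly_ring m))"
  proof (rule add.subgroupI)
    show "curve_ideal m C \<noteq> {}" by (auto simp: curve_ideal_def intro!: exI[of _ 0] poly_ring_closed poly_ring_add_closed poly_ring_mult_closed)
    show "\<ominus>\<^bsub>poly_ring m\<^esub> F \<in> curve_ideal m C" if "F \<in> curve_ideal m C" for F
      using that by (auto simp: curve_ideal_def neg poly_ring_closed poly_ring_add_closed poly_ring_mult_closed)
  qed (auto simp: curve_ideal_def poly_ring_closed poly_ring_add_closed poly_ring_mult_closed)
  then show ?thesis
    by (intro idealI ring_axioms) (auto simp: curve_ideal_def poly_ring_closed poly_ring_add_closed poly_ring_mult_closed)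
qed

lemma residue_class_eq:
  "residue_class m C F = {H + F |H. H \<in> curve_ideal m C}"
  by (auto simp: a_r_coset_def r_coset_def)

text \<open>Members of the ideal vanish on the cone over \<open>C\<close>, so all representatives
  have one value there and \<open>the_elem\<close> is applied to a singleton.\<close>

lemma class_value_residue_class:
  assumes "P \<in> C" "v \<in> P"
  shows "class_value (residue_class m C F) v = value_at F v"
proof -
  have "0 \<in> curve_ideal m C" by (simp add: curve_ideal_def poly_ring_closed poly_ring_add_closed poly_ring_mult_closed)
  then have "(\<lambda>G. value_at G v) ` residue_class m C F = {value_at F v}"
    using assms unfolding residue_class_eq by (auto simp: curve_ideal_def image_iff)
  then show ?thesis by (simp add: class_value_def)
qed

lemma mem_residue_class_self: "F \<in> residue_class m C F"
  unfolding residue_class_eq by (auto simp: curve_ideal_def poly_ring_closed poly_ring_add_closed poly_ring_mult_closed intro!: exI[of _ 0])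

text \<open>The difference of the two polynomials vanishes on the cone over \<open>C\<close>, which
  is the definition of the ideal.\<close>

lemma residue_class_eqI:
  assumes "F \<in> carrier (poly_ring m)" "G \<in> carrier (poly_ring m)"
    and "\<And>P v. P \<in> C \<Longrightarrow> v \<in> P \<Longrightarrow> value_at F v = value_at G v"
  shows "residue_class m C F = residue_class m C G"
proof -
  have sub: "residue_class m C F \<subseteq> residue_class m C G"
    if "F \<in> carrier (poly_ring m)" "G \<in> carrier (poly_ring m)"
      "\<And>P v. P \<in> C \<Longrightarrow> v \<in> P \<Longrightarrow> value_at F v = value_at G v" for F G
  proof
    fix K assume "K \<in> residue_class m C F"
    then obtain H where H: "H \<in> curve_ideal m C" "K = H + F" unfolding residue_class_eq by blast
    have "H + (F + - G) \<in> curve_ideal m C"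
      using H that by (auto simp: curve_ideal_def intro!: poly_ring_closed poly_ring_add_closed poly_ring_mult_closed simp del: add_uminus_conv_diff)
    moreover have "K = H + (F + - G) + G" using H by simp
    ultimately show "K \<in> residue_class m C G" unfolding residue_class_eq by blast
  qed
  show ?thesis by (intro equalityI sub) (use assms in auto)
qed

lemma coord_ring_mult:
  assumes "F \<in> carrier (poly_ring m)" "G \<in> carrier (poly_ring m)"
  shows "residue_class m C F \<otimes>\<^bsub>coord_ring m C\<^esub> residue_class m C G = residue_class m C (F * G)"
proof -
  interpret ideal "curve_ideal m C" "poly_ring m" by (rule curve_ideal_ideal)
  show ?thesis using rcoset_mult_add[OF assms] by (simp add: coord_ring_def FactRing_def)
qed

lemma forms_iff:
  "F \<in> forms m d \<longleftrightarrow> (\<forall>\<alpha>\<in>Poly_Mapping.keys F. Poly_Mapping.keys \<alpha> \<subseteq> {..m} \<and> monomial_degree \<alpha> = d)"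
  by (auto simp: forms_def carrier_poly_ring monomial_degree_def)

lemma forms_carrier: "F \<in> forms m d \<Longrightarrow> F \<in> carrier (poly_ring m)"
  by (simp add: forms_def)

lemma forms_add: "F \<in> forms m d \<Longrightarrow> G \<in> forms m d \<Longrightarrow> F + G \<in> forms m d"
  using keys_add[of F G] by (auto simp: forms_iff)

lemma forms_mult:
  assumes "F \<in> forms m d" "G \<in> forms m e" shows "F * G \<in> forms m (d + e)"
  unfolding forms_iff
proof
  fix \<gamma> assume "\<gamma> \<in> Poly_Mapping.keys (F * G)"
  then obtain \<alpha> \<beta> where "\<gamma> = \<alpha> + \<beta>" "\<alpha> \<in> Poly_Mapping.keys F" "\<beta> \<in> Poly_Mapping.keys G"
    using keys_mult[of F G] by blast
  then have "Poly_Mapping.keys \<alpha> \<union> Poly_Mapping.keys \<beta> \<subseteq> {..m}" "monomial_degree \<gamma> = d + e" "\<gamma> = \<alpha> + \<beta>"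
    using assms by (simp_all add: forms_iff monomial_degree_add)
  then show "Poly_Mapping.keys \<gamma> \<subseteq> {..m} \<and> monomial_degree \<gamma> = d + e"
    using keys_add[of \<alpha> \<beta>] by (simp add: subset_trans)
qed

lemma forms_const: "Poly_Mapping.single 0 c \<in> forms m 0"
  by (auto simp: forms_iff)

lemma forms_one: "1 \<in> forms m 0"
  by (auto simp: forms_iff)

lemma forms_coordinate: "i \<le> m \<Longrightarrow> Poly_Mapping.single (Poly_Mapping.single i k) c \<in> forms m k"
  by (auto simp: forms_iff)

lemma forms_value_scale:
  assumes "F \<in> forms m d" shows "value_at F (\<lambda>i. c * v i) = c ^ d * value_at F v"
  unfolding value_at_eq sum_distrib_left
proof (rule sum.cong)
  fix \<alpha> assume "\<alpha> \<in> Poly_Mapping.keys F"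
  then have "monomial_degree \<alpha> = d" using assms by (simp add: forms_iff)
  then show "to_ac (Poly_Mapping.lookup F \<alpha>) * monomial_value \<alpha> (\<lambda>i. c * v i)
      = c ^ d * (to_ac (Poly_Mapping.lookup F \<alpha>) * monomial_value \<alpha> v)"
    by (simp add: monomial_value_scale)
qed simp

text \<open>Exponents are natural numbers, so total degree 0 leaves only the empty monomial. This is
  where the scalar of the uniqueness claim comes from.\<close>

lemma forms_zero_degree:
  assumes "F \<in> forms m 0" shows "F = Poly_Mapping.single 0 (Poly_Mapping.lookup F 0)"
proof (rule poly_mapping_eqI)
  fix \<alpha>
  have "\<alpha> = 0" if "\<alpha> \<in> Poly_Mapping.keys F"
  proof (rule poly_mapping_eqI)
    fix i
    have "(\<Sum>i\<in>Poly_Mapping.keys \<alpha>. Poly_Mapping.lookup \<alpha> i) = 0"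
      using that assms by (auto simp: forms_def)
    then show "Poly_Mapping.lookup \<alpha> i = Poly_Mapping.lookup 0 i" by (cases "i \<in> Poly_Mapping.keys \<alpha>") (auto simp: in_keys_iff)
  qed
  then show "Poly_Mapping.lookup F \<alpha> = Poly_Mapping.lookup (Poly_Mapping.single 0 (Poly_Mapping.lookup F 0)) \<alpha>"
    by (auto simp: lookup_single when_def in_keys_iff)
qed

text \<open>A monomial of degree n fills exactly n tensor slots; this is what makes the restriction
  of a form a legitimate formal sum.\<close>

lemma length_monomial_factors:
  assumes "Poly_Mapping.keys \<alpha> \<subseteq> {..m}" shows "length (monomial_factors m \<alpha>) = monomial_degree \<alpha>"
proof -
  have "length (monomial_factors m \<alpha>) = (\<Sum>i\<leftarrow>[0..<Suc m]. Poly_Mapping.lookup \<alpha> i)"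
    unfolding monomial_factors_def length_concat map_map by (simp add: o_def)
  also have "\<dots> = (\<Sum>i\<in>{..m}. Poly_Mapping.lookup \<alpha> i)"
    by (subst sum.distinct_set_conv_list[symmetric]) (auto simp: atLeast0LessThan lessThan_Suc_atMost simp del: upt_Suc)
  finally show ?thesis using monomial_degree_superset[OF finite_atMost assms] by simp
qed

lemma prod_monomial_factors:
  assumes "Poly_Mapping.keys \<alpha> \<subseteq> {..m}" shows "(\<Prod>i\<leftarrow>monomial_factors m \<alpha>. v i) = monomial_value \<alpha> v"
proof -
  have c: "(\<Prod>i\<leftarrow>concat (map (\<lambda>i. replicate (k i) i) xs). v i) = (\<Prod>i\<leftarrow>xs. v i ^ k i)" for k :: "nat \<Rightarrow> nat" and xs
    by (induction xs) (simp_all only: map_append list.map concat.simps prod_list.append prod_list.Nil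
      prod_list.Cons map_replicate prod_list_replicate)
  have "(\<Prod>i\<leftarrow>monomial_factors m \<alpha>. v i) = (\<Prod>i\<leftarrow>[0..<Suc m]. v i ^ Poly_Mapping.lookup \<alpha> i)"
    unfolding monomial_factors_def by (rule c)
  also have "\<dots> = (\<Prod>i\<in>{..m}. v i ^ Poly_Mapping.lookup \<alpha> i)"
    by (subst prod.distinct_set_conv_list[symmetric]) (auto simp: atLeast0LessThan lessThan_Suc_atMost simp del: upt_Suc)
  finally show ?thesis by (simp only: monomial_value_superset[OF finite_atMost assms])
qed

lemma set_monomial_factors: "set (monomial_factors m \<alpha>) \<subseteq> {..m}"
  by (auto simp: monomial_factors_def)

section \<open>Projective varieties\<close>

definition rep :: "'k::field point \<Rightarrow> nat \<Rightarrow> 'k alg_closure" where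
  "rep P = (SOME v. v \<in> P)"

lemma ray_self: "v \<in> ray v"
  by (auto simp: ray_def intro!: exI[of _ 1])

lemma rep_in:
  assumes "P \<in> proj_space m" shows "rep P \<in> P"
proof -
  obtain v where "P = ray v" using assms by (auto simp: proj_space_def)
  then have "v \<in> P" using ray_self by blast
  then show ?thesis by (auto simp: rep_def some_in_eq)
qed

lemma point_scale:
  assumes "P \<in> proj_space m" "v \<in> P" "w \<in> P"
  obtains c where "c \<noteq> 0" "w = (\<lambda>i. c * v i)"
proof -
  obtain u where P: "P = ray u" using assms by (auto simp: proj_space_def)
  obtain a b where "a \<noteq> 0" "b \<noteq> 0" "v = (\<lambda>i. a * u i)" "w = (\<lambda>i. b * u i)"
    using assms(2,3) unfolding P ray_def by blast
  then show ?thesis by (intro that[of "b / a"]) auto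
qed

lemma point_eq_ray:
  assumes "P \<in> proj_space m" "v \<in> P" shows "P = ray v"
proof
  show "P \<subseteq> ray v" using point_scale[OF assms] by (auto simp: ray_def)
  obtain u a where "P = ray u" "v = (\<lambda>i. a * u i)" "a \<noteq> 0" using assms by (auto simp: proj_space_def ray_def)
  show "ray v \<subseteq> P"
  proof
    fix w assume "w \<in> ray v"
    then obtain c where "c \<noteq> 0" "w = (\<lambda>i. (c * a) * u i)"
      using \<open>v = _\<close> by (auto simp: ray_def mult.assoc)
    then show "w \<in> P" using \<open>P = ray u\<close> \<open>a \<noteq> 0\<close> unfolding ray_def by auto
  qed
qed

lemma rep_coordinates:
  assumes "P \<in> proj_space m"
  shows "\<exists>i\<le>m. rep P i \<noteq> 0" "i > m \<Longrightarrow> rep P i = 0"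
proof -
  obtain u where u: "P = ray u" "\<exists>i. u i \<noteq> 0" "\<forall>i>m. u i = 0" using assms by (auto simp: proj_space_def)
  obtain c where "c \<noteq> 0" "rep P = (\<lambda>i. c * u i)" using rep_in[OF assms] u(1) by (auto simp: ray_def)
  then show "\<exists>i\<le>m. rep P i \<noteq> 0" "i > m \<Longrightarrow> rep P i = 0"
    using u by (auto simp: not_le[symmetric])
qed

lemma ray_rep: "P \<in> proj_space m \<Longrightarrow> ray (rep P) = P"
  using point_eq_ray rep_in by blast

definition nonvanishing :: "'k::field point set \<Rightarrow> 'k mpoly \<Rightarrow> 'k point set" where
  "nonvanishing C F = {P \<in> C. \<forall>v\<in>P. value_at F v \<noteq> 0}"

lemma openin_nonvanishing: "F \<in> forms m d \<Longrightarrow> openin (zariski m C) (nonvanishing C F)"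
  unfolding zariski_def nonvanishing_def by (rule topology_generated_by_Basis) blast

lemma topspace_zariski [simp]: "topspace (zariski m C) = C"
proof -
  have "C = nonvanishing C 1" by (auto simp: nonvanishing_def)
  then have "C \<in> {{P \<in> C. \<forall>v\<in>P. value_at F v \<noteq> 0} |F. \<exists>d. F \<in> forms m d}"
    unfolding nonvanishing_def using forms_one by blast
  then show ?thesis unfolding zariski_def topology_generated_by_topspace by blast
qed

lemma variety_simps [simp]: "topo (variety m C) = zariski m C"
  by (simp add: variety_def)

text \<open>Rescaling the vector multiplies the value of a form by a power of a nonzero scalar, so
  testing the chosen vector is enough.\<close>

lemma mem_nonvanishing_iff:
  assumes "C \<subseteq> proj_space m" "F \<in> forms m d" "P \<in> C"
  shows "P \<in> nonvanishing C F \<longleftrightarrow> value_at F (rep P) \<noteq> 0"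
proof -
  have P: "P \<in> proj_space m" using assms by blast
  show ?thesis
  proof
    assume nz: "value_at F (rep P) \<noteq> 0"
    have "value_at F v \<noteq> 0" if v: "v \<in> P" for v
    proof -
      obtain c where "c \<noteq> 0" "v = (\<lambda>i. c * rep P i)" using point_scale[OF P rep_in[OF P] v] .
      then show ?thesis using nz by (simp add: forms_value_scale[OF assms(2)])
    qed
    then show "P \<in> nonvanishing C F" using assms(3) by (simp add: nonvanishing_def)
  qed (use rep_in[OF P] in \<open>simp add: nonvanishing_def\<close>)
qed

lemma regular_iff:
  "s \<in> regular (variety m C) U \<longleftrightarrow> s \<in> extensional U \<and> (\<forall>P\<in>U. \<exists>V d F G.
        openin (zariski m C) V \<and> P \<in> V \<and> V \<subseteq> U \<and> F \<in> forms m d \<and> G \<in> forms m d \<and>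
        (\<forall>Q\<in>V. \<forall>v\<in>Q. value_at G v \<noteq> 0 \<and> s Q = value_at F v / value_at G v))"
  by (simp add: variety_def)

lemma regularE:
  assumes "s \<in> regular (variety m C) U" "P \<in> U"
  obtains V d F G where "openin (zariski m C) V" "P \<in> V" "V \<subseteq> U" "F \<in> forms m d" "G \<in> forms m d"
    "\<And>Q v. Q \<in> V \<Longrightarrow> v \<in> Q \<Longrightarrow> value_at G v \<noteq> 0" "\<And>Q v. Q \<in> V \<Longrightarrow> v \<in> Q \<Longrightarrow> s Q = value_at F v / value_at G v"
proof -
  have "\<exists>V d F G.
        openin (zariski m C) V \<and> P \<in> V \<and> V \<subseteq> U \<and> F \<in> forms m d \<and> G \<in> forms m d \<and>
        (\<forall>Q\<in>V. \<forall>v\<in>Q. value_at G v \<noteq> 0 \<and> s Q = value_at F v / value_at G v)"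
    using assms by (simp add: regular_iff)
  then show ?thesis using that by (elim exE conjE) blast
qed

lemma regularI:
  assumes "s \<in> extensional U"
    and "\<And>P. P \<in> U \<Longrightarrow> \<exists>V d F G.
        openin (zariski m C) V \<and> P \<in> V \<and> V \<subseteq> U \<and> F \<in> forms m d \<and> G \<in> forms m d \<and>
        (\<forall>Q\<in>V. \<forall>v\<in>Q. value_at G v \<noteq> 0 \<and> s Q = value_at F v / value_at G v)"
  shows "s \<in> regular (variety m C) U"
  using assms by (simp add: regular_iff)

text \<open>Numerator and denominator have the same degree, so the scale factor between the chosen
  vector and any other cancels. This is the only source of nonconstant regular functions in the
  constructions below.\<close>

lemma regular_quotient:
  assumes C: "C \<subseteq> proj_space m" and U: "openin (zariski m C) U" and FG: "F \<in> forms m d" "G \<in> forms m d"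
    and nz: "\<And>P. P \<in> U \<Longrightarrow> value_at G (rep P) \<noteq> 0"
  shows "(\<lambda>P\<in>U. value_at F (rep P) / value_at G (rep P)) \<in> regular (variety m C) U"
proof (rule regularI)
  fix P assume P: "P \<in> U"
  have "value_at G v \<noteq> 0 \<and> (\<lambda>P\<in>U. value_at F (rep P) / value_at G (rep P)) Q = value_at F v / value_at G v"
    if Q: "Q \<in> U" "v \<in> Q" for Q v
  proof -
    have QP: "Q \<in> proj_space m" using Q U C openin_subset[OF U] by auto
    obtain c where "c \<noteq> 0" "v = (\<lambda>i. c * rep Q i)" using point_scale[OF QP rep_in[OF QP] Q(2)] .
    then show ?thesis using nz[OF Q(1)] Q FG by (simp add: forms_value_scale)
  qed
  then show "\<exists>V d F' G'. openin (zariski m C) V \<and> P \<in> V \<and> V \<subseteq> U \<and> F' \<in> forms m d \<and> G' \<in> forms m d \<and>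
      (\<forall>Q\<in>V. \<forall>v\<in>Q. value_at G' v \<noteq> 0 \<and>
         (\<lambda>P\<in>U. value_at F (rep P) / value_at G (rep P)) Q = value_at F' v / value_at G' v)"
    using U P FG by (intro exI[of _ U] exI[of _ d] exI[of _ F] exI[of _ G]) simp
qed simp

lemma regular_const:
  assumes "openin (zariski m C) U" shows "(\<lambda>P\<in>U. to_ac c) \<in> regular (variety m C) U"
proof (rule regularI)
  fix P assume "P \<in> U"
  then show "\<exists>V d F G. openin (zariski m C) V \<and> P \<in> V \<and> V \<subseteq> U \<and> F \<in> forms m d \<and> G \<in> forms m d \<and>
      (\<forall>Q\<in>V. \<forall>v\<in>Q. value_at G v \<noteq> 0 \<and> (\<lambda>P\<in>U. to_ac c) Q = value_at F v / value_at G v)"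
    using assms forms_const[of c m] forms_one[of m]
    by (intro exI[of _ U] exI[of _ 0] exI[of _ "Poly_Mapping.single 0 c"] exI[of _ 1]) auto
qed simp

lemma function_space_variety: "function_space (variety m C)"
proof
  fix U V a assume U: "openin (topo (variety m C)) U" "openin (topo (variety m C)) V" "V \<subseteq> U"
    and a: "a \<in> regular (variety m C) U"
  show "restrict a V \<in> regular (variety m C) V"
  proof (rule regularI)
    fix P assume P: "P \<in> V"
    then have "P \<in> U" using U by blast
    then obtain W d F G where W: "openin (zariski m C) W" "P \<in> W" "W \<subseteq> U" "F \<in> forms m d" "G \<in> forms m d"
      "\<And>Q v. Q \<in> W \<Longrightarrow> v \<in> Q \<Longrightarrow> value_at G v \<noteq> 0" "\<And>Q v. Q \<in> W \<Longrightarrow> v \<in> Q \<Longrightarrow> a Q = value_at F v / value_at G v"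
      by (rule regularE[OF a]) (rule that)
    have "value_at G v \<noteq> 0 \<and> restrict a V Q = value_at F v / value_at G v" if "Q \<in> W \<inter> V" "v \<in> Q" for Q v
      using that W(6)[of Q v] W(7)[of Q v] by simp
    then show "\<exists>W d F G. openin (zariski m C) W \<and> P \<in> W \<and> W \<subseteq> V \<and> F \<in> forms m d \<and> G \<in> forms m d \<and>
      (\<forall>Q\<in>W. \<forall>v\<in>Q. value_at G v \<noteq> 0 \<and> restrict a V Q = value_at F v / value_at G v)"
      using U P W(1,2,4,5)
      by (intro exI[of _ "W \<inter> V"] exI[of _ d] exI[of _ F] exI[of _ G]) (simp add: openin_Int)
  qed simp
next
  fix U a b assume a: "a \<in> regular (variety m C) U" and b: "b \<in> regular (variety m C) U"
  have *: "(\<lambda>x\<in>U. a x + b x) \<in> regular (variety m C) U \<and> (\<lambda>x\<in>U. a x * b x) \<in> regular (variety m C) U"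
  proof (intro conjI regularI)
    fix P assume P: "P \<in> U"
    obtain W d F G where W: "openin (zariski m C) W" "P \<in> W" "W \<subseteq> U" "F \<in> forms m d" "G \<in> forms m d"
      "\<And>Q v. Q \<in> W \<Longrightarrow> v \<in> Q \<Longrightarrow> value_at G v \<noteq> 0" "\<And>Q v. Q \<in> W \<Longrightarrow> v \<in> Q \<Longrightarrow> a Q = value_at F v / value_at G v"
      by (rule regularE[OF a P]) (rule that)
    obtain W' d' F' G' where W': "openin (zariski m C) W'" "P \<in> W'" "W' \<subseteq> U" "F' \<in> forms m d'" "G' \<in> forms m d'"
      "\<And>Q v. Q \<in> W' \<Longrightarrow> v \<in> Q \<Longrightarrow> value_at G' v \<noteq> 0" "\<And>Q v. Q \<in> W' \<Longrightarrow> v \<in> Q \<Longrightarrow> b Q = value_at F' v / value_at G' v"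
      by (rule regularE[OF b P]) (rule that)
    \<comment> \<open>Over the common denominator \<open>G * G'\<close> all three forms have degree
      d + d'.\<close>
    have f: "F * G' + F' * G \<in> forms m (d + d')" "F * F' \<in> forms m (d + d')" "G * G' \<in> forms m (d + d')"
      using forms_mult[OF W(4) W'(5)] forms_mult[OF W'(4) W(5)] forms_mult[OF W(4) W'(4)] forms_mult[OF W(5) W'(5)]
      by (simp_all add: forms_add add.commute)
    have W'': "openin (zariski m C) (W \<inter> W')" "P \<in> W \<inter> W'" "W \<inter> W' \<subseteq> U" using W W' by auto
    have "\<forall>Q\<in>W \<inter> W'. \<forall>v\<in>Q. value_at (G * G') v \<noteq> 0 \<and>
        (\<lambda>x\<in>U. a x + b x) Q = value_at (F * G' + F' * G) v / value_at (G * G') v"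
    proof (intro ballI)
      fix Q v assume Q: "Q \<in> W \<inter> W'" "v \<in> Q"
      then have "value_at G v \<noteq> 0" "value_at G' v \<noteq> 0" "a Q = value_at F v / value_at G v"
        "b Q = value_at F' v / value_at G' v" "Q \<in> U" using W W' by blast+
      then show "value_at (G * G') v \<noteq> 0 \<and>
        (\<lambda>x\<in>U. a x + b x) Q = value_at (F * G' + F' * G) v / value_at (G * G') v"
        by (simp add: field_simps)
    qed
    then show "\<exists>V d F G. openin (zariski m C) V \<and> P \<in> V \<and> V \<subseteq> U \<and> F \<in> forms m d \<and> G \<in> forms m d \<and>
      (\<forall>Q\<in>V. \<forall>v\<in>Q. value_at G v \<noteq> 0 \<and> (\<lambda>x\<in>U. a x + b x) Q = value_at F v / value_at G v)"
      using f W'' by (intro exI[of _ "W \<inter> W'"] exI[of _ "d + d'"] exI[of _ "F * G' + F' * G"] exI[of _ "G * G'"] conjI)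
    have "\<forall>Q\<in>W \<inter> W'. \<forall>v\<in>Q. value_at (G * G') v \<noteq> 0 \<and>
        (\<lambda>x\<in>U. a x * b x) Q = value_at (F * F') v / value_at (G * G') v"
    proof (intro ballI)
      fix Q v assume Q: "Q \<in> W \<inter> W'" "v \<in> Q"
      then have "value_at G v \<noteq> 0" "value_at G' v \<noteq> 0" "a Q = value_at F v / value_at G v"
        "b Q = value_at F' v / value_at G' v" "Q \<in> U" using W W' by blast+
      then show "value_at (G * G') v \<noteq> 0 \<and>
        (\<lambda>x\<in>U. a x * b x) Q = value_at (F * F') v / value_at (G * G') v"
        by simp
    qed
    then show "\<exists>V d F G. openin (zariski m C) V \<and> P \<in> V \<and> V \<subseteq> U \<and> F \<in> forms m d \<and> G \<in> forms m d \<and>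
      (\<forall>Q\<in>V. \<forall>v\<in>Q. value_at G v \<noteq> 0 \<and> (\<lambda>x\<in>U. a x * b x) Q = value_at F v / value_at G v)"
      using f W'' by (intro exI[of _ "W \<inter> W'"] exI[of _ "d + d'"] exI[of _ "F * F'"] exI[of _ "G * G'"] conjI)
  qed simp_all
  from * show "(\<lambda>x\<in>U. a x + b x) \<in> regular (variety m C) U" ..
  from * show "(\<lambda>x\<in>U. a x * b x) \<in> regular (variety m C) U" ..
next
  fix U assume "openin (topo (variety m C)) U"
  then show "(\<lambda>x\<in>U. 0) \<in> regular (variety m C) U" "(\<lambda>x\<in>U. 1) \<in> regular (variety m C) U"
    using regular_const[of m C U 0] regular_const[of m C U 1] by simp_all
qed (simp add: regular_iff)

text \<open>Both topologies are generated by nonvanishing sets of the same forms, and local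
  quotients of forms restrict to local quotients. With \<open>C\<close> = \<open>D\<close> this is
  the identity map, along which tensor powers are formed.\<close>

lemma space_morphism_inclusion:
  assumes "C \<subseteq> D"
  shows "space_morphism (variety m C) (variety m D) (\<lambda>P. P)"
proof -
  have cont: "continuous_map (zariski m C) (zariski m D) (\<lambda>P. P)"
    unfolding zariski_def[of m D]
  proof (rule continuous_on_generated_topo)
    fix U assume "U \<in> {{P \<in> D. \<forall>v\<in>P. value_at F v \<noteq> 0} |F. \<exists>d. F \<in> forms m d}"
    then obtain F d where F: "U = nonvanishing D F" "F \<in> forms m d" by (auto simp: nonvanishing_def)
    then have "(\<lambda>P. P) -` U \<inter> topspace (zariski m C) = nonvanishing C F"
      using assms by (auto simp: nonvanishing_def)
    then show "openin (zariski m C) ((\<lambda>P. P) -` U \<inter> topspace (zariski m C))"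
      using F openin_nonvanishing by metis
  next
    have "topspace (zariski m D) = D" by simp
    then show "(\<lambda>P. P) ` topspace (zariski m C) \<subseteq> \<Union> {{P \<in> D. \<forall>v\<in>P. value_at F v \<noteq> 0} |F. \<exists>d. F \<in> forms m d}"
      unfolding zariski_def[of m D] topology_generated_by_topspace using assms by simp
  qed
  moreover have "(\<lambda>x\<in>{x \<in> C. x \<in> V}. s x) \<in> regular (variety m C) {x \<in> C. x \<in> V}"
    if V: "openin (zariski m D) V" "s \<in> regular (variety m D) V" for V s
  proof (rule regularI)
    fix P assume P: "P \<in> {x \<in> C. x \<in> V}"
    then have "P \<in> V" by simp
    then obtain W d F G where W: "openin (zariski m D) W" "P \<in> W" "W \<subseteq> V" "F \<in> forms m d" "G \<in> forms m d"
      "\<And>Q v. Q \<in> W \<Longrightarrow> v \<in> Q \<Longrightarrow> value_at G v \<noteq> 0" "\<And>Q v. Q \<in> W \<Longrightarrow> v \<in> Q \<Longrightarrow> s Q = value_at F v / value_at G v"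
      by (rule regularE[OF V(2)]) (rule that)
    moreover have "openin (zariski m C) {x \<in> C. x \<in> W}"
      using cont W(1) by (simp add: continuous_map_def)
    have "\<forall>Q\<in>{x \<in> C. x \<in> W}. \<forall>v\<in>Q. value_at G v \<noteq> 0 \<and>
        (\<lambda>x\<in>{x \<in> C. x \<in> V}. s x) Q = value_at F v / value_at G v"
    proof (intro ballI)
      fix Q v assume Q: "Q \<in> {x \<in> C. x \<in> W}" "v \<in> Q"
      then have "Q \<in> V" using W(3) by blast
      then show "value_at G v \<noteq> 0 \<and> (\<lambda>x\<in>{x \<in> C. x \<in> V}. s x) Q = value_at F v / value_at G v"
        using Q W(6)[of Q v] W(7)[of Q v] by simp
    qed
    moreover have "openin (zariski m C) {x \<in> C. x \<in> W}"
      using cont W(1) by (simp add: continuous_map_def)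
    moreover have "P \<in> {x \<in> C. x \<in> W}" "{x \<in> C. x \<in> W} \<subseteq> {x \<in> C. x \<in> V}" using P W(2,3) by auto
    ultimately show "\<exists>W d F G. openin (zariski m C) W \<and> P \<in> W \<and> W \<subseteq> {x \<in> C. x \<in> V} \<and> F \<in> forms m d \<and> G \<in> forms m d \<and>
      (\<forall>Q\<in>W. \<forall>v\<in>Q. value_at G v \<noteq> 0 \<and> (\<lambda>x\<in>{x \<in> C. x \<in> V}. s x) Q = value_at F v / value_at G v)"
      using W(4,5) by (intro exI[of _ "{x \<in> C. x \<in> W}"] exI[of _ d] exI[of _ F] exI[of _ G] conjI)
  qed simp
  ultimately show ?thesis by (simp add: space_morphism_def)
qed

section \<open>Values and generators of O(1) on projective space\<close>

abbreviation coordinate :: "nat \<Rightarrow> 'k::field mpoly" where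
  "coordinate i \<equiv> Poly_Mapping.single (Poly_Mapping.single i 1) 1"

text \<open>The argument \<open>U\<close> is ignored; it only gives \<open>cone_value\<close> the type of an evaluation map.\<close>

definition cone_value :: "'k::field point set \<Rightarrow> ((nat \<Rightarrow> 'k alg_closure) \<Rightarrow> 'k alg_closure) \<Rightarrow> 'k point \<Rightarrow> 'k alg_closure"
  where "cone_value U s P = s (rep P)"

text \<open>The standard trivialisations of O(1): the section X_i over the open set where X_i is
  nonzero.\<close>

definition coordinate_gen :: "nat \<Rightarrow> 'k::field point set \<Rightarrow> ('k point \<Rightarrow> 'k alg_closure) \<Rightarrow> bool" where
  "coordinate_gen m V g \<longleftrightarrow> (\<exists>i\<le>m. V = nonvanishing (proj_space m) (coordinate i) \<and> g = (\<lambda>P. rep P i))"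

lemma twisting_sheaf_simps:
  "s \<in> carrier (sections (twisting_sheaf m d) U) \<longleftrightarrow> s \<in> extensional (\<Union>U) \<and> (\<forall>P\<in>U. \<exists>V e F G.
         openin (zariski m (proj_space m)) V \<and> P \<in> V \<and> V \<subseteq> U \<and> F \<in> forms m (e + d) \<and> G \<in> forms m e \<and>
         (\<forall>v\<in>\<Union>V. value_at G v \<noteq> 0 \<and> s v = value_at F v / value_at G v))"
  "s \<oplus>\<^bsub>sections (twisting_sheaf m d) U\<^esub> t = (\<lambda>v\<in>\<Union>U. s v + t v)"
  "a \<odot>\<^bsub>sections (twisting_sheaf m d) U\<^esub> s = (\<lambda>v\<in>\<Union>U. a (ray v) * s v)"
  "res (twisting_sheaf m d) U V s = restrict s (\<Union>V)"
  by (simp_all add: twisting_sheaf_def)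

lemma twisting_sectionE:
  assumes "s \<in> carrier (sections (twisting_sheaf m d) U)" "P \<in> U"
  obtains V e F G where "openin (zariski m (proj_space m)) V" "P \<in> V" "V \<subseteq> U" "F \<in> forms m (e + d)"
    "G \<in> forms m e" "\<And>Q v. Q \<in> V \<Longrightarrow> v \<in> Q \<Longrightarrow> value_at G v \<noteq> 0"
    "\<And>Q v. Q \<in> V \<Longrightarrow> v \<in> Q \<Longrightarrow> s v = value_at F v / value_at G v"
proof -
  have "\<exists>V e F G. openin (zariski m (proj_space m)) V \<and> P \<in> V \<and> V \<subseteq> U \<and> F \<in> forms m (e + d) \<and> G \<in> forms m e \<and>
         (\<forall>v\<in>\<Union>V. value_at G v \<noteq> 0 \<and> s v = value_at F v / value_at G v)"
    using assms by (simp add: twisting_sheaf_simps)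
  then show ?thesis using that by (elim exE conjE) blast
qed

lemma twisting_sectionI:
  assumes "s \<in> extensional (\<Union>U)"
    and "\<And>P. P \<in> U \<Longrightarrow> \<exists>V e F G. openin (zariski m (proj_space m)) V \<and> P \<in> V \<and> V \<subseteq> U \<and>
       F \<in> forms m (e + d) \<and> G \<in> forms m e \<and>
       (\<forall>Q\<in>V. \<forall>v\<in>Q. value_at G v \<noteq> 0 \<and> s v = value_at F v / value_at G v)"
  shows "s \<in> carrier (sections (twisting_sheaf m d) U)"
  using assms by (simp add: twisting_sheaf_simps)

text \<open>Locally s is a quotient whose degrees differ by d. Hence its value at the chosen vector
  fixes it on the whole ray, which is what faithfulness of \<open>cone_value\<close>
  requires.\<close>

lemma twisting_section_scale:
  assumes "s \<in> carrier (sections (twisting_sheaf m d) U)" "P \<in> U" "v \<in> P" "(\<lambda>i. c * v i) \<in> P" "c \<noteq> 0"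
  shows "s (\<lambda>i. c * v i) = c ^ d * s v"
proof -
  obtain V e F G where "P \<in> V" "F \<in> forms m (e + d)" "G \<in> forms m e"
    "\<And>Q v. Q \<in> V \<Longrightarrow> v \<in> Q \<Longrightarrow> s v = value_at F v / value_at G v"
    using twisting_sectionE[OF assms(1,2)] by metis
  then show ?thesis using assms(3-5) by (simp add: forms_value_scale power_add)
qed

section \<open>The sheaf of hyperplane sections\<close>

text \<open>A section of O(1) is locally F / G with deg F = deg G + 1, so where X_i is nonzero it
  equals F / (G X_i) times X_i with a regular coefficient. Faithfulness is homogeneity along rays;
  closure under the operations is arithmetic of fractions.\<close>

theorem line_sheaf_twisting:
  "line_sheaf (variety m (proj_space m :: 'k::field point set)) (twisting_sheaf m 1) cone_value (coordinate_gen m)"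
  (is "line_sheaf ?Z ?F _ _")
proof -
  interpret function_space ?Z by (rule function_space_variety)
  have inU: "P \<in> proj_space m" if "openin (topo ?Z) U" "P \<in> U" for U P
    using that openin_subset[OF that(1)] by auto
  have gen: "(coordinate i :: 'k mpoly) \<in> forms m 1" if "i \<le> m" for i using that by (rule forms_coordinate)
  have gen_mem: "P \<in> nonvanishing (proj_space m) (coordinate i) \<longleftrightarrow> P \<in> proj_space m \<and> rep P i \<noteq> 0" 
    if "i \<le> m" for i and P :: "'k point"
    using mem_nonvanishing_iff[OF subset_refl gen[OF that], of P]
    by (auto simp: nonvanishing_def)
  show ?thesis
  proof
    fix U s t assume U: "openin (topo ?Z) U" and s: "s \<in> carrier (sections ?F U)" and t: "t \<in> carrier (sections ?F U)"
    show "s \<oplus>\<^bsub>sections ?F U\<^esub> t \<in> carrier (sections ?F U)"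
      unfolding twisting_sheaf_simps(2)
    proof (rule twisting_sectionI)
      fix P assume P: "P \<in> U"
      obtain V e F G where V: "openin (zariski m (proj_space m)) V" "P \<in> V" "V \<subseteq> U" "F \<in> forms m (e + 1)"
        "G \<in> forms m e" "\<And>Q v. Q \<in> V \<Longrightarrow> v \<in> Q \<Longrightarrow> value_at G v \<noteq> 0"
        "\<And>Q v. Q \<in> V \<Longrightarrow> v \<in> Q \<Longrightarrow> s v = value_at F v / value_at G v"
        by (rule twisting_sectionE[OF s P]) (rule that)
      obtain V' e' F' G' where V': "openin (zariski m (proj_space m)) V'" "P \<in> V'" "V' \<subseteq> U" "F' \<in> forms m (e' + 1)"
        "G' \<in> forms m e'" "\<And>Q v. Q \<in> V' \<Longrightarrow> v \<in> Q \<Longrightarrow> value_at G' v \<noteq> 0"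
        "\<And>Q v. Q \<in> V' \<Longrightarrow> v \<in> Q \<Longrightarrow> t v = value_at F' v / value_at G' v"
        by (rule twisting_sectionE[OF t P]) (rule that)
      have f: "F * G' + F' * G \<in> forms m (e + e' + 1)" "G * G' \<in> forms m (e + e')"
        using forms_mult[OF V(4) V'(5)] forms_mult[OF V'(4) V(5)] forms_mult[OF V(5) V'(5)]
        by (simp_all add: forms_add add_ac)
      have W: "openin (zariski m (proj_space m)) (V \<inter> V')" "P \<in> V \<inter> V'" "V \<inter> V' \<subseteq> U" using V V' by auto
      have "\<forall>Q\<in>V \<inter> V'. \<forall>v\<in>Q. value_at (G * G') v \<noteq> 0 \<and>
          (\<lambda>v\<in>\<Union>U. s v + t v) v = value_at (F * G' + F' * G) v / value_at (G * G') v"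
      proof (intro ballI)
        fix Q v assume Q: "Q \<in> V \<inter> V'" "v \<in> Q"
        then have "value_at G v \<noteq> 0" "value_at G' v \<noteq> 0" "s v = value_at F v / value_at G v"
          "t v = value_at F' v / value_at G' v" "v \<in> \<Union>U" using V V' by blast+
        then show "value_at (G * G') v \<noteq> 0 \<and>
          (\<lambda>v\<in>\<Union>U. s v + t v) v = value_at (F * G' + F' * G) v / value_at (G * G') v"
          by (simp add: field_simps del: Union_iff)
      qed
      then show "\<exists>V e F G. openin (zariski m (proj_space m)) V \<and> P \<in> V \<and> V \<subseteq> U \<and> F \<in> forms m (e + 1) \<and> G \<in> forms m e \<and>
          (\<forall>Q\<in>V. \<forall>v\<in>Q. value_at G v \<noteq> 0 \<and> (\<lambda>v\<in>\<Union>U. s v + t v) v = value_at F v / value_at G v)"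
        using f W by (intro exI[of _ "V \<inter> V'"] exI[of _ "e + e'"] exI[of _ "F * G' + F' * G"] exI[of _ "G * G'"] conjI)
    qed simp
    show "cone_value U (s \<oplus>\<^bsub>sections ?F U\<^esub> t) x = cone_value U s x + cone_value U t x" if "x \<in> U" for x
      using that rep_in[OF inU[OF U that]] by (auto simp: cone_value_def twisting_sheaf_simps)
    show "s = t" if eq: "\<And>x. x \<in> U \<Longrightarrow> cone_value U s x = cone_value U t x"
    proof (rule extensionalityI[of _ "\<Union>U"])
      show "s \<in> extensional (\<Union>U)" "t \<in> extensional (\<Union>U)" using s t by (simp_all add: twisting_sheaf_simps(1))
      fix v assume "v \<in> \<Union>U"
      then obtain P where P: "P \<in> U" "v \<in> P" by blast
      note PP = inU[OF U P(1)]
      obtain c where c: "c \<noteq> 0" "v = (\<lambda>i. c * rep P i)" using point_scale[OF PP rep_in[OF PP] P(2)] .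
      then show "s v = t v"
        using twisting_section_scale[OF s P(1) rep_in[OF PP], of c] twisting_section_scale[OF t P(1) rep_in[OF PP], of c]
          P(2) eq[OF P(1)] by (simp add: cone_value_def)
    qed
  next
    fix U a t assume U: "openin (topo ?Z) U" and a: "a \<in> regular ?Z U" and t: "t \<in> carrier (sections ?F U)"
    show "a \<odot>\<^bsub>sections ?F U\<^esub> t \<in> carrier (sections ?F U)"
      unfolding twisting_sheaf_simps(3)
    proof (rule twisting_sectionI)
      fix P assume P: "P \<in> U"
      obtain V d F G where V: "openin (zariski m (proj_space m)) V" "P \<in> V" "V \<subseteq> U" "F \<in> forms m d"
        "G \<in> forms m d" "\<And>Q v. Q \<in> V \<Longrightarrow> v \<in> Q \<Longrightarrow> value_at G v \<noteq> 0"
        "\<And>Q v. Q \<in> V \<Longrightarrow> v \<in> Q \<Longrightarrow> a Q = value_at F v / value_at G v"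
        by (rule regularE[OF a P]) (rule that)
      obtain V' e' F' G' where V': "openin (zariski m (proj_space m)) V'" "P \<in> V'" "V' \<subseteq> U" "F' \<in> forms m (e' + 1)"
        "G' \<in> forms m e'" "\<And>Q v. Q \<in> V' \<Longrightarrow> v \<in> Q \<Longrightarrow> value_at G' v \<noteq> 0"
        "\<And>Q v. Q \<in> V' \<Longrightarrow> v \<in> Q \<Longrightarrow> t v = value_at F' v / value_at G' v"
        by (rule twisting_sectionE[OF t P]) (rule that)
      have f: "F * F' \<in> forms m (d + e' + 1)" "G * G' \<in> forms m (d + e')"
        using forms_mult[OF V(4) V'(4)] forms_mult[OF V(5) V'(5)] by (simp_all add: add_ac)
      have W: "openin (zariski m (proj_space m)) (V \<inter> V')" "P \<in> V \<inter> V'" "V \<inter> V' \<subseteq> U" using V V' by auto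
      have "\<forall>Q\<in>V \<inter> V'. \<forall>v\<in>Q. value_at (G * G') v \<noteq> 0 \<and>
          (\<lambda>v\<in>\<Union>U. a (ray v) * t v) v = value_at (F * F') v / value_at (G * G') v"
      proof (intro ballI)
        fix Q v assume Q: "Q \<in> V \<inter> V'" "v \<in> Q"
        then have "value_at G v \<noteq> 0" "value_at G' v \<noteq> 0" "a Q = value_at F v / value_at G v"
          "t v = value_at F' v / value_at G' v" "v \<in> \<Union>U" "Q \<in> U" using V V' by blast+
        \<comment> \<open>Scalars act on a vector v through the point \<open>ray v\<close>, which
          must be recognised as \<open>Q\<close> before the formula for a applies.\<close>
        moreover have "Q = ray v" using point_eq_ray inU[OF U \<open>Q \<in> U\<close>] Q by blast
        ultimately show "value_at (G * G') v \<noteq> 0 \<and>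
          (\<lambda>v\<in>\<Union>U. a (ray v) * t v) v = value_at (F * F') v / value_at (G * G') v"
          by (simp del: Union_iff)
      qed
      then show "\<exists>V e F G. openin (zariski m (proj_space m)) V \<and> P \<in> V \<and> V \<subseteq> U \<and> F \<in> forms m (e + 1) \<and> G \<in> forms m e \<and>
          (\<forall>Q\<in>V. \<forall>v\<in>Q. value_at G v \<noteq> 0 \<and> (\<lambda>v\<in>\<Union>U. a (ray v) * t v) v = value_at F v / value_at G v)"
        using f W by (intro exI[of _ "V \<inter> V'"] exI[of _ "d + e'"] exI[of _ "F * F'"] exI[of _ "G * G'"] conjI)
    qed simp
    show "cone_value U (a \<odot>\<^bsub>sections ?F U\<^esub> t) x = a x * cone_value U t x" if "x \<in> U" for x
      using that rep_in[OF inU[OF U that]] ray_rep[OF inU[OF U that]]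
      by (auto simp: cone_value_def twisting_sheaf_simps)
  next
    fix U V s assume U: "openin (topo ?Z) U" and V: "openin (topo ?Z) V" and VU: "V \<subseteq> U"
      and s: "s \<in> carrier (sections ?F U)"
    show "res ?F U V s \<in> carrier (sections ?F V)"
      unfolding twisting_sheaf_simps(4)
    proof (rule twisting_sectionI)
      fix P assume P: "P \<in> V"
      then have PU: "P \<in> U" using VU by blast
      obtain W e F G where W: "openin (zariski m (proj_space m)) W" "P \<in> W" "W \<subseteq> U" "F \<in> forms m (e + 1)"
        "G \<in> forms m e" "\<And>Q v. Q \<in> W \<Longrightarrow> v \<in> Q \<Longrightarrow> value_at G v \<noteq> 0"
        "\<And>Q v. Q \<in> W \<Longrightarrow> v \<in> Q \<Longrightarrow> s v = value_at F v / value_at G v"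
        by (rule twisting_sectionE[OF s PU]) (rule that)
      have "\<forall>Q\<in>W \<inter> V. \<forall>v\<in>Q. value_at G v \<noteq> 0 \<and> restrict s (\<Union>V) v = value_at F v / value_at G v"
      proof (intro ballI)
        fix Q v assume Q: "Q \<in> W \<inter> V" "v \<in> Q"
        then have "v \<in> \<Union>V" "Q \<in> W" by blast+
        then show "value_at G v \<noteq> 0 \<and> restrict s (\<Union>V) v = value_at F v / value_at G v"
          using W(6)[of Q v] W(7)[of Q v] Q(2) by (simp del: Union_iff)
      qed
      moreover have "openin (zariski m (proj_space m)) (W \<inter> V)" "P \<in> W \<inter> V" "W \<inter> V \<subseteq> V" using W V P by auto
      ultimately show "\<exists>W e F G. openin (zariski m (proj_space m)) W \<and> P \<in> W \<and> W \<subseteq> V \<and> F \<in> forms m (e + 1) \<and> G \<in> forms m e \<and>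
          (\<forall>Q\<in>W. \<forall>v\<in>Q. value_at G v \<noteq> 0 \<and> restrict s (\<Union>V) v = value_at F v / value_at G v)"
        using W(4,5) by (intro exI[of _ "W \<inter> V"] exI[of _ e] exI[of _ F] exI[of _ G] conjI)
    qed simp
    show "cone_value V (res ?F U V s) x = cone_value U s x" if "x \<in> V" for x
      using that rep_in[OF inU[OF V that]] by (auto simp: cone_value_def twisting_sheaf_simps)
  next
    fix V :: "'k point set" and g assume "coordinate_gen m V g"
    then obtain i where i: "i \<le> m" "V = nonvanishing (proj_space m) (coordinate i)" "g = (\<lambda>P. rep P i)"
      by (auto simp: coordinate_gen_def)
    show V: "openin (topo ?Z) V" using openin_nonvanishing[OF gen] i by simp
    show gnz: "g x \<noteq> 0" if "x \<in> V" for x using that i gen_mem[OF i(1)] by simp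
    show "\<exists>s\<in>carrier (sections ?F V). \<forall>x\<in>V. cone_value V s x = g x"
    proof (intro bexI ballI)
      show "cone_value V (\<lambda>v\<in>\<Union>V. v i) x = g x" if "x \<in> V" for x
        using that rep_in[OF inU[OF V that]] i by (auto simp: cone_value_def)
      show "(\<lambda>v\<in>\<Union>V. v i) \<in> carrier (sections ?F V)"
      proof (rule twisting_sectionI)
        fix P assume "P \<in> V"
        moreover have "\<forall>Q\<in>V. \<forall>v\<in>Q. value_at 1 v \<noteq> 0 \<and> (\<lambda>v\<in>\<Union>V. v i) v = value_at (coordinate i) v / value_at 1 v"
          by auto
        ultimately show "\<exists>W e F G. openin (zariski m (proj_space m)) W \<and> P \<in> W \<and> W \<subseteq> V \<and> F \<in> forms m (e + 1) \<and> G \<in> forms m e \<and>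
          (\<forall>Q\<in>W. \<forall>v\<in>Q. value_at G v \<noteq> 0 \<and> (\<lambda>v\<in>\<Union>V. v i) v = value_at F v / value_at G v)"
          using V gen[OF i(1)] forms_one[of m]
          by (intro exI[of _ V] exI[of _ 0] exI[of _ "coordinate i"] exI[of _ 1] conjI) simp_all
      qed simp
    qed
    fix U s x assume U: "openin (topo ?Z) U" and s: "s \<in> carrier (sections ?F U)" and x: "x \<in> U" "x \<in> V"
    obtain W e F G where W: "openin (zariski m (proj_space m)) W" "x \<in> W" "W \<subseteq> U" "F \<in> forms m (e + 1)"
        "G \<in> forms m e" "\<And>Q v. Q \<in> W \<Longrightarrow> v \<in> Q \<Longrightarrow> value_at G v \<noteq> 0"
        "\<And>Q v. Q \<in> W \<Longrightarrow> v \<in> Q \<Longrightarrow> s v = value_at F v / value_at G v"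
      by (rule twisting_sectionE[OF s x(1)]) (rule that)
    \<comment> \<open>The extra factor raises the degree of the denominator to e + 1, that of
      \<open>F\<close>, so that the quotient is a regular function.\<close>
    let ?N = "W \<inter> V" and ?H = "G * coordinate i"
    define a where "a = (\<lambda>P\<in>?N. value_at F (rep P) / value_at ?H (rep P))"
    have N: "openin (zariski m (proj_space m)) ?N" "x \<in> ?N" "?N \<subseteq> U \<inter> V" using W V x by auto
    have H: "?H \<in> forms m (e + 1)" using W gen[OF i(1)] by (intro forms_mult)
    have nz: "value_at G (rep P) \<noteq> 0" "rep P i \<noteq> 0" "s (rep P) = value_at F (rep P) / value_at G (rep P)" if "P \<in> ?N" for P
      using that W(6,7)[of P "rep P"] rep_in[OF inU[OF V, of P]] gnz[of P] i by auto
    have "a \<in> regular ?Z ?N"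
      unfolding a_def by (rule regular_quotient[OF subset_refl N(1) W(4) H]) (use nz in auto)
    moreover have "cone_value U s z = a z * g z" if "z \<in> ?N" for z
      using nz[OF that] that i by (simp add: a_def cone_value_def)
    ultimately show "\<exists>W a. openin (topo ?Z) W \<and> x \<in> W \<and> W \<subseteq> U \<inter> V \<and> a \<in> regular ?Z W \<and>
        (\<forall>z\<in>W. cone_value U s z = a z * g z)"
      using N by (intro exI[of _ ?N] exI[of _ a]) simp
  next
    fix x assume "x \<in> topspace (topo ?Z)"
    then have "x \<in> proj_space m" by simp
    then obtain i where "i \<le> m" "x \<in> nonvanishing (proj_space m) (coordinate i)"
      using rep_coordinates gen_mem by blast
    then show "\<exists>V g. coordinate_gen m V g \<and> x \<in> V" unfolding coordinate_gen_def by blast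
  qed
qed

section \<open>The hyperplane sheaf of a projective set and its powers\<close>

locale projective_set =
  fixes m :: nat and C :: "'k::field point set"
  assumes subset: "C \<subseteq> proj_space m"

sublocale projective_set \<subseteq> H: line_pullback "variety m C" "variety m (proj_space m)" "twisting_sheaf m 1"
    cone_value "coordinate_gen m" "\<lambda>P. P" 1
  by (intro line_pullback.intro function_space_variety line_sheaf_twisting line_pullback_axioms.intro
    space_morphism_inclusion subset)

context projective_set
begin

lemma in_proj: "P \<in> C \<Longrightarrow> P \<in> proj_space m"
  using subset by blast

lemma hyperplane_sheaf_eq: "hyperplane_sheaf m C = H.sheaf"
  by (simp add: hyperplane_sheaf_def)

lemma line_sheaf_hyperplane: "line_sheaf (variety m C) (hyperplane_sheaf m C) H.pullback_ev H.pullback_gen"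
  unfolding hyperplane_sheaf_eq by (rule H.line_sheaf_pullback)

text \<open>The trivialisations inherited from projective space are again given by coordinates, the
  exponent being 1.\<close>

lemma pullback_gen_iff:
  "H.pullback_gen V g \<longleftrightarrow> (\<exists>i\<le>m. V = nonvanishing C (coordinate i) \<and> g = (\<lambda>P. rep P i))"
proof -
  have "H.pre (nonvanishing (proj_space m) F) = nonvanishing C F" for F
    using in_proj by (auto simp: nonvanishing_def)
  then show ?thesis unfolding H.pullback_gen_def coordinate_gen_def variety_simps topspace_zariski power_one_right
    by auto
qed

lemma openin_C: "openin (zariski m C) C"
  using openin_topspace[of "zariski m C"] by simp

lemma coord_section:
  assumes "i \<le> m"
  shows "coord_section m C i \<in> carrier (sections (hyperplane_sheaf m C) C)"
    and "P \<in> C \<Longrightarrow> H.point_value P (coord_section m C i P) = rep P i"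
proof -
  let ?U = "proj_space m"
  let ?s = "\<lambda>v\<in>\<Union>?U. v i"
  let ?u = "{#(\<lambda>P\<in>C. 1, [?s])#}"
  have U: "openin (zariski m ?U) ?U" using openin_topspace[of "zariski m ?U"] by simp
  have "?s \<in> carrier (sections (twisting_sheaf m 1) ?U)"
  proof (rule twisting_sectionI)
    fix P assume "P \<in> ?U"
    moreover have "\<forall>Q\<in>?U. \<forall>v\<in>Q. value_at 1 v \<noteq> 0 \<and> ?s v = value_at (coordinate i) v / value_at 1 v" by auto
    ultimately show "\<exists>V e F G. openin (zariski m ?U) V \<and> P \<in> V \<and> V \<subseteq> ?U \<and> F \<in> forms m (e + 1) \<and> G \<in> forms m e \<and>
       (\<forall>Q\<in>V. \<forall>v\<in>Q. value_at G v \<noteq> 0 \<and> ?s v = value_at F v / value_at G v)"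
      using U forms_coordinate[OF assms, of 1 1] forms_one[of m]
      by (intro exI[of _ ?U] exI[of _ 0] exI[of _ "coordinate i"] exI[of _ 1] conjI) simp_all
  qed simp
  then have u: "?u \<in> H.sums_on C ?U"
    using regular_const[OF openin_C, of 1] by (simp add: formal_sums_def)
  have *: "openin (topo (variety m C)) C" "openin (topo (variety m ?U)) ?U" "(\<lambda>P. P) ` C \<subseteq> ?U"
    using openin_C U subset by auto
  show "coord_section m C i \<in> carrier (sections (hyperplane_sheaf m C) C)"
    unfolding coord_section_def hyperplane_sheaf_eq using * u by (rule H.section_of_closed)
  show "H.point_value P (coord_section m C i P) = rep P i" if P: "P \<in> C"
    unfolding coord_section_def H.point_value_section_of[OF * u P]
    using P rep_in[OF in_proj[OF P]] in_proj[OF P] by (auto simp: cone_value_def)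
qed

end

text \<open>The exponent is a parameter of its own so that two powers of the same sheaf can be
  interpreted side by side; the uniqueness argument uses exponents n and 0 together.\<close>

locale projective_set_power = projective_set + fixes n :: nat

sublocale projective_set_power \<subseteq> L: line_pullback "variety m C" "variety m C" "hyperplane_sheaf m C"
    H.pullback_ev H.pullback_gen "\<lambda>P. P" n
  by (intro line_pullback.intro function_space_variety line_sheaf_hyperplane line_pullback_axioms.intro
    space_morphism_inclusion order_refl)

context projective_set_power
begin

text \<open>Under evaluation tensors become products and the restricted coordinates become the
  entries of the chosen vector, so each monomial goes to its value. This translates projective
  normality into a statement about values of forms.\<close>

lemma restrict_form:
  assumes F: "F \<in> forms m n" and P: "P \<in> C"
  shows "L.point_value P (restrict_form m C n F P) = value_at F (rep P)"
proof -
  let ?t = "\<lambda>\<alpha>. (\<lambda>P\<in>C. to_ac (Poly_Mapping.lookup F \<alpha>), map (coord_section m C) (monomial_factors m \<alpha>))"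
  let ?u = "image_mset ?t (mset_set (Poly_Mapping.keys F))"
  have k: "Poly_Mapping.keys \<alpha> \<subseteq> {..m}" "monomial_degree \<alpha> = n" if "\<alpha> \<in> Poly_Mapping.keys F" for \<alpha>
    using F that by (auto simp: forms_iff)
  have C: "openin (topo (variety m C)) C" using openin_C by simp
  \<comment> \<open>Every monomial of \<open>F\<close> has degree n, so each list of factors has the
    required length.\<close>
  have "?u \<in> L.sums_on C C"
    using k set_monomial_factors[of m] coord_section(1) regular_const[OF openin_C]
    by (auto simp: formal_sums_def length_monomial_factors subset_iff)
  then have "L.point_value P (restrict_form m C n F P) = L.section_value C ?u P"
    unfolding restrict_form_def using C P by (intro L.point_value_section_of) auto
  also have "\<dots> = (\<Sum>\<alpha>\<in>Poly_Mapping.keys F. to_ac (Poly_Mapping.lookup F \<alpha>) *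
      (\<Prod>s\<leftarrow>map (coord_section m C) (monomial_factors m \<alpha>). H.point_value P (s P)))"
    using P by (simp add: L.section_value_def formal_value_def sum_unfold_sum_mset multiset.map_comp o_def case_prod_beta)
  also have "\<dots> = (\<Sum>\<alpha>\<in>Poly_Mapping.keys F. to_ac (Poly_Mapping.lookup F \<alpha>) * monomial_value \<alpha> (rep P))"
  proof (rule sum.cong[OF HOL.refl])
    fix \<alpha> assume \<alpha>: "\<alpha> \<in> Poly_Mapping.keys F"
    have "map (\<lambda>i. H.point_value P (coord_section m C i P)) (monomial_factors m \<alpha>) = map (rep P) (monomial_factors m \<alpha>)"
      using coord_section(2)[OF _ P] set_monomial_factors[of m \<alpha>] by auto
    from arg_cong[OF this, of prod_list]
    show "to_ac (Poly_Mapping.lookup F \<alpha>) *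
        (\<Prod>s\<leftarrow>map (coord_section m C) (monomial_factors m \<alpha>). H.point_value P (s P)) =
        to_ac (Poly_Mapping.lookup F \<alpha>) * monomial_value \<alpha> (rep P)"
      using prod_monomial_factors[OF k(1)[OF \<alpha>], of "rep P"] by (simp add: o_def)
  qed
  finally show ?thesis by (simp add: value_at_eq)
qed

end

section \<open>Morphisms given by forms\<close>

locale projective_morphism = A: projective_set_power m C n + B: projective_set r D
  for m r :: nat and C D :: "'k::field point set" and n +
  fixes \<phi> :: "'k point \<Rightarrow> 'k point"
  assumes morphism: "space_morphism (variety m C) (variety r D) \<phi>"

sublocale projective_morphism \<subseteq> Q: line_pullback "variety m C" "variety r D" "hyperplane_sheaf r D"
    B.H.pullback_ev B.H.pullback_gen \<phi> 1
  by (intro line_pullback.intro function_space_variety B.line_sheaf_hyperplane line_pullback_axioms.intro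
    morphism)

context projective_morphism
begin

text \<open>Two vectors on the ray \<phi>(P) are compared: the one computed by the forms and the
  chosen one. Their ratio h depends on the choices at P and \<phi>(P), so nothing but h(P) \<noteq>
  0 is demanded of it.\<close>

definition represents :: "(nat \<Rightarrow> 'k mpoly) \<Rightarrow> ('k point \<Rightarrow> 'k alg_closure) \<Rightarrow> bool" where
  "represents F h \<longleftrightarrow> (\<forall>i\<le>r. F i \<in> forms m n) \<and>
     (\<forall>P\<in>C. h P \<noteq> 0 \<and> (\<forall>i\<le>r. value_at (F i) (rep P) = h P * rep (\<phi> P) i))"

lemma phi_mem: "P \<in> C \<Longrightarrow> \<phi> P \<in> D"
  using Q.phi_in[of P] by simp

lemma nonzero_coordinate:
  assumes "P \<in> C" obtains i where "i \<le> m" "rep P i \<noteq> 0"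
  using rep_coordinates(1)[OF A.in_proj[OF assms]] by blast

lemma nonzero_image_coordinate:
  assumes "P \<in> C" obtains i where "i \<le> r" "rep (\<phi> P) i \<noteq> 0"
  using rep_coordinates(1)[OF B.in_proj[OF phi_mem[OF assms]]] by blast

lemma coordinate_nonvanishing:
  assumes "j \<le> m" "P \<in> C" shows "P \<in> nonvanishing C (coordinate j) \<longleftrightarrow> rep P j \<noteq> 0"
  using mem_nonvanishing_iff[OF A.subset forms_coordinate[OF assms(1), of 1 1] assms(2)] by simp

lemma image_coordinate_nonvanishing:
  assumes "i \<le> r" "P \<in> C" shows "\<phi> P \<in> nonvanishing D (coordinate i) \<longleftrightarrow> rep (\<phi> P) i \<noteq> 0"
  using mem_nonvanishing_iff[OF B.subset forms_coordinate[OF assms(1), of 1 1] phi_mem[OF assms(2)]] by simp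

lemma gen_C: "j \<le> m \<Longrightarrow> A.H.pullback_gen (nonvanishing C (coordinate j)) (\<lambda>P. rep P j)"
  using A.pullback_gen_iff by blast

lemma gen_D: "i \<le> r \<Longrightarrow> B.H.pullback_gen (nonvanishing D (coordinate i)) (\<lambda>P. rep P i)"
  using B.pullback_gen_iff by blast

text \<open>Near a point choose j with X_j nonzero at it and i with X_i nonzero at its image. With
  (\<phi> z)_i the i-th entry of the chosen vector, h (\<phi> z)_i is the value of
  \<open>F i\<close>. So h carries a (\<phi> z)_i to a (\<open>F i\<close> / X_j^n) X_j^n, and
  dividing by h carries a X_j^n to a (X_j^n / \<open>F i\<close>) (\<phi> z)_i. Both quotients are
  regular where their denominators are nonzero.\<close>

lemma represents_imp_sheaf_iso:
  assumes "represents F h"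
  shows "sheaf_iso (variety m C) Q.sheaf A.L.sheaf"
proof (rule sheaf_isoI)
  let ?Z = "variety m C"
  interpret LQ: line_sheaf ?Z Q.sheaf Q.pullback_ev Q.pullback_gen by (rule Q.line_sheaf_pullback)
  interpret LL: line_sheaf ?Z A.L.sheaf A.L.pullback_ev A.L.pullback_gen by (rule A.L.line_sheaf_pullback)
  show "valued_sheaf ?Z Q.sheaf Q.pullback_ev" "valued_sheaf ?Z A.L.sheaf A.L.pullback_ev"
    by (rule LQ.valued_sheaf_axioms LL.valued_sheaf_axioms)+
  have F: "\<And>i. i \<le> r \<Longrightarrow> F i \<in> forms m n" and h: "\<And>P. P \<in> C \<Longrightarrow> h P \<noteq> 0"
    and Fh: "\<And>P i. P \<in> C \<Longrightarrow> i \<le> r \<Longrightarrow> value_at (F i) (rep P) = h P * rep (\<phi> P) i"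
    using assms by (auto simp: represents_def)
  show "h x \<noteq> 0" if "x \<in> topspace (topo ?Z)" for x using that h by simp
  fix U assume U: "openin (topo ?Z) U"
  have UC: "x \<in> C" if "x \<in> U" for x using that openin_subset[OF U] by auto
  note open_C = openin_nonvanishing[of _ m _ C]
  {
    fix s assume s: "s \<in> carrier (sections Q.sheaf U)"
    show "\<exists>t\<in>carrier (sections A.L.sheaf U). \<forall>x\<in>U. A.L.pullback_ev U t x = h x * Q.pullback_ev U s x"
    proof (rule A.L.pullback_section_exists[OF U])
      fix x assume x: "x \<in> U"
      note xC = UC[OF x]
      obtain j where j: "j \<le> m" "rep x j \<noteq> 0" using nonzero_coordinate[OF xC] .
      obtain i where i: "i \<le> r" "rep (\<phi> x) i \<noteq> 0" using nonzero_image_coordinate[OF xC] .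
      let ?V = "nonvanishing C (coordinate j)"
      have V: "openin (zariski m C) ?V" by (rule open_C[OF forms_coordinate[OF j(1)]])
      have g: "Q.pullback_gen (Q.pre (nonvanishing D (coordinate i))) (\<lambda>P. rep (\<phi> P) i ^ 1)"
        unfolding Q.pullback_gen_def using gen_D[OF i(1)] by blast
      have xg: "x \<in> Q.pre (nonvanishing D (coordinate i))"
        using xC i image_coordinate_nonvanishing by simp
      from LQ.gen_local[OF U s g x xg] obtain W a where W': "openin (topo ?Z) W" "x \<in> W"
        "W \<subseteq> U \<inter> Q.pre (nonvanishing D (coordinate i))" "a \<in> regular ?Z W"
        "\<forall>z\<in>W. Q.point_value z (s z) = a z * rep (\<phi> z) i ^ 1"
        by (elim exE conjE) (rule that)
      then have W: "openin (topo ?Z) W" "x \<in> W" "W \<subseteq> U" "a \<in> regular ?Z W"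
        "\<And>z. z \<in> W \<Longrightarrow> Q.point_value z (s z) = a z * rep (\<phi> z) i"
        by simp_all
      \<comment> \<open>This is X_j^n; its degree matches that of \<open>F i\<close>, and its value
        is the generator of the target sheaf.\<close>
      let ?X = "Poly_Mapping.single (Poly_Mapping.single j n) 1 :: 'k mpoly"
      define q where "q = (\<lambda>P\<in>?V. value_at (F i) (rep P) / value_at ?X (rep P))"
      have nz: "rep z j \<noteq> 0" if "z \<in> ?V" for z
        using that coordinate_nonvanishing[OF j(1), of z] by (auto simp: nonvanishing_def)
      have q: "q \<in> regular ?Z ?V"
        unfolding q_def by (rule regular_quotient[OF A.subset V F[OF i(1)] forms_coordinate[OF j(1)]]) (use nz in simp)
      have "openin (topo ?Z) (W \<inter> ?V)" "x \<in> W \<inter> ?V" "W \<inter> ?V \<subseteq> U" "(\<lambda>P. P) ` (W \<inter> ?V) \<subseteq> ?V"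
        using W V j coordinate_nonvanishing[OF j(1) xC] by auto
      moreover have "(\<lambda>z\<in>W \<inter> ?V. a z * q z) \<in> regular ?Z (W \<inter> ?V)"
        using W(1,4) V q by (intro A.H.Z.regular_mult_Int) simp_all
      moreover have "h z * Q.point_value z (s z) = (\<lambda>z\<in>W \<inter> ?V. a z * q z) z * rep z j ^ n" if z: "z \<in> W \<inter> ?V" for z
      proof -
        have "z \<in> C" using z UC W(3) by blast
        then show ?thesis using W(5)[of z] z nz[of z] Fh[OF _ i(1), of z] by (simp add: q_def)
      qed
      ultimately show "\<exists>W V g a. openin (topo ?Z) W \<and> x \<in> W \<and> W \<subseteq> U \<and> (\<lambda>P. P) ` W \<subseteq> V \<and>
         A.H.pullback_gen V g \<and> a \<in> regular ?Z W \<and> (\<forall>z\<in>W. h z * Q.point_value z (s z) = a z * g z ^ n)"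
        using gen_C[OF j(1)]
        by (intro exI[of _ "W \<inter> ?V"] exI[of _ ?V] exI[of _ "\<lambda>P. rep P j"] exI[of _ "\<lambda>z\<in>W \<inter> ?V. a z * q z"] conjI ballI)
    qed
  next
    fix t assume t: "t \<in> carrier (sections A.L.sheaf U)"
    \<comment> \<open>The preimage of t is found by prescribing its values, t divided by h.\<close>
    have "\<exists>s\<in>carrier (sections Q.sheaf U). \<forall>x\<in>U. Q.pullback_ev U s x = A.L.pullback_ev U t x / h x"
    proof (rule Q.pullback_section_exists[OF U])
      fix x assume x: "x \<in> U"
      note xC = UC[OF x]
      obtain j where j: "j \<le> m" "rep x j \<noteq> 0" using nonzero_coordinate[OF xC] .
      obtain i where i: "i \<le> r" "rep (\<phi> x) i \<noteq> 0" using nonzero_image_coordinate[OF xC] .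
      let ?V = "nonvanishing D (coordinate i)"
      have V: "openin (zariski m C) (Q.pre ?V)"
        using Q.pre_open[of ?V] openin_nonvanishing[OF forms_coordinate[OF i(1)], of D] by simp
      have g: "A.L.pullback_gen (A.L.pre (nonvanishing C (coordinate j))) (\<lambda>P. rep P j ^ n)"
        unfolding A.L.pullback_gen_def using gen_C[OF j(1)] by blast
      have xg: "x \<in> A.L.pre (nonvanishing C (coordinate j))"
        using xC j coordinate_nonvanishing by simp
      from LL.gen_local[OF U t g x xg] obtain W a where W': "openin (topo ?Z) W" "x \<in> W"
        "W \<subseteq> U \<inter> A.L.pre (nonvanishing C (coordinate j))" "a \<in> regular ?Z W"
        "\<forall>z\<in>W. A.L.point_value z (t z) = a z * rep z j ^ n"
        by (elim exE conjE) (rule that)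
      then have W: "openin (topo ?Z) W" "x \<in> W" "W \<subseteq> U" "a \<in> regular ?Z W"
        "\<And>z. z \<in> W \<Longrightarrow> A.L.point_value z (t z) = a z * rep z j ^ n"
        by simp_all
      let ?X = "Poly_Mapping.single (Poly_Mapping.single j n) 1 :: 'k mpoly"
      define q where "q = (\<lambda>P\<in>Q.pre ?V. value_at ?X (rep P) / value_at (F i) (rep P))"
      have nz: "z \<in> C" "rep (\<phi> z) i \<noteq> 0" if "z \<in> Q.pre ?V" for z
        using that image_coordinate_nonvanishing[OF i(1), of z] by auto
      \<comment> \<open>Here h being nowhere zero is used: \<open>F i\<close> vanishes only where
        the i-th coordinate of the image does.\<close>
      have "value_at (F i) (rep z) \<noteq> 0" if "z \<in> Q.pre ?V" for z
        using Fh[OF nz(1)[OF that] i(1)] h[OF nz(1)[OF that]] nz(2)[OF that] by simp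
      then have q: "q \<in> regular ?Z (Q.pre ?V)"
        unfolding q_def by (rule regular_quotient[OF A.subset V forms_coordinate[OF j(1)] F[OF i(1)]])
      let ?N = "W \<inter> Q.pre ?V"
      have "openin (topo ?Z) ?N" "x \<in> ?N" "?N \<subseteq> U" "\<phi> ` ?N \<subseteq> ?V"
        using W V i image_coordinate_nonvanishing[OF i(1) xC] xC by auto
      moreover have "(\<lambda>z\<in>?N. a z * q z) \<in> regular ?Z ?N"
        using W(1,4) V q by (intro A.H.Z.regular_mult_Int) simp_all
      moreover have "A.L.point_value z (t z) / h z = (\<lambda>z\<in>?N. a z * q z) z * rep (\<phi> z) i ^ 1" if z: "z \<in> ?N" for z
      proof -
        have *: "z \<in> Q.pre ?V" "z \<in> W" using z by blast+
        have "q z = rep z j ^ n / (h z * rep (\<phi> z) i)"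
          using *(1) Fh[OF nz(1)[OF *(1)] i(1)] by (simp add: q_def)
        then show ?thesis using W(5)[OF *(2)] z nz[OF *(1)] h[OF nz(1)[OF *(1)]] by (simp add: field_simps)
      qed
      ultimately show "\<exists>W V g a. openin (topo ?Z) W \<and> x \<in> W \<and> W \<subseteq> U \<and> \<phi> ` W \<subseteq> V \<and>
         B.H.pullback_gen V g \<and> a \<in> regular ?Z W \<and> (\<forall>z\<in>W. A.L.point_value z (t z) / h z = a z * g (\<phi> z) ^ 1)"
        using gen_D[OF i(1)]
        by (intro exI[of _ ?N] exI[of _ ?V] exI[of _ "\<lambda>P. rep P i"] exI[of _ "\<lambda>z\<in>?N. a z * q z"] conjI ballI)
    qed
    then obtain s where s: "s \<in> carrier (sections Q.sheaf U)" "\<forall>x\<in>U. Q.pullback_ev U s x = A.L.pullback_ev U t x / h x"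
      by blast
    have "\<forall>x\<in>U. A.L.pullback_ev U t x = h x * Q.pullback_ev U s x"
    proof
      fix x assume x: "x \<in> U"
      then show "A.L.pullback_ev U t x = h x * Q.pullback_ev U s x" using s(2) h[OF UC[OF x]] by simp
    qed
    with s(1) show "\<exists>s\<in>carrier (sections Q.sheaf U). \<forall>x\<in>U. A.L.pullback_ev U t x = h x * Q.pullback_ev U s x"
      by blast
  }
qed

text \<open>The section is the pullback of the coordinate X_i of the target, that is 1 \<otimes>
  X_i. These are the global sections that an isomorphism will turn into the defining forms.\<close>

lemma image_coordinate_section:
  assumes "i \<le> r"
  shows "\<exists>s\<in>carrier (sections Q.sheaf C). \<forall>P\<in>C. Q.point_value P (s P) = rep (\<phi> P) i"
proof -
  let ?u = "{#(\<lambda>P\<in>C. 1, [coord_section r D i])#}"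
  have u: "?u \<in> Q.sums_on C D"
    using regular_const[OF A.openin_C, of 1] B.coord_section(1)[OF assms] by (simp add: formal_sums_def)
  have *: "openin (topo (variety m C)) C" "openin (topo (variety r D)) D" "\<phi> ` C \<subseteq> D"
    using A.openin_C B.openin_C phi_mem by auto
  show ?thesis
  proof (intro bexI ballI)
    show "Q.section_of C D ?u \<in> carrier (sections Q.sheaf C)" using * u by (rule Q.section_of_closed)
    show "Q.point_value P (Q.section_of C D ?u P) = rep (\<phi> P) i" if P: "P \<in> C" for P
      unfolding Q.point_value_section_of[OF * u P] using P B.coord_section(2)[OF assms phi_mem[OF P]] by simp
  qed
qed

lemma sheaf_iso_imp_represents:
  assumes "sheaf_iso (variety m C) Q.sheaf A.L.sheaf"
    and normal: "restrict_form m C n ` forms m n = carrier (sections A.L.sheaf C)"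
  shows "\<exists>F h. represents F h"
proof -
  obtain h where h: "\<And>x. x \<in> topspace (topo (variety m C)) \<Longrightarrow> h x \<noteq> 0"
    and ev: "\<And>U s. openin (topo (variety m C)) U \<Longrightarrow> s \<in> carrier (sections Q.sheaf U) \<Longrightarrow>
      \<exists>t\<in>carrier (sections A.L.sheaf U). \<forall>x\<in>U. A.L.pullback_ev U t x = h x * Q.pullback_ev U s x"
    by (rule sheaf_iso_factor[OF Q.line_sheaf_pullback A.L.line_sheaf_pullback assms(1)]) (rule that)
  have "\<exists>G. G \<in> forms m n \<and> (\<forall>P\<in>C. value_at G (rep P) = h P * rep (\<phi> P) i)" if i: "i \<le> r" for i
  proof -
    obtain s where s: "s \<in> carrier (sections Q.sheaf C)" "\<forall>P\<in>C. Q.point_value P (s P) = rep (\<phi> P) i"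
      using image_coordinate_section[OF i] by blast
    have "openin (topo (variety m C)) C" using A.openin_C by simp
    from ev[OF this s(1)] obtain t where t: "t \<in> carrier (sections A.L.sheaf C)"
        "\<forall>P\<in>C. A.L.point_value P (t P) = h P * Q.point_value P (s P)"
      by (elim bexE) (rule that)
    have "t \<in> restrict_form m C n ` forms m n" unfolding normal by (rule t(1))
    then obtain G where G: "G \<in> forms m n" "t = restrict_form m C n G" by blast
    then have "\<forall>P\<in>C. value_at G (rep P) = h P * rep (\<phi> P) i"
      using t(2) s(2) A.restrict_form[OF G(1)] by simp
    with G(1) show ?thesis by blast
  qed
  then obtain F where "\<forall>i\<le>r. F i \<in> forms m n \<and> (\<forall>P\<in>C. value_at (F i) (rep P) = h P * rep (\<phi> P) i)"
    by metis
  then have "represents F h" using h by (simp add: represents_def)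
  then show ?thesis by blast
qed

text \<open>Completeness makes the tuple of values a nonzero vector at every point; it then lies on
  the ray \<phi>(P), and h(P) is its ratio to the chosen vector. Conversely a nonzero h(P) excludes
  exceptional points and yields the ray, because rescaling the argument only rescales the
  tuple.\<close>

lemma complete_tuple_iff:
  assumes "C \<noteq> {}"
  shows "complete_tuple m C r \<phi> n f \<longleftrightarrow> (\<exists>F h. represents F h \<and> (\<forall>i\<le>r. f i = residue_class m C (F i)))"
proof
  assume f: "complete_tuple m C r \<phi> n f"
  then have "\<forall>i\<le>r. \<exists>G. G \<in> forms m n \<and> f i = residue_class m C G"
    by (auto simp: complete_tuple_def defining_polynomials_def)
  then obtain F where F: "\<And>i. i \<le> r \<Longrightarrow> F i \<in> forms m n" "\<And>i. i \<le> r \<Longrightarrow> f i = residue_class m C (F i)"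
    by metis
  have cv: "class_value (f i) v = value_at (F i) v" if "i \<le> r" "P \<in> C" "v \<in> P" for i P v
    using class_value_residue_class[OF that(2,3)] F(2)[OF that(1)] by simp
  have "\<exists>c. c \<noteq> 0 \<and> (\<forall>i\<le>r. value_at (F i) (rep P) = c * rep (\<phi> P) i)" if P: "P \<in> C" for P
  proof -
    note PP = A.in_proj[OF P] and QQ = B.in_proj[OF phi_mem[OF P]]
    obtain v i where v: "v \<in> P" "i \<le> r" "class_value (f i) v \<noteq> 0"
      using f P by (auto simp: complete_tuple_def exceptional_set_def)
    obtain c where c: "c \<noteq> 0" "v = (\<lambda>i. c * rep P i)" using point_scale[OF PP rep_in[OF PP] v(1)] .
    \<comment> \<open>Completeness provides some vector of P at which the tuple is nonzero;
      homogeneity transfers this to the chosen one.\<close>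
    have "class_value (f i) (rep P) \<noteq> 0"
      using v(3) cv[OF v(2) P v(1)] cv[OF v(2) P rep_in[OF PP]] c forms_value_scale[OF F(1)[OF v(2)]] by auto
    then have eq: "\<phi> P = ray (\<lambda>i. if i \<le> r then class_value (f i) (rep P) else 0)"
      using f P rep_in[OF PP] v(2) unfolding complete_tuple_def defining_polynomials_def by blast
    obtain k where k: "k \<noteq> 0" "(\<lambda>i. if i \<le> r then class_value (f i) (rep P) else 0) = (\<lambda>i. k * rep (\<phi> P) i)"
      using point_scale[OF QQ rep_in[OF QQ]] ray_self eq by metis
    have "value_at (F i) (rep P) = k * rep (\<phi> P) i" if "i \<le> r" for i
      using fun_cong[OF k(2), of i] cv[OF that P rep_in[OF PP]] that by simp
    with k(1) show ?thesis by blast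
  qed
  then obtain h where "\<forall>P\<in>C. h P \<noteq> 0 \<and> (\<forall>i\<le>r. value_at (F i) (rep P) = h P * rep (\<phi> P) i)" by metis
  then have "represents F h" using F(1) by (simp add: represents_def)
  then show "\<exists>F h. represents F h \<and> (\<forall>i\<le>r. f i = residue_class m C (F i))" using F(2) by blast
next
  assume "\<exists>F h. represents F h \<and> (\<forall>i\<le>r. f i = residue_class m C (F i))"
  then obtain F h where R: "represents F h" and f: "\<And>i. i \<le> r \<Longrightarrow> f i = residue_class m C (F i)" by blast
  have F: "\<And>i. i \<le> r \<Longrightarrow> F i \<in> forms m n" and h: "\<And>P. P \<in> C \<Longrightarrow> h P \<noteq> 0"
    and Fh: "\<And>P i. P \<in> C \<Longrightarrow> i \<le> r \<Longrightarrow> value_at (F i) (rep P) = h P * rep (\<phi> P) i"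
    using R by (auto simp: represents_def)
  have cv: "class_value (f i) v = value_at (F i) v" if "i \<le> r" "P \<in> C" "v \<in> P" for i P v
    using class_value_residue_class[OF that(2,3)] f[OF that(1)] by simp
  have nz: "\<exists>i\<le>r. value_at (F i) (rep P) \<noteq> 0" if "P \<in> C" for P
    using nonzero_image_coordinate[OF that] Fh[OF that] h[OF that] by (metis mult_eq_0_iff)
  have "exceptional_set C r f = {}"
  proof -
    have "\<not> (\<forall>v\<in>P. \<forall>i\<le>r. class_value (f i) v = 0)" if P: "P \<in> C" for P
      using nz[OF P] cv[OF _ P rep_in[OF A.in_proj[OF P]]] rep_in[OF A.in_proj[OF P]] by metis
    then show ?thesis by (auto simp: exceptional_set_def)
  qed
  moreover have "\<exists>i\<le>r. f i \<noteq> \<zero>\<^bsub>coord_ring m C\<^esub>"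
  proof -
    \<comment> \<open>The tuple must have a nonzero class, and a point of \<open>C\<close> is needed
      to witness it: a form that is nonzero there lies outside the ideal, which is the zero of the
      quotient ring.\<close>
    obtain P where P: "P \<in> C" using assms by blast
    obtain i where i: "i \<le> r" "value_at (F i) (rep P) \<noteq> 0" using nz[OF P] by blast
    have "F i \<in> f i" using f[OF i(1)] mem_residue_class_self by blast
    moreover have "F i \<notin> curve_ideal m C"
      using i(2) P rep_in[OF A.in_proj[OF P]] by (auto simp: curve_ideal_def)
    ultimately show ?thesis using i(1) by (auto simp: coord_ring_def FactRing_def)
  qed
  moreover have "\<phi> P = ray (\<lambda>i. if i \<le> r then class_value (f i) v else 0)" if P: "P \<in> C" and v: "v \<in> P" for P v
  proof -
    note PP = A.in_proj[OF P] and QQ = B.in_proj[OF phi_mem[OF P]]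
    obtain c where c: "c \<noteq> 0" "v = (\<lambda>i. c * rep P i)" using point_scale[OF PP rep_in[OF PP] v] .
    \<comment> \<open>Passing from the chosen vector to v = c times it multiplies forms of degree n
      by c^n, hence the factor c^n h(P).\<close>
    have "(\<lambda>i. if i \<le> r then class_value (f i) v else 0) = (\<lambda>i. (c ^ n * h P) * rep (\<phi> P) i)"
    proof
      fix i
      show "(if i \<le> r then class_value (f i) v else 0) = (c ^ n * h P) * rep (\<phi> P) i"
      proof (cases "i \<le> r")
        case True
        then show ?thesis
          using cv[OF True P v] forms_value_scale[OF F[OF True], of c "rep P"] Fh[OF P True] c(2) by simp
      next
        case False
        \<comment> \<open>Beyond index r the tuple is padded with 0, and so are the vectors of
          points of projective r-space.\<close>
        then show ?thesis using rep_coordinates(2)[OF QQ, of i] by simp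
      qed
    qed
    moreover have "(\<lambda>i. (c ^ n * h P) * rep (\<phi> P) i) \<in> \<phi> P"
    proof -
      have "(\<lambda>i. (c ^ n * h P) * rep (\<phi> P) i) \<in> ray (rep (\<phi> P))"
        unfolding ray_def using c(1) h[OF P] by (intro CollectI exI[of _ "c ^ n * h P"]) simp
      then show ?thesis by (simp only: ray_rep[OF QQ])
    qed
    ultimately show ?thesis using point_eq_ray[OF QQ] by metis
  qed
  ultimately show "complete_tuple m C r \<phi> n f"
    unfolding complete_tuple_def defining_polynomials_def using F f by blast
qed

text \<open>The chosen vectors cancel in h' / h: where \<open>F i\<close> is nonzero it equals
  \<open>G i\<close> / \<open>F i\<close>, a quotient of forms of degree n. So it is a global
  section of the power with exponent 0, and projective normality in degree 0 makes it a constant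
  from k.\<close>

lemma represents_ratio:
  assumes "represents F h" "represents G h'"
    and normal: "restrict_form m C 0 ` forms m 0 =
      carrier (sections (tensor_power (variety m C) (hyperplane_sheaf m C) 0) C)"
  shows "\<exists>c. \<forall>P\<in>C. h' P = to_ac c * h P"
proof -
  \<comment> \<open>A second copy of the theory of powers, now with exponent 0.\<close>
  interpret N: projective_set_power m C 0 by unfold_locales
  let ?Z = "variety m C"
  have F: "\<And>i. i \<le> r \<Longrightarrow> F i \<in> forms m n" and h: "\<And>P. P \<in> C \<Longrightarrow> h P \<noteq> 0"
    and Fh: "\<And>P i. P \<in> C \<Longrightarrow> i \<le> r \<Longrightarrow> value_at (F i) (rep P) = h P * rep (\<phi> P) i"
    using assms(1) by (auto simp: represents_def)
  have G: "\<And>i. i \<le> r \<Longrightarrow> G i \<in> forms m n"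
    and Gh: "\<And>P i. P \<in> C \<Longrightarrow> i \<le> r \<Longrightarrow> value_at (G i) (rep P) = h' P * rep (\<phi> P) i"
    using assms(2) by (auto simp: represents_def)
  have C: "openin (topo ?Z) C" using A.openin_C by simp
  have "\<exists>\<sigma>\<in>carrier (sections N.L.sheaf C). \<forall>x\<in>C. N.L.point_value x (\<sigma> x) = h' x / h x"
  proof (rule N.L.pullback_section_exists[OF C])
    fix x assume x: "x \<in> C"
    obtain j where j: "j \<le> m" "rep x j \<noteq> 0" using nonzero_coordinate[OF x] .
    obtain i where i: "i \<le> r" "rep (\<phi> x) i \<noteq> 0" using nonzero_image_coordinate[OF x] .
    let ?V = "nonvanishing C (coordinate j)" and ?W = "nonvanishing C (F i)"
    \<comment> \<open>The set \<open>?V\<close> supplies a trivialisation of the hyperplane sheaf,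
      whose generator enters only with exponent 0; on \<open>?W\<close> the quotient
      \<open>G i\<close> / \<open>F i\<close> is defined.\<close>
    let ?N = "?V \<inter> ?W"
    have N: "openin (zariski m C) ?N"
      using openin_nonvanishing[OF forms_coordinate[OF j(1)]] openin_nonvanishing[OF F[OF i(1)]] by blast
    have nz: "z \<in> C" "value_at (F i) (rep z) \<noteq> 0" if "z \<in> ?W" for z
      using that mem_nonvanishing_iff[OF A.subset F[OF i(1)], of z] by (auto simp: nonvanishing_def)
    define q where "q = (\<lambda>P\<in>?N. value_at (G i) (rep P) / value_at (F i) (rep P))"
    have "q \<in> regular ?Z ?N"
      unfolding q_def by (rule regular_quotient[OF A.subset N G[OF i(1)] F[OF i(1)]]) (use nz in blast)
    moreover have "x \<in> ?N" "?N \<subseteq> C" "(\<lambda>P. P) ` ?N \<subseteq> ?V"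
      using x i j coordinate_nonvanishing[OF j(1) x] mem_nonvanishing_iff[OF A.subset F[OF i(1)] x] Fh[OF x i(1)] h[OF x]
      by (auto simp: nonvanishing_def)
    moreover have "h' z / h z = q z * rep z j ^ 0" if z: "z \<in> ?N" for z
    proof -
      have "z \<in> C" "h z * rep (\<phi> z) i \<noteq> 0" using z nz[of z] Fh[OF _ i(1), of z] by auto
      then show ?thesis using z Fh[of z i] Gh[of z i] i(1) by (simp add: q_def)
    qed
    ultimately show "\<exists>W V g a. openin (topo ?Z) W \<and> x \<in> W \<and> W \<subseteq> C \<and> (\<lambda>P. P) ` W \<subseteq> V \<and>
         A.H.pullback_gen V g \<and> a \<in> regular ?Z W \<and> (\<forall>z\<in>W. h' z / h z = a z * g z ^ 0)"
      using N gen_C[OF j(1)] unfolding variety_simps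
      by (intro exI[of _ ?N] exI[of _ ?V] exI[of _ "\<lambda>P. rep P j"] exI[of _ q] conjI ballI)
  qed
  then obtain \<sigma> where \<sigma>: "\<sigma> \<in> carrier (sections N.L.sheaf C)" "\<forall>x\<in>C. N.L.point_value x (\<sigma> x) = h' x / h x"
    by blast
  have "\<sigma> \<in> restrict_form m C 0 ` forms m 0" unfolding normal by (rule \<sigma>(1))
  then obtain K where K: "K \<in> forms m 0" "\<sigma> = restrict_form m C 0 K" by blast
  have "h' P = to_ac (Poly_Mapping.lookup K 0) * h P" if P: "P \<in> C" for P
  proof -
    have "value_at K (rep P) = h' P / h P" using \<sigma>(2) K(2) N.restrict_form[OF K(1) P] P by simp
    moreover have "value_at K (rep P) = to_ac (Poly_Mapping.lookup K 0)"
      by (subst forms_zero_degree[OF K(1)]) simp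
    ultimately show ?thesis using h[OF P] by (simp add: field_simps)
  qed
  then show ?thesis by blast
qed

end

text \<open>Every polynomial vanishes on the empty set, but a prime ideal is proper.\<close>

lemma projective_curve_nonempty:
  assumes "projective_curve m C" shows "C \<noteq> {}"
proof
  assume "C = {}"
  then have "geometric_ideal m C = carrier (poly_ring m)" by (simp add: geometric_ideal_def)
  moreover have "primeideal (geometric_ideal m C) (poly_ring m)" using assms unfolding projective_curve_def by (elim conjE)
  ultimately show False using primeideal.I_notcarr by metis
qed

theorem theorem4p1:
  fixes C1 C2 :: "'k::field point set"
    and \<phi> :: "'k point \<Rightarrow> 'k point"
    and m r n :: nat
  assumes "projective_curve m C1" and "projective_curve r C2"
    and "projectively_normal m C1" and "projectively_normal r C2"
    and "space_morphism (variety m C1) (variety r C2) \<phi>"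
  shows "((\<exists>f. complete_tuple m C1 r \<phi> n f) \<longleftrightarrow>
          sheaf_iso (variety m C1)
            (pullback (variety m C1) (variety r C2) \<phi> (hyperplane_sheaf r C2))
            (tensor_power (variety m C1) (hyperplane_sheaf m C1) n)) \<and>
         (\<forall>f g. complete_tuple m C1 r \<phi> n f \<and> complete_tuple m C1 r \<phi> n g \<longrightarrow>
            (\<exists>c::'k. c \<noteq> 0 \<and> (\<forall>i\<le>r. g i =
               residue_class m C1 (Poly_Mapping.single 0 c) \<otimes>\<^bsub>coord_ring m C1\<^esub> f i)))"
proof -
  have "C1 \<subseteq> proj_space m" "C2 \<subseteq> proj_space r" using assms(1,2) by (simp_all add: projective_curve_def)
  then interpret projective_morphism m r C1 C2 n \<phi>
    using assms(5) by unfold_locales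
  have C1: "C1 \<noteq> {}" using assms(1) by (rule projective_curve_nonempty)
  have normal: "restrict_form m C1 d ` forms m d =
      carrier (sections (tensor_power (variety m C1) (hyperplane_sheaf m C1) d) C1)" for d
    using assms(3) by (simp add: projectively_normal_def)
  have "(\<exists>f. complete_tuple m C1 r \<phi> n f) \<longleftrightarrow> (\<exists>F h. represents F h)"
  proof
    assume "\<exists>F h. represents F h"
    then obtain F h where "represents F h" by blast
    then have "complete_tuple m C1 r \<phi> n (\<lambda>i. residue_class m C1 (F i))"
      unfolding complete_tuple_iff[OF C1] by blast
    then show "\<exists>f. complete_tuple m C1 r \<phi> n f" by blast
  qed (unfold complete_tuple_iff[OF C1], blast)
  also have "\<dots> \<longleftrightarrow> sheaf_iso (variety m C1) Q.sheaf A.L.sheaf"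
    using represents_imp_sheaf_iso sheaf_iso_imp_represents normal by blast
  finally have iso: "(\<exists>f. complete_tuple m C1 r \<phi> n f) \<longleftrightarrow> sheaf_iso (variety m C1) Q.sheaf A.L.sheaf" .
  have "\<exists>c::'k. c \<noteq> 0 \<and> (\<forall>i\<le>r. g i = residue_class m C1 (Poly_Mapping.single 0 c) \<otimes>\<^bsub>coord_ring m C1\<^esub> f i)"
    if fg: "complete_tuple m C1 r \<phi> n f" "complete_tuple m C1 r \<phi> n g" for f g
  proof -
    obtain F h where F: "represents F h" "\<And>i. i \<le> r \<Longrightarrow> f i = residue_class m C1 (F i)"
      using fg(1) unfolding complete_tuple_iff[OF C1] by (elim exE conjE) (rule that, blast+)
    obtain G h' where G: "represents G h'" "\<And>i. i \<le> r \<Longrightarrow> g i = residue_class m C1 (G i)"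
      using fg(2) unfolding complete_tuple_iff[OF C1] by (elim exE conjE) (rule that, blast+)
    from represents_ratio[OF F(1) G(1) normal] obtain c where c: "\<forall>P\<in>C1. h' P = to_ac c * h P" ..
    \<comment> \<open>A zero constant would make h' vanish at a point of the nonempty curve.\<close>
    have "c \<noteq> 0" using c C1 G(1) by (auto simp: represents_def)
    moreover have "g i = residue_class m C1 (Poly_Mapping.single 0 c) \<otimes>\<^bsub>coord_ring m C1\<^esub> f i" if i: "i \<le> r" for i
    proof -
      have forms: "F i \<in> forms m n" "G i \<in> forms m n" using F(1) G(1) i by (auto simp: represents_def)
      \<comment> \<open>The identity is known at the chosen vectors; since \<open>F i\<close> and
        \<open>G i\<close> have the same degree, it extends along each ray and so to the whole
        cone.\<close>
      have "value_at (G i) v = value_at (Poly_Mapping.single 0 c * F i) v" if P: "P \<in> C1" "v \<in> P" for P v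
      proof -
        note PP = A.in_proj[OF P(1)]
        obtain k where "v = (\<lambda>i. k * rep P i)" using point_scale[OF PP rep_in[OF PP] P(2)] by metis
        moreover have "value_at (G i) (rep P) = to_ac c * value_at (F i) (rep P)"
          using F(1) G(1) c P(1) i by (simp add: represents_def)
        ultimately show ?thesis using forms by (simp add: forms_value_scale)
      qed
      then have "residue_class m C1 (G i) = residue_class m C1 (Poly_Mapping.single 0 c * F i)"
        using forms by (intro residue_class_eqI poly_ring_mult_closed poly_ring_closed forms_carrier)
      then show ?thesis
        using F(2)[OF i] G(2)[OF i] coord_ring_mult[OF poly_ring_closed(3) forms_carrier[OF forms(1)]] by simp
    qed
    ultimately show ?thesis by blast
  qed
  with iso show ?thesis by blast
qed

end
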